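(* Let $V$ be a $\mathcal{T}$-vertex algebra, let $A$ be an abelian group, let $2A=\{i+i\mid i\in A\}$, and let $\{M_i\}_{i\in A}$ be a set of $V$-modules in $\mathcal{T}$ such that $M_0=V$ and $\{M_i\}_{i\in2A}$ is $\mathcal{T}$-compatible. Given a one-dimensional $\mathcal{T}$-commutativity datum $\{\mathcal{I}_{i,j}^{i+j}\}_{i,j\in A}$, there exists a choice of nonzero elements $\{m^{i,j}_z\in\mathcal{I}_{i,j}^{i+j}\}_{i,j\in2A}$ that defines a $\mathcal{T}$-vertex algebra structure on $\bigoplus_{i\in2A}M_i$. In particular, evenness of the commutativity datum is automatic when $A$ is 2-divisible, for example when $A$ is a finite abelian group of odd order.
   Context: Power series. All vector spaces are over $\mathbb{C}$; all series have integer exponents. $M((z))((w))$ means Laurent series in $w$ with coefficients in $M((z))$. The space $M[[z,w]][z^{-1},w^{-1},(z-w)^{-1}]$ consists of series landing in $M[[z,w]]$ after multiplication by a power of $zw(z-w)$; it embeds in $M((z))((w))$, $M((w))((z))$, $M((w))((z-w))$ by the binomial expansions $(z-w)^n=z^n(1-w/z)^n$, $(z-w)^n=(-1)^nw^n(1-z/w)^n$, $z^n=w^n(1+\frac{z-w}{w})^n$ respectively. Maps into the larger spaces are compared by factoring them through this common subspace. Vertex algebras. A vertex algebra is $(V,\mathbf 1,L(-1),m_z)$ with $\mathbf 1\in V$, $L(-1)\in\mathrm{End}(V)$, $m_z:V\otimes V\to V((z))$ linear, such that $m_z(\mathbf 1\otimes v)=v$, $m_z(v\otimes\mathbf 1)\in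 v+zV[[z]]$, $L(-1)m_z(u\otimes v)-m_z(u\otimes L(-1)v)=\frac{d}{dz}m_z(u\otimes v)$, and $m_z(u\otimes m_w(v\otimes x))$, $m_w(v\otimes m_z(u\otimes x))$ are expansions of the same element of $V[[z,w]][z^{-1},w^{-1},(z-w)^{-1}]$. It is weighted if equipped with $L(0)$ acting semisimply with integer eigenvalues ($V=\bigoplus_n V_n$), $[L(-1),L(0)]=-L(-1)$, and $L(0)m_z(u\otimes v)-m_z(u\otimes L(0)v)=m_z(L(0)u\otimes v)+zm_z(L(-1)u\otimes v)$. It is Möbius (resp. quasi-conformal) if weighted with an operator $L(1)$ (resp. operators $L(i)$, $i\ge-1$) satisfying $[L(i),L(j)]=(i-j)L(i+j)$, $L(i)m_z(u\otimes v)-m_z(u\otimes L(i)v)=\sum_{j=0}^{i+1}\binom{i+1}{j}z^jm_z(L(i-j)u\otimes v)$, and such that the span of the $L(i)$ with $i\ge1$ acts locally nilpotently. It is conformal of central charge $c$ if weighted with $\omega\in V_2$ such that $m_z(\omega\otimes v)=\sum_nL(n)vz^{-n-2}$ gives operators satisfying the Virasoro relations of central charge $c$. A vertex operator algebra (VOA) is a conformal vertex algebra with $L(0)$-eigenvalues bounded below and finite dimensional $L(0)$-eigenspaces. Modules. A $V$-module is a vector space $M$ with $act_z:V\otimes M\to M((z))$ and an operator $L(-1)^M$ such that $act_z(\mathbf 1\otimes x)=x$, $L(-1)^Mact_z(u\otimes x)-act_z(u\otimes L(-1)^Mx)=act_z(L(-1)u\otimes x)$, and $act_w(m_{z-w}(u\otimes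 v)\otimes x)\in M((w))((z-w))$, $act_z(u\otimes act_w(v\otimes x))\in M((z))((w))$ are expansions of the same element of $M[[z,w]][z^{-1},w^{-1},(z-w)^{-1}]$. If $V$ is weighted (resp. Möbius, quasi-conformal), an integral-weight module also carries the corresponding operators $L(i)^M$, with $L(0)^M$ semisimple with integer eigenvalues, $[L(i)^M,L(j)^M]=(i-j)L(i+j)^M$, $L(i)^Mact_z(u\otimes x)-act_z(u\otimes L(i)^Mx)=\sum_{j=0}^{i+1}\binom{i+1}{j}z^jact_z(L(i-j)u\otimes x)$, and the span of the $L(i)^M$, $i\ge1$, acting locally nilpotently. If $V$ is conformal one also requires that the coefficients of $act_z(\omega\otimes\cdot)$ give a Virasoro representation of central charge $c$; if $V$ is a VOA, also that $L(0)^M$ has spectrum bounded below and finite dimensional eigenspaces. Intertwining operators. An integral-weight intertwining operator of type $\binom{M_3}{M_1M_2}$ is a linear map $I_z:M_1\otimes M_2\to M_3((z))$ with $\frac{d}{dz}I_z(u\otimes v)=I_z(L(-1)u\otimes v)=L(-1)I_z(u\otimes v)-I_z(u\otimes L(-1)v)$, and such that $act_z(a\otimes I_w(u\otimes v))$, $I_w(act_{z-w}(a\otimes u)\otimes v)$, $I_w(u\otimes act_z(a\otimes v))$ are expansions (in $M_3((z))((w))$, $M_3((w))((z-w))$, $M_3((w))((z))$) of the same element of $M_3[[z,w]][z^{-1},w^{-1},(z-w)^{-1}]$ for $a\in V$. In the presence of operators $L(i)$ one also requires $L(i)I_z(u\otimes v)-I_z(u\otimes L(i)v)=\sum_{j=0}^{i+1}\binom{i+1}{j}z^jI_z(L(i-j)u\otimes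 v)$. Its skew $I^*_z:M_2\otimes M_1\to M_3((z))$ is $I^*_z(v\otimes u)=e^{zL(-1)}I_{-z}(u\otimes v)$, again an intertwining operator. Types. $\mathcal{T}$ denotes one of the following settings: (a) unrestricted: vertex algebras, with modules, module maps and integral-weight intertwining operators; (b) weighted, Möbius, quasi-conformal or conformal vertex algebras, with integral-weight modules of the corresponding kind and with module maps and intertwining operators compatible with all defined $L(i)$; (c) VOAs, with integral-weight VOA modules; (d) strictly $G$-equivariant versions of these for a group $G$ acting on $V$ by automorphisms and on modules by operators commuting with all $L(i)$ and satisfying $act_z(gv\otimes gu)=g\,act_z(v\otimes u)$, with equivariant module maps and intertwining operators. $I_{\mathcal{T}}\binom{M_3}{M_1,M_2}$ is the space of $\mathcal{T}$-intertwining operators. A set of modules in $\mathcal{T}$ is $\mathcal{T}$-compatible if its direct sum is a module in $\mathcal{T}$. Data. A one-dimensional $\mathcal{T}$-associativity datum for $\{M_i\}_{i\in A}$ ($M_0=V$) is a set of one-dimensional subspaces $\mathcal{I}_{i,j}^{i+j}\subset I_{\mathcal{T}}\binom{M_{i+j}}{M_i,M_j}$ such that: (i) for all $i,j,k$ there is a one-dimensional space $\mathcal{I}_{i,j,k}^{i+j+k}$ of maps $M_i\otimes M_j\otimes M_k\to M_{i+j+k}[[z,w]][z^{-1},w^{-1},(z-w)^{-1}]$ such that the compositions $m^{i,j+k}_z\circ(1\otimes m^{j,k}_w)$ (into $M_{i+j+k}((z))((w))$) and $m^{i+j,k}_w\circ(m^{i,j}_{z-w}\otimes1)$ (into $M_{i+j+k}((w))((z-w))$)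 factor through the embeddings and induce isomorphisms $\mathcal{I}_{i,j+k}^{i+j+k}\otimes\mathcal{I}_{j,k}^{j+k}\cong\mathcal{I}_{i,j,k}^{i+j+k}$ and $\mathcal{I}_{i+j,k}^{i+j+k}\otimes\mathcal{I}_{i,j}^{i+j}\cong\mathcal{I}_{i,j,k}^{i+j+k}$; (ii) for all $i,j,k,\ell$ there is a one-dimensional space $\mathcal{I}_{i,j,k,\ell}^{i+j+k+\ell}$ of maps $M_i\otimes M_j\otimes M_k\otimes M_\ell\to M_{i+j+k+\ell}[[z,w,t]][z^{-1},w^{-1},t^{-1},(z-w)^{-1},(z-t)^{-1},(w-t)^{-1}]$ such that composition $m_z\circ(1\otimes m_w)\circ(1\otimes1\otimes m_t)$ (into $M_{i+j+k+\ell}((z))((w))((t))$, with the analogous binomial expansions) induces an isomorphism $\mathcal{I}_{i,j+k+\ell}^{i+j+k+\ell}\otimes\mathcal{I}_{j,k+\ell}^{j+k+\ell}\otimes\mathcal{I}_{k,\ell}^{k+\ell}\cong\mathcal{I}_{i,j,k,\ell}^{i+j+k+\ell}$; (iii) $\mathcal{I}_{0,i}^i$ is spanned by the module structure map $act_z$ of $M_i$, and $\mathcal{I}_{i,0}^i$ by $act^*_z$. It is a commutativity datum if moreover for every nonzero $m^{i,j}_z\in\mathcal{I}_{i,j}^{i+j}$ one has $m^{i,j,*}_z\in\mathcal{I}_{j,i}^{j+i}$. Evenness. A $\mathcal{T}$-intertwining operator $I_z:M_1\otimes M_1\to M_2((z))$ is even if either (1) $I_z(u\otimes u)=0$ for all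 $u$, and whenever $I_z(u\otimes v)\ne0$ its lowest-order exponent of $z$ is odd; or (2) there is $u$ with $I_z(u\otimes u)\neq0$ having even lowest-order exponent. A commutativity datum is even if for all $i\in A$ every nonzero $m^{i,i}_z\in\mathcal{I}_{i,i}^{2i}$ is even. *)

theory Defs
  imports
    Complex_Main
    "HOL-Library.Function_Algebras"
    "HOL-Computational_Algebra.Formal_Laurent_Series"
    "HOL-Algebra.Group"
begin

unbundle fps_syntax

section \<open>Complex vector spaces\<close>

class complex_vector = ab_group_add +
  fixes scaleC :: "complex \<Rightarrow> 'a \<Rightarrow> 'a"  (infixr "*\<^sub>C" 75)
  assumes scaleC_add_right: "c *\<^sub>C (x + y) = c *\<^sub>C x + c *\<^sub>C y"
    and scaleC_add_left: "(c + d) *\<^sub>C x = c *\<^sub>C x + d *\<^sub>C x"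
    and scaleC_scaleC: "c *\<^sub>C d *\<^sub>C x = (c * d) *\<^sub>C x"
    and scaleC_one: "1 *\<^sub>C x = x"

global_interpretation cvec: vector_space "scaleC :: complex \<Rightarrow> 'a \<Rightarrow> 'a::complex_vector"
  by unfold_locales (fact scaleC_add_right scaleC_add_left scaleC_scaleC scaleC_one)+

instantiation "fun" :: (type, complex_vector) complex_vector
begin

definition scaleC_fun :: "complex \<Rightarrow> ('a \<Rightarrow> 'b) \<Rightarrow> 'a \<Rightarrow> 'b"
  where "scaleC_fun c f = (\<lambda>x. c *\<^sub>C f x)"

instance
  by standard
    (simp_all add: scaleC_fun_def fun_eq_iff scaleC_add_right scaleC_add_left scaleC_scaleC scaleC_one)

end

text \<open>Coefficientwise image of a Laurent series under a map \<open>h\<close> with \<open>h 0 = 0\<close>.\<close>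

definition fls_map :: "('a::zero \<Rightarrow> 'b::zero) \<Rightarrow> 'a fls \<Rightarrow> 'b fls"
  where "fls_map h F = Abs_fls (\<lambda>n. h (F $$ n))"

lemma fls_map_nth: "h 0 = 0 \<Longrightarrow> fls_map h F $$ n = h (F $$ n)"
  unfolding fls_map_def
  by (rule nth_Abs_fls_lower_bound[of "fls_subdegree F"]) simp

instantiation fls :: (complex_vector) complex_vector
begin

definition scaleC_fls :: "complex \<Rightarrow> 'a fls \<Rightarrow> 'a fls"
  where "scaleC_fls c F = fls_map (scaleC c) F"

instance
  by standard
    (simp_all add: scaleC_fls_def fls_eq_iff fls_map_nth scaleC_add_right scaleC_add_left
      scaleC_scaleC scaleC_one)

end

definition linear_on :: "'a::complex_vector set \<Rightarrow> 'b::complex_vector set \<Rightarrow> ('a \<Rightarrow> 'b) \<Rightarrow> bool"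
  where "linear_on U W h \<longleftrightarrow> (\<forall>x\<in>U. h x \<in> W) \<and>
    (\<forall>x\<in>U. \<forall>y\<in>U. h (x + y) = h x + h y) \<and> (\<forall>c. \<forall>x\<in>U. h (c *\<^sub>C x) = c *\<^sub>C h x)"

definition bilinear_on ::
  "'a::complex_vector set \<Rightarrow> 'b::complex_vector set \<Rightarrow> 'c::complex_vector set \<Rightarrow> ('a \<Rightarrow> 'b \<Rightarrow> 'c) \<Rightarrow> bool"
  where "bilinear_on U1 U2 W h \<longleftrightarrow>
    (\<forall>u\<in>U1. linear_on U2 W (h u)) \<and> (\<forall>v\<in>U2. linear_on U1 W (\<lambda>u. h u v))"

definition trilinear_on ::
  "'a::complex_vector set \<Rightarrow> 'b::complex_vector set \<Rightarrow> 'c::complex_vector set \<Rightarrow> 'd::complex_vector set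
    \<Rightarrow> ('a \<Rightarrow> 'b \<Rightarrow> 'c \<Rightarrow> 'd) \<Rightarrow> bool"
  where "trilinear_on U1 U2 U3 W h \<longleftrightarrow>
    (\<forall>u\<in>U1. bilinear_on U2 U3 W (h u)) \<and> (\<forall>v\<in>U2. \<forall>x\<in>U3. linear_on U1 W (\<lambda>u. h u v x))"

definition quadrilinear_on ::
  "'a::complex_vector set \<Rightarrow> 'b::complex_vector set \<Rightarrow> 'c::complex_vector set \<Rightarrow> 'd::complex_vector set
    \<Rightarrow> 'e::complex_vector set \<Rightarrow> ('a \<Rightarrow> 'b \<Rightarrow> 'c \<Rightarrow> 'd \<Rightarrow> 'e) \<Rightarrow> bool"
  where "quadrilinear_on U1 U2 U3 U4 W h \<longleftrightarrow>
    (\<forall>u\<in>U1. trilinear_on U2 U3 U4 W (h u)) \<and>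
    (\<forall>v\<in>U2. \<forall>x\<in>U3. \<forall>y\<in>U4. linear_on U1 W (\<lambda>u. h u v x y))"

text \<open>
  Vector spaces are subspaces of types, so a linear map out of \<open>U1 \<otimes> U2\<close> is represented by a function
  bilinear on \<open>U1 \<times> U2\<close>.  To make this representation unique, so that spaces of such maps are
  honest subspaces of the function type, the function is required to be 0 elsewhere.
\<close>

definition tensor2_map where
  "tensor2_map U1 U2 W h \<longleftrightarrow> bilinear_on U1 U2 W h \<and>
    (\<forall>u v. u \<notin> U1 \<or> v \<notin> U2 \<longrightarrow> h u v = 0)"

definition tensor3_map where
  "tensor3_map U1 U2 U3 W h \<longleftrightarrow> trilinear_on U1 U2 U3 W h \<and>
    (\<forall>u v x. u \<notin> U1 \<or> v \<notin> U2 \<or> x \<notin> U3 \<longrightarrow> h u v x = 0)"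

definition tensor4_map where
  "tensor4_map U1 U2 U3 U4 W h \<longleftrightarrow> quadrilinear_on U1 U2 U3 U4 W h \<and>
    (\<forall>u v x y. u \<notin> U1 \<or> v \<notin> U2 \<or> x \<notin> U3 \<or> y \<notin> U4 \<longrightarrow> h u v x y = 0)"

definition one_dimensional :: "'a::complex_vector set \<Rightarrow> bool"
  where "one_dimensional S \<longleftrightarrow> cvec.subspace S \<and> cvec.dim S = 1"

definition is_basis :: "'a::complex_vector set \<Rightarrow> 'a set \<Rightarrow> bool"
  where "is_basis S B \<longleftrightarrow> cvec.independent B \<and> cvec.span B = S"

text \<open>
  The multilinear map \<open>h\<close> induces a linear isomorphism \<open>P \<otimes> Q \<cong> R\<close> (resp. \<open>P \<otimes> Q \<otimes> S \<cong> R\<close>):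
  the tensors of basis vectors, which form a basis of the tensor product, are sent bijectively to
  a basis of \<open>R\<close>.
\<close>

definition tensor2_iso ::
  "('a::complex_vector \<Rightarrow> 'b::complex_vector \<Rightarrow> 'c::complex_vector) \<Rightarrow> 'a set \<Rightarrow> 'b set \<Rightarrow> 'c set \<Rightarrow> bool"
  where "tensor2_iso h P Q R \<longleftrightarrow> bilinear_on P Q R h \<and>
    (\<forall>B C. is_basis P B \<and> is_basis Q C \<longrightarrow>
      inj_on (\<lambda>(b, c). h b c) (B \<times> C) \<and> is_basis R ((\<lambda>(b, c). h b c) ` (B \<times> C)))"

definition tensor3_iso ::
  "('a::complex_vector \<Rightarrow> 'b::complex_vector \<Rightarrow> 'c::complex_vector \<Rightarrow> 'd::complex_vector)
    \<Rightarrow> 'a set \<Rightarrow> 'b set \<Rightarrow> 'c set \<Rightarrow> 'd set \<Rightarrow> bool"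
  where "tensor3_iso h P Q S R \<longleftrightarrow> trilinear_on P Q S R h \<and>
    (\<forall>B C D. is_basis P B \<and> is_basis Q C \<and> is_basis S D \<longrightarrow>
      inj_on (\<lambda>(b, c, d). h b c d) (B \<times> C \<times> D) \<and>
      is_basis R ((\<lambda>(b, c, d). h b c d) ` (B \<times> C \<times> D)))"


section \<open>Formal series\<close>

text \<open>
  \<open>M((z))\<close> is the set of \<open>'v fls\<close> with coefficients in \<open>M\<close>.  In nested series the outermost series
  type belongs to the last variable: an element \<open>F\<close> of \<open>M((z))((w))\<close> is an \<open>'v fls fls\<close>, and
  \<open>F $$ n $$ m\<close> is the coefficient of \<open>z^m w^n\<close>.
\<close>

definition laurent :: "'v::zero set \<Rightarrow> 'v fls set"
  where "laurent M = {F. \<forall>n. F $$ n \<in> M}"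

definition ddz :: "'v::complex_vector fls \<Rightarrow> 'v fls"
  where "ddz F = Abs_fls (\<lambda>n. of_int (n + 1) *\<^sub>C (F $$ (n + 1)))"

definition neg_arg :: "'v::complex_vector fls \<Rightarrow> 'v fls"
  where "neg_arg F = Abs_fls (\<lambda>n. if even n then F $$ n else - (F $$ n))"

text \<open>\<open>exp_z D F = e^{zD} F(z)\<close>; the sum below is finite since \<open>F\<close> is a Laurent series.\<close>

definition exp_z :: "('v::complex_vector \<Rightarrow> 'v) \<Rightarrow> 'v fls \<Rightarrow> 'v fls"
  where "exp_z D F = Abs_fls (\<lambda>n. \<Sum>k | F $$ (n - int k) \<noteq> 0.
    inverse (fact k) *\<^sub>C (D ^^ k) (F $$ (n - int k)))"

text \<open>\<open>M[[z,w]]\<close> and \<open>M[[z,w,t]]\<close>, as coefficient families extended by 0 to negative exponents.\<close>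

definition powser2 :: "'v::zero set \<Rightarrow> (int \<Rightarrow> int \<Rightarrow> 'v) set"
  where "powser2 M = {f. (\<forall>a b. f a b \<in> M) \<and> (\<forall>a b. a < 0 \<or> b < 0 \<longrightarrow> f a b = 0)}"

definition powser3 :: "'v::zero set \<Rightarrow> (int \<Rightarrow> int \<Rightarrow> int \<Rightarrow> 'v) set"
  where "powser3 M = {f. (\<forall>a b c. f a b c \<in> M) \<and>
    (\<forall>a b c. a < 0 \<or> b < 0 \<or> c < 0 \<longrightarrow> f a b c = 0)}"

text \<open>
  An element of \<open>M[[z,w]][z^-1,w^-1,(z-w)^-1]\<close> is a fraction \<open>f / (z w (z-w))^N\<close> with
  \<open>f \<in> powser2 M\<close>.  The next three functions are its expansions in \<open>M((z))((w))\<close>,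
  \<open>M((w))((z))\<close> and \<open>M((w))((z-w))\<close>, obtained by substituting

  \<^item> \<open>(z-w)^-N = (\<Sum>k. (-1)^k binom(-N,k) w^k z^(-N-k))\<close>,
  \<^item> \<open>(z-w)^-N = (-1)^N (\<Sum>k. (-1)^k binom(-N,k) z^k w^(-N-k))\<close>,
  \<^item> \<open>z^(a-N) = (\<Sum>k. binom(a-N,k) w^(a-N-k) (z-w)^k)\<close>,

  respectively, and collecting the coefficients of \<open>z^m w^n\<close>, of \<open>z^m w^n\<close>, and of \<open>(z-w)^p w^n\<close>.
  Sums run over the finitely many indices with a nonzero contribution.
\<close>

definition expand_z_w :: "nat \<Rightarrow> (int \<Rightarrow> int \<Rightarrow> 'v::complex_vector) \<Rightarrow> 'v fls fls"
  where "expand_z_w N f = Abs_fls (\<lambda>n. Abs_fls (\<lambda>m. \<Sum>k | int k \<le> n + int N.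
    ((-1) ^ k * ((- of_nat N) gchoose k)) *\<^sub>C f (m + 2 * int N + int k) (n + int N - int k)))"

definition expand_w_z :: "nat \<Rightarrow> (int \<Rightarrow> int \<Rightarrow> 'v::complex_vector) \<Rightarrow> 'v fls fls"
  where "expand_w_z N f = Abs_fls (\<lambda>m. Abs_fls (\<lambda>n. \<Sum>k | int k \<le> m + int N.
    ((-1) ^ N * (-1) ^ k * ((- of_nat N) gchoose k)) *\<^sub>C f (m + int N - int k) (n + 2 * int N + int k)))"

definition expand_w_zw :: "nat \<Rightarrow> (int \<Rightarrow> int \<Rightarrow> 'v::complex_vector) \<Rightarrow> 'v fls fls"
  where "expand_w_zw N f = Abs_fls (\<lambda>p. Abs_fls (\<lambda>n.
    if p + int N < 0 then 0
    else \<Sum>a = 0..n + p + 3 * int N.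
      (of_int (a - int N) gchoose nat (p + int N)) *\<^sub>C f a (n + p + 3 * int N - a)))"

text \<open>
  The expansion in \<open>M((z))((w))((t))\<close> of \<open>f / (z w t (z-w) (z-t) (w-t))^N\<close>; the indices \<open>k\<close>, \<open>l\<close>, \<open>q\<close>
  belong to the expansions of \<open>(z-w)^-N\<close>, \<open>(z-t)^-N\<close> and \<open>(w-t)^-N\<close>.
\<close>

definition expand_z_w_t :: "nat \<Rightarrow> (int \<Rightarrow> int \<Rightarrow> int \<Rightarrow> 'v::complex_vector) \<Rightarrow> 'v fls fls fls"
  where "expand_z_w_t N f = Abs_fls (\<lambda>p. Abs_fls (\<lambda>n. Abs_fls (\<lambda>m.
    \<Sum>l | int l \<le> p + int N. \<Sum>q | int q \<le> p + int N. \<Sum>k | int k \<le> n + 2 * int N + int q.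
      ((-1) ^ (k + l + q) * ((- of_nat N) gchoose k) * ((- of_nat N) gchoose l)
          * ((- of_nat N) gchoose q))
      *\<^sub>C f (m + 3 * int N + int k + int l) (n + 2 * int N - int k + int q)
             (p + int N - int l - int q))))"

text \<open>
  The localized spaces are identified with their images under the injective embeddings into
  \<open>M((z))((w))\<close> and \<open>M((z))((w))((t))\<close>.
\<close>

definition loc2 :: "'v::complex_vector set \<Rightarrow> 'v fls fls set"
  where "loc2 M = {expand_z_w N f | N f. f \<in> powser2 M}"

definition loc3 :: "'v::complex_vector set \<Rightarrow> 'v fls fls fls set"
  where "loc3 M = {expand_z_w_t N f | N f. f \<in> powser3 M}"

text \<open>
  Being expansions of the same element of \<open>M[[z,w]][z^-1,w^-1,(z-w)^-1]\<close>, for series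
  \<open>P\<close> in \<open>M((z))((w))\<close>, \<open>Q\<close> in \<open>M((w))((z-w))\<close>, \<open>R\<close> in \<open>M((w))((z))\<close>.
\<close>

definition same_zw_wz where
  "same_zw_wz M P R \<longleftrightarrow> (\<exists>N. \<exists>f\<in>powser2 M. P = expand_z_w N f \<and> R = expand_w_z N f)"

definition same_zw_assoc where
  "same_zw_assoc M P Q \<longleftrightarrow> (\<exists>N. \<exists>f\<in>powser2 M. P = expand_z_w N f \<and> Q = expand_w_zw N f)"

definition same_all where
  "same_all M P Q R \<longleftrightarrow> (\<exists>N. \<exists>f\<in>powser2 M.
    P = expand_z_w N f \<and> Q = expand_w_zw N f \<and> R = expand_w_z N f)"

text \<open>
  The compositions \<open>m1_z \<circ> (1 \<otimes> m2_w)\<close>, \<open>m1_w \<circ> (m2_{z-w} \<otimes> 1)\<close> and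
  \<open>m1_z \<circ> (1 \<otimes> m2_w) \<circ> (1 \<otimes> 1 \<otimes> m3_t)\<close>, with values in series in the variables \<open>z\<close>, \<open>w\<close>,
  resp. \<open>w\<close>, \<open>z-w\<close>, resp. \<open>z\<close>, \<open>w\<close>, \<open>t\<close>, innermost variable first.
\<close>

definition comp_right ::
  "('a \<Rightarrow> 'b::zero \<Rightarrow> 'c::zero fls) \<Rightarrow> ('d \<Rightarrow> 'e \<Rightarrow> 'b fls) \<Rightarrow> 'a \<Rightarrow> 'd \<Rightarrow> 'e \<Rightarrow> 'c fls fls"
  where "comp_right m1 m2 u v x = fls_map (m1 u) (m2 v x)"

definition comp_left ::
  "('b::zero \<Rightarrow> 'e \<Rightarrow> 'c::zero fls) \<Rightarrow> ('a \<Rightarrow> 'd \<Rightarrow> 'b fls) \<Rightarrow> 'a \<Rightarrow> 'd \<Rightarrow> 'e \<Rightarrow> 'c fls fls"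
  where "comp_left m1 m2 u v x = fls_map (\<lambda>y. m1 y x) (m2 u v)"

definition comp_right3 ::
  "('a \<Rightarrow> 'b::zero \<Rightarrow> 'c::zero fls) \<Rightarrow> ('d \<Rightarrow> 'e::zero \<Rightarrow> 'b fls) \<Rightarrow> ('f \<Rightarrow> 'g \<Rightarrow> 'e fls)
    \<Rightarrow> 'a \<Rightarrow> 'd \<Rightarrow> 'f \<Rightarrow> 'g \<Rightarrow> 'c fls fls fls"
  where "comp_right3 m1 m2 m3 u v x y = fls_map (comp_right m1 m2 u v) (m3 x y)"


section \<open>Settings\<close>

text \<open>The complex parameters are central charges.\<close>

datatype kind = Unrestricted | Weighted | Moebius | Quasiconformal | Conformal complex | VOA complex

text \<open>\<open>symm T = Some G\<close> selects the strictly \<open>G\<close>-equivariant version of the setting.\<close>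

datatype 'g setting = Setting (kind: kind) (symm: "'g monoid option")

definition wf_setting :: "'g setting \<Rightarrow> bool"
  where "wf_setting T \<longleftrightarrow> (\<forall>G. symm T = Some G \<longrightarrow> group G)"

fun is_conformal :: "kind \<Rightarrow> bool" where
  "is_conformal (Conformal c) = True"
| "is_conformal (VOA c) = True"
| "is_conformal _ = False"

fun charge :: "kind \<Rightarrow> complex" where
  "charge (Conformal c) = c"
| "charge (VOA c) = c"
| "charge _ = 0"

text \<open>The \<open>i\<close> for which \<open>L(i)\<close> is defined.\<close>

fun modes :: "kind \<Rightarrow> int set" where
  "modes Unrestricted = {-1}"
| "modes Weighted = {-1, 0}"
| "modes Moebius = {-1, 0, 1}"
| "modes Quasiconformal = {-1..}"
| "modes (Conformal c) = UNIV"
| "modes (VOA c) = UNIV"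

text \<open>
  The \<open>i\<close> for which the definition of an algebra or module of the given kind imposes the
  covariance formula for \<open>L(i)\<close>, beyond the \<open>L(-1)\<close>-axioms of vertex algebras and modules.
  (For conformal structures the formula for \<open>i \<ge> 1\<close> is a consequence of the other axioms.)
\<close>

fun covariance_modes :: "kind \<Rightarrow> int set" where
  "covariance_modes Unrestricted = {}"
| "covariance_modes Weighted = {0}"
| "covariance_modes Moebius = {-1, 0, 1}"
| "covariance_modes Quasiconformal = {-1..}"
| "covariance_modes (Conformal c) = {0}"
| "covariance_modes (VOA c) = {0}"


section \<open>Vertex algebras, modules, intertwining operators\<close>

text \<open>
  A module over an algebra in \<open>'v\<close> lives on a subspace \<open>vs\<close> of \<open>'m\<close>.  The fields \<open>Lop i\<close> with
  \<open>i\<close> outside \<open>modes\<close>, \<open>gact\<close> in nonequivariant settings, and \<open>omega\<close> in nonconformal settings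
  carry no meaning.  The field \<open>act\<close> of a vertex algebra is its multiplication.
\<close>

record (overloaded) ('g, 'v, 'm) vmod =
  vs :: "'m set"
  act :: "'v \<Rightarrow> 'm \<Rightarrow> 'm fls"
  Lop :: "int \<Rightarrow> 'm \<Rightarrow> 'm"
  gact :: "'g \<Rightarrow> 'm \<Rightarrow> 'm"

record (overloaded) ('g, 'v) vertex = "('g, 'v, 'v) vmod" +
  vac :: 'v
  omega :: 'v

definition weight_space :: "'m::complex_vector set \<Rightarrow> ('m \<Rightarrow> 'm) \<Rightarrow> int \<Rightarrow> 'm set"
  where "weight_space M D n = {x \<in> M. D x = of_int n *\<^sub>C x}"

definition locally_nilpotent ::
  "'m::complex_vector set \<Rightarrow> (int \<Rightarrow> 'm \<Rightarrow> 'm) \<Rightarrow> int set \<Rightarrow> bool"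
  where "locally_nilpotent M L J \<longleftrightarrow>
    (\<forall>x\<in>M. \<exists>N. \<forall>js. length js = N \<and> set js \<subseteq> J \<longrightarrow> foldr L js x = 0)"

text \<open>
  The conditions on the operators \<open>L(i)\<close> alone.  The bracket relation is that of the Virasoro
  algebra; in the nonconformal kinds \<open>charge k = 0\<close>.
\<close>

definition lie_operators :: "kind \<Rightarrow> 'm::complex_vector set \<Rightarrow> (int \<Rightarrow> 'm \<Rightarrow> 'm) \<Rightarrow> bool"
  where "lie_operators k M L \<longleftrightarrow>
    (\<forall>i\<in>modes k. linear_on M M (L i)) \<and>
    (\<forall>i\<in>modes k. \<forall>j\<in>modes k. \<forall>x\<in>M.
      L i (L j x) - L j (L i x) = of_int (i - j) *\<^sub>C L (i + j) x
        + (if i + j = 0 then charge k / 12 * of_int (i ^ 3 - i) else 0) *\<^sub>C x) \<and>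
    (k \<noteq> Unrestricted \<longrightarrow> cvec.span (\<Union>n. weight_space M (L 0) n) = M) \<and>
    (k = Moebius \<or> k = Quasiconformal \<longrightarrow> locally_nilpotent M L (modes k \<inter> {1..})) \<and>
    (\<forall>c. k = VOA c \<longrightarrow>
      (\<exists>N. \<forall>n<N. weight_space M (L 0) n = {0}) \<and>
      (\<forall>n. \<exists>B. finite B \<and> weight_space M (L 0) n = cvec.span B))"

definition group_operators ::
  "'g setting \<Rightarrow> ('g, 'v, 'm::complex_vector, 'r) vmod_scheme \<Rightarrow> bool"
  where "group_operators T M \<longleftrightarrow> (\<forall>G. symm T = Some G \<longrightarrow>
    (\<forall>g\<in>carrier G. linear_on (vs M) (vs M) (gact M g)) \<and>
    (\<forall>x\<in>vs M. gact M \<one>\<^bsub>G\<^esub> x = x) \<and>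
    (\<forall>g\<in>carrier G. \<forall>h\<in>carrier G. \<forall>x\<in>vs M. gact M (g \<otimes>\<^bsub>G\<^esub> h) x = gact M g (gact M h x)) \<and>
    (\<forall>g\<in>carrier G. \<forall>i\<in>modes (kind T). \<forall>x\<in>vs M. gact M g (Lop M i x) = Lop M i (gact M g x)))"

definition equivariant ::
  "'g setting \<Rightarrow> ('g, 'v1, 'a::complex_vector, 'r1) vmod_scheme \<Rightarrow> ('g, 'v2, 'b::complex_vector, 'r2) vmod_scheme
    \<Rightarrow> ('g, 'v3, 'c::complex_vector, 'r3) vmod_scheme \<Rightarrow> ('a \<Rightarrow> 'b \<Rightarrow> 'c fls) \<Rightarrow> bool"
  where "equivariant T M1 M2 M3 Y \<longleftrightarrow> (\<forall>G. symm T = Some G \<longrightarrow>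
    (\<forall>g\<in>carrier G. \<forall>u\<in>vs M1. \<forall>v\<in>vs M2.
      Y (gact M1 g u) (gact M2 g v) = fls_map (gact M3 g) (Y u v)))"

text \<open>
  \<open>L(i) Y_z(u \<otimes> v) - Y_z(u \<otimes> L(i) v) = (\<Sum>j=0..i+1. binom(i+1,j) z^j Y_z(L(i-j) u \<otimes> v))\<close> for \<open>i \<ge> -1\<close>;
  multiplication by \<open>z^j\<close> is \<open>fls_shift (- j)\<close>.
\<close>

definition covariant ::
  "int \<Rightarrow> ('g, 'v1, 'a::complex_vector, 'r1) vmod_scheme \<Rightarrow> ('g, 'v2, 'b::complex_vector, 'r2) vmod_scheme
    \<Rightarrow> ('g, 'v3, 'c::complex_vector, 'r3) vmod_scheme \<Rightarrow> ('a \<Rightarrow> 'b \<Rightarrow> 'c fls) \<Rightarrow> bool"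
  where "covariant i M1 M2 M3 Y \<longleftrightarrow> (\<forall>u\<in>vs M1. \<forall>v\<in>vs M2.
    fls_map (Lop M3 i) (Y u v) - Y u (Lop M2 i v) =
    (\<Sum>j\<le>nat (i + 1). of_nat (nat (i + 1) choose j) *\<^sub>C
        fls_shift (- int j) (Y (Lop M1 (i - int j) u) v)))"

definition vertex_algebra :: "'g setting \<Rightarrow> ('g, 'v::complex_vector) vertex \<Rightarrow> bool"
  where "vertex_algebra T V \<longleftrightarrow>
    cvec.subspace (vs V) \<and> vac V \<in> vs V \<and>
    tensor2_map (vs V) (vs V) (laurent (vs V)) (act V) \<and>
    lie_operators (kind T) (vs V) (Lop V) \<and>
    (\<forall>v\<in>vs V. act V (vac V) v = fls_const v) \<and>
    (\<forall>v\<in>vs V. act V v (vac V) $$ 0 = v \<and> (\<forall>n<0. act V v (vac V) $$ n = 0)) \<and>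
    (\<forall>u\<in>vs V. \<forall>v\<in>vs V.
      fls_map (Lop V (-1)) (act V u v) - act V u (Lop V (-1) v) = ddz (act V u v)) \<and>
    (\<forall>u\<in>vs V. \<forall>v\<in>vs V. \<forall>x\<in>vs V.
      same_zw_wz (vs V) (comp_right (act V) (act V) u v x) (comp_right (act V) (act V) v u x)) \<and>
    (\<forall>i\<in>covariance_modes (kind T). covariant i V V V (act V)) \<and>
    (is_conformal (kind T) \<longrightarrow> omega V \<in> weight_space (vs V) (Lop V 0) 2 \<and>
      (\<forall>n. \<forall>v\<in>vs V. Lop V n v = act V (omega V) v $$ (- n - 2))) \<and>
    group_operators T V \<and> equivariant T V V V (act V) \<and>
    (\<forall>G. symm T = Some G \<longrightarrow> (\<forall>g\<in>carrier G. gact V g (vac V) = vac V \<and>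
      (is_conformal (kind T) \<longrightarrow> gact V g (omega V) = omega V)))"

definition vmodule ::
  "'g setting \<Rightarrow> ('g, 'v::complex_vector) vertex \<Rightarrow> ('g, 'v, 'm::complex_vector) vmod \<Rightarrow> bool"
  where "vmodule T V M \<longleftrightarrow>
    cvec.subspace (vs M) \<and>
    tensor2_map (vs V) (vs M) (laurent (vs M)) (act M) \<and>
    lie_operators (kind T) (vs M) (Lop M) \<and>
    (\<forall>x\<in>vs M. act M (vac V) x = fls_const x) \<and>
    (\<forall>u\<in>vs V. \<forall>x\<in>vs M.
      fls_map (Lop M (-1)) (act M u x) - act M u (Lop M (-1) x) = act M (Lop V (-1) u) x) \<and>
    (\<forall>u\<in>vs V. \<forall>v\<in>vs V. \<forall>x\<in>vs M.
      same_zw_assoc (vs M) (comp_right (act M) (act M) u v x) (comp_left (act M) (act V) u v x)) \<and>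
    (\<forall>i\<in>covariance_modes (kind T). covariant i V M M (act M)) \<and>
    (is_conformal (kind T) \<longrightarrow>
      (\<forall>n. \<forall>x\<in>vs M. Lop M n x = act M (omega V) x $$ (- n - 2))) \<and>
    group_operators T M \<and> equivariant T V M M (act M)"

definition intertwiners ::
  "'g setting \<Rightarrow> ('g, 'v::complex_vector) vertex \<Rightarrow> ('g, 'v, 'a::complex_vector) vmod
    \<Rightarrow> ('g, 'v, 'b::complex_vector) vmod \<Rightarrow> ('g, 'v, 'c::complex_vector) vmod \<Rightarrow> ('a \<Rightarrow> 'b \<Rightarrow> 'c fls) set"
  where "intertwiners T V M1 M2 M3 = {Y.
    tensor2_map (vs M1) (vs M2) (laurent (vs M3)) Y \<and>
    (\<forall>u\<in>vs M1. \<forall>v\<in>vs M2.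
      ddz (Y u v) = Y (Lop M1 (-1) u) v \<and>
      ddz (Y u v) = fls_map (Lop M3 (-1)) (Y u v) - Y u (Lop M2 (-1) v)) \<and>
    (\<forall>a\<in>vs V. \<forall>u\<in>vs M1. \<forall>v\<in>vs M2.
      same_all (vs M3) (comp_right (act M3) Y a u v) (comp_left Y (act M1) a u v)
        (comp_right Y (act M2) u a v)) \<and>
    (\<forall>i\<in>modes (kind T) \<inter> {-1..}. covariant i M1 M2 M3 Y) \<and>
    equivariant T M1 M2 M3 Y}"

text \<open>The skew \<open>Y^*_z(v \<otimes> u) = e^{zL(-1)} Y_{-z}(u \<otimes> v)\<close>, where \<open>D\<close> is \<open>L(-1)\<close> on the target.\<close>

definition skew ::
  "('c::complex_vector \<Rightarrow> 'c) \<Rightarrow> ('a \<Rightarrow> 'b \<Rightarrow> 'c fls) \<Rightarrow> 'b \<Rightarrow> 'a \<Rightarrow> 'c fls"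
  where "skew D Y v u = exp_z D (neg_arg (Y u v))"

definition even_intertwiner :: "'a set \<Rightarrow> ('a \<Rightarrow> 'a \<Rightarrow> 'c::complex_vector fls) \<Rightarrow> bool"
  where "even_intertwiner M1 Y \<longleftrightarrow>
    (\<forall>u\<in>M1. Y u u = 0) \<and>
      (\<forall>u\<in>M1. \<forall>v\<in>M1. Y u v \<noteq> 0 \<longrightarrow> odd (fls_subdegree (Y u v))) \<or>
    (\<exists>u\<in>M1. Y u u \<noteq> 0 \<and> even (fls_subdegree (Y u u)))"


section \<open>Direct sums\<close>

definition dsum_space :: "'i set \<Rightarrow> ('i \<Rightarrow> 'm::zero set) \<Rightarrow> ('i \<Rightarrow> 'm) set"
  where "dsum_space S U = {f. finite {k. f k \<noteq> 0} \<and> (\<forall>k\<in>S. f k \<in> U k) \<and> (\<forall>k. k \<notin> S \<longrightarrow> f k = 0)}"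

definition single :: "'i \<Rightarrow> 'm::zero \<Rightarrow> 'i \<Rightarrow> 'm"
  where "single k x = (\<lambda>j. if j = k then x else 0)"

definition dsum_module ::
  "'i set \<Rightarrow> ('i \<Rightarrow> ('g, 'v, 'm::complex_vector) vmod) \<Rightarrow> ('g, 'v, 'i \<Rightarrow> 'm) vmod"
  where "dsum_module S M = \<lparr>
    vs = dsum_space S (\<lambda>k. vs (M k)),
    act = (\<lambda>u f. if f \<in> dsum_space S (\<lambda>k. vs (M k))
      then \<Sum>k | f k \<noteq> 0. fls_map (single k) (act (M k) u (f k)) else 0),
    Lop = (\<lambda>n f k. if k \<in> S then Lop (M k) n (f k) else 0),
    gact = (\<lambda>g f k. if k \<in> S then gact (M k) g (f k) else 0)\<rparr>"

definition compatible ::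
  "'g setting \<Rightarrow> ('g, 'v::complex_vector) vertex \<Rightarrow> 'i set
    \<Rightarrow> ('i \<Rightarrow> ('g, 'v, 'm::complex_vector) vmod) \<Rightarrow> bool"
  where "compatible T V S M \<longleftrightarrow> vmodule T V (dsum_module S M)"

text \<open>
  The structure on the direct sum of the \<open>M i\<close>, \<open>i \<in> S\<close>, with multiplication assembled from the
  \<open>m i j\<close>, with operators acting componentwise, and with vacuum and conformal vector those of
  \<open>V = M 0\<close>.
\<close>

definition dsum_vertex ::
  "('g, 'v::complex_vector) vertex \<Rightarrow> 'i::ab_group_add set \<Rightarrow> ('i \<Rightarrow> ('g, 'v, 'v) vmod)
    \<Rightarrow> ('i \<Rightarrow> 'i \<Rightarrow> 'v \<Rightarrow> 'v \<Rightarrow> 'v fls) \<Rightarrow> ('g, 'i \<Rightarrow> 'v) vertex"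
  where "dsum_vertex V S M m = \<lparr>
    vs = dsum_space S (\<lambda>k. vs (M k)),
    act = (\<lambda>f h. if f \<in> dsum_space S (\<lambda>k. vs (M k)) \<and> h \<in> dsum_space S (\<lambda>k. vs (M k))
      then \<Sum>i | f i \<noteq> 0. \<Sum>j | h j \<noteq> 0. fls_map (single (i + j)) (m i j (f i) (h j)) else 0),
    Lop = (\<lambda>n f k. if k \<in> S then Lop (M k) n (f k) else 0),
    gact = (\<lambda>g f k. if k \<in> S then gact (M k) g (f k) else 0),
    vac = single 0 (vac V),
    omega = single 0 (omega V)\<rparr>"


section \<open>Associativity and commutativity data\<close>

definition associativity_datum ::
  "'g setting \<Rightarrow> ('g, 'v::complex_vector) vertex \<Rightarrow> ('i::ab_group_add \<Rightarrow> ('g, 'v, 'v) vmod)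
    \<Rightarrow> ('i \<Rightarrow> 'i \<Rightarrow> ('v \<Rightarrow> 'v \<Rightarrow> 'v fls) set) \<Rightarrow> bool"
  where "associativity_datum T V M \<I> \<longleftrightarrow>
    (\<forall>i j. one_dimensional (\<I> i j) \<and> \<I> i j \<subseteq> intertwiners T V (M i) (M j) (M (i + j))) \<and>
    (\<forall>i j k. \<exists>\<K>.
      one_dimensional \<K> \<and>
      (\<forall>F\<in>\<K>. tensor3_map (vs (M i)) (vs (M j)) (vs (M k)) (loc2 (vs (M (i + j + k)))) F) \<and>
      tensor2_iso comp_right (\<I> i (j + k)) (\<I> j k) \<K> \<and>
      (\<exists>h. tensor2_iso h (\<I> (i + j) k) (\<I> i j) \<K> \<and>
        (\<forall>m1\<in>\<I> (i + j) k. \<forall>m2\<in>\<I> i j.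
          \<forall>u\<in>vs (M i). \<forall>v\<in>vs (M j). \<forall>x\<in>vs (M k).
            same_zw_assoc (vs (M (i + j + k))) (h m1 m2 u v x) (comp_left m1 m2 u v x)))) \<and>
    (\<forall>i j k l. \<exists>\<K>.
      one_dimensional \<K> \<and>
      (\<forall>F\<in>\<K>. tensor4_map (vs (M i)) (vs (M j)) (vs (M k)) (vs (M l))
        (loc3 (vs (M (i + j + k + l)))) F) \<and>
      tensor3_iso comp_right3 (\<I> i (j + k + l)) (\<I> j (k + l)) (\<I> k l) \<K>) \<and>
    (\<forall>i. \<I> 0 i = cvec.span {act (M i)} \<and>
      \<I> i 0 = cvec.span {skew (Lop (M i) (-1)) (act (M i))})"

definition commutativity_datum ::
  "'g setting \<Rightarrow> ('g, 'v::complex_vector) vertex \<Rightarrow> ('i::ab_group_add \<Rightarrow> ('g, 'v, 'v) vmod)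
    \<Rightarrow> ('i \<Rightarrow> 'i \<Rightarrow> ('v \<Rightarrow> 'v \<Rightarrow> 'v fls) set) \<Rightarrow> bool"
  where "commutativity_datum T V M \<I> \<longleftrightarrow> associativity_datum T V M \<I> \<and>
    (\<forall>i j. \<forall>m\<in>\<I> i j. m \<noteq> 0 \<longrightarrow> skew (Lop (M (i + j)) (-1)) m \<in> \<I> j i)"

definition even_datum ::
  "('i::ab_group_add \<Rightarrow> ('g, 'v::complex_vector, 'v) vmod)
    \<Rightarrow> ('i \<Rightarrow> 'i \<Rightarrow> ('v \<Rightarrow> 'v \<Rightarrow> 'v fls) set) \<Rightarrow> bool"
  where "even_datum M \<I> \<longleftrightarrow> (\<forall>i. \<forall>m\<in>\<I> i i. m \<noteq> 0 \<longrightarrow> even_intertwiner (vs (M i)) m)"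

definition doubles :: "'i::ab_group_add set"
  where "doubles = {i + i | i. True}"

end

(*
  Rescaling each m^{i,j} turns the problem into one about scalars. On M_k the compositions of m^i and m^j
  in the two orders are expansions of proportional rational functions (associativity and skew symmetry);
  let B(i,j;k) be the factor. Comparing products of three operators (as in Dong's lemma; the products of four
  elements, which condition (ii) makes nonzero, detect the scalars) gives a hexagon identity between B and the
  associativity factors phi. It makes the pairs (i, f), f a function on A modulo constants, into a group
  in which commutation up to B is preserved by products, and it yields B(2i,2i;k) = B(i,i;k)^2 = 1.
  On 2A a maximal commuting subgroup that meets the kernel of (i, f) |-> i trivially, found with Zorn's
  lemma, maps onto 2A: it can be extended because every complex number has roots. Its elements are the scalars
  by which to multiply the m^{i,j} to make them mutually local. Since the skew factor of m^{i,i} is 1 for i in 2A,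
  evenness can be read off from lowest coefficients.
*)
theory Submission
  imports Defs "HOL-Algebra.Generated_Groups"
begin

section \<open>Doubly infinite series\<close>

text \<open>Condition (ii) concerns a single bracketing of four factors, so the datum supplies no
  pentagon for \<open>\<phi>\<close>. What is used of it comes from the hexagon, and only up to
  factors independent of the line on which the operators act; hence functions modulo constants. The
  genuine obstruction is the sign \<open>B i i k = 1 / \<omega> i i\<close>, which plays the part of
  the quadratic form attached to an abelian 3-cocycle: no rescaling changes how an operator commutes
  with itself. Two compositions are compared as arrays of coefficients, because their expansions lie
  in different spaces and agree only after multiplication by a power of z - w. For three operators
  this power has to be the same for infinitely many coefficients at once; therefore pole orders are
  read off from the product of the first two arguments, uniformly in the third. The definition of a
  vertex algebra asks for mutual locality, so no associativity of the rescaled products has to be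
  arranged.\<close>

text \<open>
  A series in \<open>z\<close>, \<open>w\<close>, possibly infinite in both directions, is an array \<open>X\<close>, with \<open>X m n\<close> the coefficient
  of \<open>z^m w^n\<close>; \<open>delta\<close> is multiplication by \<open>z - w\<close>.
\<close>

definition delta :: "(int \<Rightarrow> int \<Rightarrow> 'v::ab_group_add) \<Rightarrow> int \<Rightarrow> int \<Rightarrow> 'v"
  where "delta X = (\<lambda>m n. X (m - 1) n - X m (n - 1))"

lemma delta_pow_hom:
  assumes "\<And>x y. h (x - y) = h x - h y"
  shows "(delta ^^ N) (\<lambda>m n. h (X m n)) = (\<lambda>m n. h ((delta ^^ N) X m n))"
  by (induction N) (simp_all add: delta_def assms)

lemma delta_pow_diff: "(delta ^^ N) (X - Y) = (delta ^^ N) X - (delta ^^ N) Y"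
  by (induction N) (simp_all add: delta_def fun_eq_iff)

lemma delta_pow_add: "(delta ^^ N) (X + Y) = (delta ^^ N) X + (delta ^^ N) Y"
  by (induction N) (simp_all add: delta_def fun_eq_iff)

lemma delta_pow_scale: "(delta ^^ N) (c *\<^sub>C X) = c *\<^sub>C (delta ^^ N) (X::int \<Rightarrow> int \<Rightarrow> 'v::complex_vector)"
  by (induction N) (simp_all add: delta_def fun_eq_iff scaleC_fun_def cvec.scale_right_diff_distrib)

lemma delta_pow_0: "(delta ^^ N) 0 = 0"
  by (induction N) (simp_all add: delta_def fun_eq_iff)

lemma delta_pow_mono:
  assumes "(delta ^^ N) X = (delta ^^ N) Y" "N \<le> N'"
  shows "(delta ^^ N') X = (delta ^^ N') Y"
proof -
  have "(delta ^^ N') W = (delta ^^ (N' - N)) ((delta ^^ N) W)" for W :: "int \<Rightarrow> int \<Rightarrow> 'a"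
    using assms(2) by (metis comp_apply funpow_add le_add_diff_inverse2)
  then show ?thesis using assms(1) by simp
qed

lemma delta_pow_bdd2:
  assumes "\<And>m n. n < K \<Longrightarrow> X m n = 0" "n < K"
  shows "(delta ^^ N) X m n = 0"
  using assms(2) by (induction N arbitrary: m n) (simp_all add: delta_def assms(1))

lemma delta_pow_bdd1:
  assumes "\<And>m n. m < K \<Longrightarrow> X m n = 0" "m < K"
  shows "(delta ^^ N) X m n = 0"
  using assms(2) by (induction N arbitrary: m n) (simp_all add: delta_def assms(1))

lemma delta_pow_in:
  assumes "cvec.subspace S" "\<And>m n. X m n \<in> S"
  shows "(delta ^^ N) X m n \<in> S"
  by (induction N arbitrary: m n) (simp_all add: delta_def assms cvec.subspace_diff)

text \<open>The coefficient of the lowest power of w is merely multiplied by z, so vanishing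
  propagates upwards in the exponent of w. The bound matters: the formal delta function, with
  coefficient 1 wherever \<open>m + n = -1\<close>, is killed by z - w.\<close>

lemma delta_inj:
  assumes b: "\<And>m n. n < K \<Longrightarrow> X m n = 0" and z: "delta X = 0"
  shows "X = 0"
proof -
  have "\<forall>r. X m (K - 1 + int r) = 0" for m
  proof
    fix r show "X m (K - 1 + int r) = 0"
  proof (induction r arbitrary: m)
    case (Suc r)
    have "delta X (m + 1) (K - 1 + int (Suc r)) = 0" using z by simp
    moreover have "delta X (m + 1) (K - 1 + int (Suc r)) = X m (K - 1 + int (Suc r)) - X (m + 1) (K - 1 + int r)"
      unfolding delta_def by (simp add: algebra_simps)
    ultimately show ?case using Suc.IH by simp
  qed (simp add: b)
  qed
  then have "X m n = 0" for m n
    using b[of n m] spec[of _ "nat (n - (K - 1))", OF \<open>\<And>m. \<forall>r. X m (K - 1 + int r) = 0\<close>, of m]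
    by (cases "n < K") simp_all
  then show ?thesis by (simp add: fun_eq_iff)
qed

lemma delta_pow_inj:
  assumes b: "\<And>m n. n < K \<Longrightarrow> X m n = 0" and z: "(delta ^^ N) X = 0"
  shows "X = 0"
  using z
proof (induction N)
  case (Suc N)
  have "(delta ^^ N) X = 0"
    by (rule delta_inj[where K = K], rule delta_pow_bdd2[OF b]) (use Suc.prems in \<open>simp_all only: funpow.simps comp_apply\<close>)
  then show ?case by (rule Suc.IH)
qed simp

lemma delta_pow_transpose:
  "(delta ^^ N) (\<lambda>m n. X n m) = (\<lambda>m n. ((-1) ^ N) *\<^sub>C (delta ^^ N) X n (m::int) :: 'v::complex_vector)"
  by (induction N) (simp_all add: delta_def fun_eq_iff cvec.scale_right_diff_distrib)

lemma delta_pow_inj':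
  fixes X :: "int \<Rightarrow> int \<Rightarrow> 'v::complex_vector"
  assumes b: "\<And>m n. m < K \<Longrightarrow> X m n = 0" and z: "(delta ^^ N) X = 0"
  shows "X = 0"
proof -
  have "(\<lambda>m n. X n m) = 0"
    by (rule delta_pow_inj[where K = K and N = N], erule b, subst delta_pow_transpose)
      (simp add: z fun_eq_iff)
  then show ?thesis by (auto simp: fun_eq_iff)
qed

section \<open>Re-expansion in powers of z - w\<close>

definition bounded_below :: "(int \<Rightarrow> int \<Rightarrow> 'v::zero) \<Rightarrow> bool"
  where "bounded_below Z \<longleftrightarrow> (\<exists>K. \<forall>m n. m < K \<or> n < K \<longrightarrow> Z m n = 0)"

text \<open>
  If \<open>Z(z,w)\<close> has coefficients \<open>Z m n\<close>, then \<open>diag q Z (n + q)\<close> is the coefficient of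
  \<open>(z-w)^q w^n\<close> after re-expansion of \<open>z^m = (w + (z-w))^m\<close>.
\<close>

definition diag :: "nat \<Rightarrow> (int \<Rightarrow> int \<Rightarrow> 'v::complex_vector) \<Rightarrow> int \<Rightarrow> 'v"
  where "diag q Z d = (\<Sum>m | Z m (d - m) \<noteq> 0. (of_int m gchoose q) *\<^sub>C Z m (d - m))"

lemma diag_eq_sum:
  assumes "finite A" "\<And>m. m \<notin> A \<Longrightarrow> Z m (d - m) = 0"
  shows "diag q Z d = (\<Sum>m\<in>A. (of_int m gchoose q) *\<^sub>C Z m (d - m))"
  unfolding diag_def
  by (rule sum.mono_neutral_left) (use assms in auto)

lemma diag_eq:
  assumes "\<forall>m n. m < K \<or> n < K \<longrightarrow> Z m n = 0"
  shows "diag q Z d = (\<Sum>m=K..d-K. (of_int m gchoose q) *\<^sub>C Z m (d - m))"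
  by (rule diag_eq_sum) (use assms in auto)

lemma bounded_below_common:
  assumes "bounded_below X" "bounded_below Y"
  obtains K where "\<forall>m n. m < K \<or> n < K \<longrightarrow> X m n = 0" "\<forall>m n. m < K \<or> n < K \<longrightarrow> Y m n = 0"
proof -
  obtain K1 K2 where "\<forall>m n. m < K1 \<or> n < K1 \<longrightarrow> X m n = 0" "\<forall>m n. m < K2 \<or> n < K2 \<longrightarrow> Y m n = 0"
    using assms unfolding bounded_below_def by blast
  then show ?thesis by (intro that[of "min K1 K2"]) auto
qed

lemma bounded_below_diff: "bounded_below X \<Longrightarrow> bounded_below Y \<Longrightarrow> bounded_below (X - (Y::int \<Rightarrow> int \<Rightarrow> 'v::group_add))"
  by (erule (1) bounded_below_common) (unfold bounded_below_def, rule_tac x = K in exI, simp)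

lemma bounded_below_scale: "bounded_below X \<Longrightarrow> bounded_below (c *\<^sub>C (X::int \<Rightarrow> int \<Rightarrow> 'v::complex_vector))"
  by (force simp: bounded_below_def scaleC_fun_def)

lemma bounded_below_hom: "bounded_below X \<Longrightarrow> h 0 = 0 \<Longrightarrow> bounded_below (\<lambda>m n. h (X m n))"
  unfolding bounded_below_def by (elim exE, rule_tac x = K in exI) simp

lemma bounded_below_shift1:
  assumes "bounded_below X" shows "bounded_below (\<lambda>m n. X (m - 1) n)"
proof -
  obtain K where "\<forall>m n. m < K \<or> n < K \<longrightarrow> X m n = 0"
    using assms unfolding bounded_below_def by blast
  then show ?thesis unfolding bounded_below_def by (intro exI[of _ K]) auto
qed

lemma bounded_below_transpose: "bounded_below X \<Longrightarrow> bounded_below (\<lambda>m n. X n m)"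
  by (force simp: bounded_below_def)

lemma bounded_below_shift2:
  assumes "bounded_below X" shows "bounded_below (\<lambda>m n. X m (n - 1))"
  using bounded_below_transpose[OF bounded_below_shift1[OF bounded_below_transpose[OF assms]]] .

lemma bounded_below_delta: "bounded_below X \<Longrightarrow> bounded_below (delta X)"
  using bounded_below_diff[OF bounded_below_shift1 bounded_below_shift2, of X X]
  unfolding delta_def fun_diff_def by simp

lemma diag_diff:
  assumes "bounded_below X" "bounded_below Y"
  shows "diag q (X - Y) d = diag q X d - diag q Y d"
proof -
  obtain K where K: "\<forall>m n. m < K \<or> n < K \<longrightarrow> X m n = 0" "\<forall>m n. m < K \<or> n < K \<longrightarrow> Y m n = 0"
    by (rule bounded_below_common[OF assms])
  have K': "\<forall>m n. m < K \<or> n < K \<longrightarrow> (X - Y) m n = 0" using K by simp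
  show ?thesis
    unfolding diag_eq[OF K(1)] diag_eq[OF K(2)] diag_eq[OF K']
    by (simp add: cvec.scale_right_diff_distrib sum_subtractf)
qed

lemma diag_hom:
  assumes "bounded_below X" "\<And>x y. h (x + y) = h x + h y" "\<And>c x. h (c *\<^sub>C x) = c *\<^sub>C h x"
  shows "diag q (\<lambda>m n. h (X m n)) d = h (diag q X d)"
proof -
  have h0: "h 0 = 0" using assms(3)[of 0 0] by simp
  obtain K where K: "\<forall>m n. m < K \<or> n < K \<longrightarrow> X m n = 0"
    using assms(1) unfolding bounded_below_def by blast
  have K': "\<forall>m n. m < K \<or> n < K \<longrightarrow> h (X m n) = 0" using K h0 by simp
  have hs: "h (sum g A) = (\<Sum>a\<in>A. h (g a))" for g and A :: "int set"
    by (induction A rule: infinite_finite_induct) (simp_all add: h0 assms(2))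
  show ?thesis unfolding diag_eq[OF K] diag_eq[OF K'] hs assms(3) ..
qed

lemma diag_scale: "bounded_below X \<Longrightarrow> diag q (c *\<^sub>C X) d = c *\<^sub>C diag q X d"
  using diag_hom[of X "\<lambda>x. c *\<^sub>C x" q d]
  by (simp add: scaleC_fun_def scaleC_add_right mult.commute)

text \<open>Multiplication by z is multiplication by w + (z-w); the two terms are those of Pascal's
  rule.\<close>

lemma diag_shift1:
  assumes "bounded_below X"
  shows "diag q (\<lambda>m n. X (m - 1) n) d
    = diag q X (d - 1) + (if q = 0 then 0 else diag (q - 1) X (d - 1))"
proof -
  obtain K where K: "\<forall>m n. m < K \<or> n < K \<longrightarrow> X m n = 0"
    using assms unfolding bounded_below_def by blast
  have K': "\<forall>m n. m < K \<or> n < K \<longrightarrow> X (m - 1) n = 0" using K by auto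
  have "diag q (\<lambda>m n. X (m - 1) n) d = (\<Sum>m=K+1..d-K. (of_int m gchoose q) *\<^sub>C X (m - 1) (d - m))"
    by (rule diag_eq_sum) (use K in auto)
  also have "\<dots> = (\<Sum>m=K..d-1-K. (of_int (m + 1) gchoose q) *\<^sub>C X m (d - 1 - m))"
    by (rule sum.reindex_bij_witness[where i="\<lambda>m. m + 1" and j="\<lambda>m. m - 1"]) (auto simp: algebra_simps)
  also have "\<dots> = diag q X (d - 1) + (if q = 0 then 0 else diag (q - 1) X (d - 1))"
  proof (cases q)
    case (Suc r)
    have "(of_int (m + 1) gchoose Suc r) = (of_int m gchoose Suc r) + (of_int m gchoose r :: complex)" for m
      using gbinomial_Suc_Suc[of "of_int m :: complex" r] by simp
    then show ?thesis
      by (simp add: Suc diag_eq[OF K] scaleC_add_left sum.distrib)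
  qed (simp add: diag_eq[OF K])
  finally show ?thesis .
qed

lemma diag_shift2: "diag q (\<lambda>m n. X m (n - 1)) d = diag q X (d - 1)"
  unfolding diag_def by (simp add: algebra_simps)

lemma diag_delta:
  assumes "bounded_below X"
  shows "diag q (delta X) d = (if q = 0 then 0 else diag (q - 1) X (d - 1))"
proof -
  have "delta X = (\<lambda>m n. X (m - 1) n) - (\<lambda>m n. X m (n - 1))"
    by (simp add: delta_def fun_eq_iff)
  then show ?thesis
    by (simp add: diag_diff[OF bounded_below_shift1 bounded_below_shift2] assms diag_shift1 diag_shift2)
qed

text \<open>\<open>diag 0 Z\<close> consists of the coefficients of Z(w,w), so this is divisibility
  by z - w of a series that vanishes on the diagonal.\<close>

lemma diag_0_divide:
  assumes bZ: "bounded_below Z" and z: "\<And>d. diag 0 Z d = 0"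
  obtains Z' where "bounded_below Z'" "delta Z' = Z"
proof -
  obtain K where K: "\<forall>m n. m < K \<or> n < K \<longrightarrow> Z m n = 0"
    using bZ unfolding bounded_below_def by blast
  \<comment> \<open>The recursion \<open>Z' m n = Z' (m - 1) (n + 1) - Z m (n + 1)\<close> forced by
    \<open>delta Z' = Z\<close>, solved along an antidiagonal from the value 0 below
    \<open>K\<close>. For \<open>n < K\<close> the sum covers the whole support, so the hypothesis
    makes it 0.\<close>
  define Z' where "Z' = (\<lambda>m n. - (\<Sum>m'=K..m. Z m' (m + n + 1 - m')))"
  have "Z' m n = 0" if "m < K \<or> n < K" for m n
  proof (cases "m < K")
    case False
    have "diag 0 Z (m + n + 1) = (\<Sum>m'=K..m. Z m' (m + n + 1 - m'))"
      by (subst diag_eq_sum[where A = "{K..m}"]) (use False that K in auto)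
    then show ?thesis using z by (simp add: Z'_def)
  qed (simp add: Z'_def)
  then have "bounded_below Z'" unfolding bounded_below_def by blast
  moreover have "delta Z' m n = Z m n" for m n
  proof (cases "m < K")
    case False
    then have "{K..m} = insert m {K..m - 1}" by auto
    then show ?thesis by (simp add: delta_def Z'_def)
  qed (simp add: delta_def Z'_def K)
  ultimately show ?thesis by (intro that[of Z']) (auto simp: fun_eq_iff)
qed

text \<open>On an antidiagonal the hypotheses are linear relations with coefficients (m choose q).
  They combine to relations with coefficients (m-K choose Q); if \<open>m0\<close> is the largest
  index in the support and \<open>Q = m0 - K\<close>, these are 0 for K \<le> m < m0 and 1 at
  \<open>m0\<close>, which isolates a nonzero term.\<close>

lemma diag_eq_0_imp_0:
  assumes bZ: "bounded_below Z" and z: "\<And>q d. diag q Z d = 0"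
  shows "Z = 0"
proof (rule ccontr)
  assume "Z \<noteq> 0"
  then obtain m1 n1 where 1: "Z m1 n1 \<noteq> 0" by (auto simp: fun_eq_iff)
  define d where "d = m1 + n1"
  obtain K where K: "\<forall>m n. m < K \<or> n < K \<longrightarrow> Z m n = 0"
    using bZ unfolding bounded_below_def by blast
  define A where "A = {m. Z m (d - m) \<noteq> 0}"
  have "A \<subseteq> {K..d-K}" using K by (auto simp: A_def not_less[symmetric])
  then have fin: "finite A" by (rule finite_subset) simp
  have "m1 \<in> A" using 1 by (simp add: A_def d_def)
  define m0 where "m0 = Max A"
  have m0: "m0 \<in> A" "\<And>m. m \<in> A \<Longrightarrow> m \<le> m0"
    using fin \<open>m1 \<in> A\<close> unfolding m0_def by (auto intro: Max_in)
  have ge: "K \<le> m" if "m \<in> A" for m using that \<open>A \<subseteq> {K..d-K}\<close> by auto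
  define Q where "Q = nat (m0 - K)"
  have dg: "diag q Z d = (\<Sum>m\<in>A. (of_int m gchoose q) *\<^sub>C Z m (d - m))" for q
    by (rule diag_eq_sum) (use fin in \<open>auto simp: A_def\<close>)
  \<comment> \<open>Vandermonde's convolution for the upper index \<open>m + (- K)\<close>.\<close>
  have "(\<Sum>m\<in>A. (of_int (m - K) gchoose Q) *\<^sub>C Z m (d - m))
      = (\<Sum>m\<in>A. \<Sum>k\<le>Q. (of_int (- K) gchoose (Q - k)) *\<^sub>C (of_int m gchoose k) *\<^sub>C Z m (d - m))"
  proof (rule sum.cong[OF refl])
    fix m
    have "(of_int (m - K) gchoose Q :: complex)
        = (\<Sum>k\<le>Q. (of_int m gchoose k) * (of_int (- K) gchoose (Q - k)))"
      using gbinomial_Vandermonde[of "of_int m :: complex" "of_int (- K)" Q]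
      by (simp add: atMost_atLeast0)
    then show "(of_int (m - K) gchoose Q) *\<^sub>C Z m (d - m)
      = (\<Sum>k\<le>Q. (of_int (- K) gchoose (Q - k)) *\<^sub>C (of_int m gchoose k) *\<^sub>C Z m (d - m))"
      by (simp add: cvec.scale_sum_left mult.commute)
  qed
  also have "\<dots> = (\<Sum>k\<le>Q. (of_int (- K) gchoose (Q - k)) *\<^sub>C diag k Z d)"
    by (subst sum.swap) (simp only: dg cvec.scale_sum_right)
  also have "\<dots> = 0" by (simp add: z)
  finally have s0: "(\<Sum>m\<in>A. (of_int (m - K) gchoose Q) *\<^sub>C Z m (d - m)) = 0" .
  have "(of_int (m - K) gchoose Q) *\<^sub>C Z m (d - m) = (if m = m0 then Z m0 (d - m0) else 0)"
    if "m \<in> A" for m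
  proof -
    have e: "(of_int (m - K) :: complex) = of_nat (nat (m - K))" using ge[OF that] by simp
    have "(of_int (m - K) gchoose Q :: complex) = of_nat (nat (m - K) choose Q)"
      unfolding e by (simp add: binomial_gbinomial)
    moreover have "nat (m - K) < Q" if "m \<noteq> m0"
      using m0(2)[OF \<open>m \<in> A\<close>] that ge[OF \<open>m \<in> A\<close>] unfolding Q_def by linarith
    ultimately show ?thesis by (auto simp: Q_def)
  qed
  then have "(\<Sum>m\<in>A. (of_int (m - K) gchoose Q) *\<^sub>C Z m (d - m)) = Z m0 (d - m0)"
    using m0(1) fin by simp
  with s0 m0(1) show False by (simp add: A_def)
qed

text \<open>Exchanging \<open>z\<close> and \<open>w\<close>: Taylor's formula, which reduces to the Vandermonde convolution.\<close>

lemma diag_transpose: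
  assumes bZ: "bounded_below Z"
  shows "diag q (\<lambda>m n. Z n m) (n + int q)
    = (\<Sum>k\<le>q. ((-1) ^ (q - k) * (of_int (n + int k) gchoose k)) *\<^sub>C diag (q - k) Z (n + int q))"
proof -
  obtain K where K: "\<forall>m n. m < K \<or> n < K \<longrightarrow> Z m n = 0"
    using bZ unfolding bounded_below_def by blast
  define d where "d = n + int q"
  have K': "\<forall>m n. m < K \<or> n < K \<longrightarrow> Z n m = 0" using K by auto
  have id: "(of_int (d - m) gchoose q :: complex)
      = (\<Sum>k\<le>q. ((-1) ^ (q - k) * (of_int (n + int k) gchoose k)) * (of_int m gchoose (q - k)))" for m
  proof -
    \<comment> \<open>Negating upper indices turns the upper index \<open>n + k\<close>, which
      varies with \<open>k\<close>, into the constant \<open>- n - 1\<close>; the sum is then a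
      Vandermonde convolution.\<close>
    have neg: "(of_int (n + int k) gchoose k :: complex) = (-1) ^ k * ((of_int (- n - 1)) gchoose k)" for k
      using gbinomial_negated_upper[of "of_int (n + int k) :: complex" k]
      by (simp add: algebra_simps)
    have neg2: "(of_int (d - m) gchoose q :: complex) = (-1) ^ q * ((of_int (m - n - 1)) gchoose q)"
      using gbinomial_negated_upper[of "of_int (d - m) :: complex" q]
      by (simp add: algebra_simps d_def)
    have "(of_int (m - n - 1) gchoose q :: complex)
        = (\<Sum>k\<le>q. ((of_int (- n - 1)) gchoose k) * (of_int m gchoose (q - k)))"
      using gbinomial_Vandermonde[of "of_int (- n - 1) :: complex" "of_int m" q]
      by (simp add: atMost_atLeast0 algebra_simps)
    then have "(of_int (d - m) gchoose q :: complex)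
        = (\<Sum>k\<le>q. (-1) ^ q * (((of_int (- n - 1)) gchoose k) * (of_int m gchoose (q - k))))"
      unfolding neg2 by (simp only: sum_distrib_left)
    also have "\<dots> = (\<Sum>k\<le>q. ((-1) ^ (q - k) * (of_int (n + int k) gchoose k)) * (of_int m gchoose (q - k)))"
    proof (rule sum.cong[OF refl])
      fix k assume "k \<in> {..q}"
      then have "(-1::complex) ^ q = (-1) ^ (q - k) * (-1) ^ k" by (simp flip: power_add)
      then show "(-1) ^ q * (((of_int (- n - 1)) gchoose k) * (of_int m gchoose (q - k)))
        = ((-1) ^ (q - k) * (of_int (n + int k) gchoose k)) * (of_int m gchoose (q - k) :: complex)"
        by (simp only: neg mult_ac)
    qed
    finally show ?thesis .
  qed
  have "diag q (\<lambda>m n. Z n m) d = (\<Sum>m=K..d-K. (of_int m gchoose q) *\<^sub>C Z (d - m) m)"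
    using diag_eq[OF K'] .
  also have "\<dots> = (\<Sum>m=K..d-K. (of_int (d - m) gchoose q) *\<^sub>C Z m (d - m))"
    by (rule sum.reindex_bij_witness[where i="\<lambda>m. d - m" and j="\<lambda>m. d - m"]) auto
  also have "\<dots> = (\<Sum>m=K..d-K. \<Sum>k\<le>q. ((-1) ^ (q - k) * (of_int (n + int k) gchoose k))
      *\<^sub>C (of_int m gchoose (q - k)) *\<^sub>C Z m (d - m))"
    unfolding id by (simp add: cvec.scale_sum_left)
  also have "\<dots> = (\<Sum>k\<le>q. ((-1) ^ (q - k) * (of_int (n + int k) gchoose k)) *\<^sub>C diag (q - k) Z d)"
    by (subst sum.swap) (simp only: diag_eq[OF K] cvec.scale_sum_right)
  finally show ?thesis by (simp only: d_def)
qed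

section \<open>Trivializing the commutation factors\<close>

text \<open>
  Think of operators \<open>Y_i\<close> of degree \<open>i\<close> on a sum of lines \<open>k\<close>, such that on the line \<open>k\<close> the product
  \<open>Y_i Y_j\<close> is \<open>\<phi> i j k\<close> times \<open>Y_(i+j)\<close>, and such that exchanging the arguments of the structure maps costs
  \<open>\<omega> i j\<close>.  Then \<open>Y_i Y_j = B i j k Y_j Y_i\<close> on \<open>k\<close>.
\<close>

locale braiding =
  fixes \<phi> :: "'i::ab_group_add \<Rightarrow> 'i \<Rightarrow> 'i \<Rightarrow> complex" and \<omega> :: "'i \<Rightarrow> 'i \<Rightarrow> complex"
  assumes phi_nz [simp]: "\<phi> i j k \<noteq> 0" and om_nz [simp]: "\<omega> i j \<noteq> 0"
begin

definition B :: "'i \<Rightarrow> 'i \<Rightarrow> 'i \<Rightarrow> complex"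
  where "B i j k = \<phi> i j k / (\<phi> j i k * \<omega> i j)"

lemma B_nz [simp]: "B i j k \<noteq> 0"
  by (simp add: B_def)

end

text \<open>The hexagon computes Y_i Y_j Y_l on the line \<open>k\<close> in two ways: Y_l is moved
  to the front past Y_(i+j), after fusing Y_i and Y_j, or past the two operators one at a
  time.\<close>

locale abelian_cocycle = braiding \<phi> \<omega>
  for \<phi> :: "'i::ab_group_add \<Rightarrow> 'i \<Rightarrow> 'i \<Rightarrow> complex" and \<omega> +
  assumes antisym: "B i j k * B j i k = 1"
    and hexagon: "B (i + j) l k * \<phi> i j (l + k) = \<phi> i j k * B i l (j + k) * B j l k"
    and phi_0 [simp]: "\<phi> 0 j k = 1"
    and B_0 [simp]: "B 0 j k = 1"
begin

lemma B_inv: "B j i k = 1 / B i j k"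
  using antisym[of j i k] by (simp add: field_simps)

text \<open>A pentagon up to a factor independent of \<open>k\<close>, which suffices since constants are divided out below.\<close>

lemma pentagon_ratio:
  "\<phi> (i + j) h k * \<phi> i j (h + k) * (\<phi> i (j + h) 0 * \<phi> j h 0)
    = \<phi> (i + j) h 0 * \<phi> i j h * (\<phi> i (j + h) k * \<phi> j h k)"
proof -
  have h1: "B (i + j + h) k 0 = \<phi> (i + j) h 0 * B (i + j) k h * B h k 0 / \<phi> (i + j) h k"
    using hexagon[of "i + j" h k 0] by (simp add: field_simps)
  have h2: "B (i + j) k h = \<phi> i j h * B i k (j + h) * B j k h / \<phi> i j (h + k)"
    using hexagon[of i j k h] by (simp add: field_simps add.commute)
  have h3: "B (i + j + h) k 0 = \<phi> i (j + h) 0 * B i k (j + h) * B (j + h) k 0 / \<phi> i (j + h) k"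
    using hexagon[of i "j + h" k 0] by (simp add: field_simps add.assoc)
  have h4: "B (j + h) k 0 = \<phi> j h 0 * B j k h * B h k 0 / \<phi> j h k"
    using hexagon[of j h k 0] by (simp add: field_simps)
  from h1 h3 have "\<phi> (i + j) h 0 * B (i + j) k h * B h k 0 / \<phi> (i + j) h k
     = \<phi> i (j + h) 0 * B i k (j + h) * B (j + h) k 0 / \<phi> i (j + h) k" by simp
  then show ?thesis unfolding h2 h4 by (simp add: field_simps)
qed

text \<open>For equal indices \<open>\<phi>\<close> cancels in \<open>B\<close>, which leaves
  \<open>1 / \<omega> i i\<close>.\<close>

lemma B_diag: "B i i k * B i i k = 1" "B i i k = B i i l"
  using antisym[of i i k] by (simp_all add: B_def)

text \<open>Two hexagons express the factor through values of \<open>\<phi> i i\<close>, the signs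
  from \<open>B_diag\<close> cancelling in pairs; the resulting product telescopes.\<close>

lemma B_double: "B (i + i) (i + i) k = 1"
proof -
  have 1: "B (i + i) l k = \<phi> i i k / \<phi> i i (l + k) * (B i l (i + k) * B i l k)" for l k
    using hexagon[of i i l k] by (simp add: field_simps)
  have "B i i (i + k) * B i i k = 1" for k using B_diag(1)[of i k] B_diag(2)[of i k "i + k"] by simp
  then have "B (i + i) i k = \<phi> i i k / \<phi> i i (i + k)" for k by (simp add: 1)
  then have "B i (i + i) k = \<phi> i i (i + k) / \<phi> i i k" for k by (simp add: B_inv[of i "i + i"])
  then show ?thesis by (simp add: 1[of "i + i" k] add.assoc)
qed

lemma om_double: "\<omega> (i + i) (i + i) = 1"
  using B_double[of i 0] by (simp add: B_def field_simps)

text \<open>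
  The pair \<open>(i, f)\<close> stands for the operator \<open>f k Y_i\<close> on the line \<open>k\<close>, up to a constant, whence the
  normalization \<open>f 0 = 1\<close>.  The product is composition, and \<open>com\<close> is commutation corrected by the factor \<open>B\<close>.
\<close>

fun com :: "'i \<times> ('i \<Rightarrow> complex) \<Rightarrow> 'i \<times> ('i \<Rightarrow> complex) \<Rightarrow> bool"
  where "com (i, f) (j, g) \<longleftrightarrow> (\<forall>k. f (j + k) * g k * B i j k = g (i + k) * f k)"

definition nrm :: "('i \<Rightarrow> complex) \<Rightarrow> 'i \<Rightarrow> complex"
  where "nrm f = (\<lambda>k. f k / f 0)"

definition doubled :: "('i \<times> ('i \<Rightarrow> complex)) monoid"
  where "doubled = \<lparr>
    carrier = doubles \<times> {f. f 0 = 1 \<and> (\<forall>k. f k \<noteq> 0)},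
    monoid.mult = (\<lambda>p q. (fst p + fst q, nrm (\<lambda>k. snd p (fst q + k) * snd q k * \<phi> (fst p) (fst q) k))),
    one = (0, \<lambda>_. 1)\<rparr>"

lemma in_carrier: "(i, f) \<in> carrier doubled \<longleftrightarrow> i \<in> doubles \<and> f 0 = 1 \<and> (\<forall>k. f k \<noteq> 0)"
  by (simp add: doubled_def)

lemma mult_eq: "(i, f) \<otimes>\<^bsub>doubled\<^esub> (j, g) = (i + j, nrm (\<lambda>k. f (j + k) * g k * \<phi> i j k))"
  by (simp add: doubled_def)

lemma fst_mult: "fst (p \<otimes>\<^bsub>doubled\<^esub> q) = fst p + fst q"
  by (simp add: doubled_def)

lemma one_eq: "\<one>\<^bsub>doubled\<^esub> = (0, \<lambda>_. 1)"
  by (simp add: doubled_def)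

lemma nrm_nz: "\<forall>k. f k \<noteq> 0 \<Longrightarrow> nrm f 0 = 1 \<and> (\<forall>k. nrm f k \<noteq> 0)"
  by (simp add: nrm_def)

lemma nrm_prop: "c \<noteq> 0 \<Longrightarrow> (\<And>k. f k = c * g k) \<Longrightarrow> nrm f = nrm g"
  by (simp add: nrm_def)

lemma nrm_id: "f 0 = 1 \<Longrightarrow> nrm f = f"
  by (simp add: nrm_def)

lemma com_nrm: "\<forall>k. f k \<noteq> 0 \<Longrightarrow> com (i, nrm f) q \<longleftrightarrow> com (i, f) q"
  by (cases q) (simp add: nrm_def field_simps)

lemma doubles_0: "0 \<in> (doubles :: 'i set)"
  unfolding doubles_def by (auto intro!: exI[of _ 0])

lemma doubles_add:
  assumes "i \<in> doubles" "j \<in> doubles" shows "i + j \<in> (doubles :: 'i set)"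
proof -
  obtain a b where "i = a + a" "j = b + b" using assms unfolding doubles_def by blast
  then have "i + j = (a + b) + (a + b)" by (simp add: add_ac)
  then show ?thesis unfolding doubles_def by blast
qed

lemma doubles_minus:
  assumes "i \<in> doubles" shows "- i \<in> (doubles :: 'i set)"
proof -
  obtain a where "i = a + a" using assms unfolding doubles_def by blast
  then have "- i = - a + - a" by simp
  then show ?thesis unfolding doubles_def by blast
qed

text \<open>The two bracketings of a triple product differ by values of \<open>\<phi>\<close> whose
  ratio does not depend on \<open>k\<close>, by \<open>pentagon_ratio\<close>, and so disappears
  under \<open>nrm\<close>.\<close>

lemma group_doubled: "group doubled"
proof (rule groupI)
  fix p q assume "p \<in> carrier doubled" "q \<in> carrier doubled"
  then show "p \<otimes>\<^bsub>doubled\<^esub> q \<in> carrier doubled"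
    by (cases p, cases q) (simp add: mult_eq in_carrier doubles_add nrm_def)
next
  show "\<one>\<^bsub>doubled\<^esub> \<in> carrier doubled" by (simp add: one_eq in_carrier doubles_0)
next
  fix p q r assume p: "p \<in> carrier doubled" "q \<in> carrier doubled" "r \<in> carrier doubled"
  obtain i f j g h e where [simp]: "p = (i, f)" "q = (j, g)" "r = (h, e)"
    by (cases p, cases q, cases r)
  have nz [simp]: "f k \<noteq> 0" "g k \<noteq> 0" "e k \<noteq> 0" "f 0 = 1" "g 0 = 1" "e 0 = 1" for k using p by (simp_all add: in_carrier)
  have "nrm (\<lambda>k. nrm (\<lambda>k. f (j + k) * g k * \<phi> i j k) (h + k) * e k * \<phi> (i + j) h k)
      = nrm (\<lambda>k. f (j + h + k) * g (h + k) * e k * (\<phi> (i + j) h k * \<phi> i j (h + k)))"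
    by (rule nrm_prop[where c = "1 / (f j * \<phi> i j 0)"]) (simp_all only: nrm_def add.assoc, simp_all)
  also have "\<dots> = nrm (\<lambda>k. f (j + h + k) * g (h + k) * e k * (\<phi> i (j + h) k * \<phi> j h k))"
  proof (rule nrm_prop)
    show "\<phi> (i + j) h 0 * \<phi> i j h / (\<phi> i (j + h) 0 * \<phi> j h 0) \<noteq> 0" by simp
    fix k
    have "\<phi> (i + j) h k * \<phi> i j (h + k) = \<phi> (i + j) h 0 * \<phi> i j h / (\<phi> i (j + h) 0 * \<phi> j h 0)
        * (\<phi> i (j + h) k * \<phi> j h k)"
      using pentagon_ratio[of i j h k] by (simp add: field_simps)
    then show "f (j + h + k) * g (h + k) * e k * (\<phi> (i + j) h k * \<phi> i j (h + k))
        = \<phi> (i + j) h 0 * \<phi> i j h / (\<phi> i (j + h) 0 * \<phi> j h 0)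
          * (f (j + h + k) * g (h + k) * e k * (\<phi> i (j + h) k * \<phi> j h k))"
      by (simp only: mult.left_commute)
  qed
  also have "\<dots> = nrm (\<lambda>k. f (j + h + k) * nrm (\<lambda>k. g (h + k) * e k * \<phi> j h k) k * \<phi> i (j + h) k)"
    by (rule nrm_prop[where c = "g h * \<phi> j h 0"]) (simp_all add: nrm_def)
  finally have "nrm (\<lambda>k. nrm (\<lambda>k. f (j + k) * g k * \<phi> i j k) (h + k) * e k * \<phi> (i + j) h k)
    = nrm (\<lambda>k. f (j + h + k) * nrm (\<lambda>k. g (h + k) * e k * \<phi> j h k) k * \<phi> i (j + h) k)" .
  then show "p \<otimes>\<^bsub>doubled\<^esub> q \<otimes>\<^bsub>doubled\<^esub> r = p \<otimes>\<^bsub>doubled\<^esub> (q \<otimes>\<^bsub>doubled\<^esub> r)"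
    by (simp add: mult_eq add.assoc)
next
  fix p assume p: "p \<in> carrier doubled"
  obtain i f where [simp]: "p = (i, f)" by (cases p)
  have nz [simp]: "f k \<noteq> 0" "f 0 = 1" for k using p by (simp_all add: in_carrier)
  show "\<one>\<^bsub>doubled\<^esub> \<otimes>\<^bsub>doubled\<^esub> p = p"
    by (simp add: one_eq mult_eq nrm_id)
  \<comment> \<open>The solution of \<open>g (i + k) * f k * \<phi> (- i) i k = 1\<close>.\<close>
  define g where "g = (\<lambda>k. 1 / (f (k - i) * \<phi> (- i) i (k - i)))"
  have "nrm (\<lambda>k. nrm g (i + k) * f k * \<phi> (- i) i k) = (\<lambda>_. 1)"
    by (simp add: nrm_def g_def)
  moreover have "(- i, nrm g) \<in> carrier doubled"
    using p by (simp add: in_carrier doubles_minus nrm_def g_def)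
  ultimately show "\<exists>q\<in>carrier doubled. q \<otimes>\<^bsub>doubled\<^esub> p = \<one>\<^bsub>doubled\<^esub>"
    by (intro bexI[of _ "(- i, nrm g)"]) (simp_all add: mult_eq one_eq)
qed

lemma com_sym: "com p q \<Longrightarrow> com q p"
proof -
  assume c: "com p q"
  obtain i f j g where [simp]: "p = (i, f)" "q = (j, g)" by (cases p, cases q)
  have "f (j + k) * g k * B i j k = g (i + k) * f k" for k using c by simp
  then have "g (i + k) * f k * B j i k = f (j + k) * g k" for k
    by (simp add: B_inv[of j i] flip: \<open>\<And>k. f (j + k) * g k * B i j k = g (i + k) * f k\<close>)
  then show ?thesis by simp
qed

text \<open>By the hexagon, moving \<open>r\<close> past the product costs the same as moving it
  past each factor, and the part belonging to \<open>q\<close> cancels. Having an equivalence makes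
  centralizers closed under inverses as well as products.\<close>

lemma com_mult_right:
  assumes "p \<in> carrier doubled" "q \<in> carrier doubled" "com q r"
  shows "com (p \<otimes>\<^bsub>doubled\<^esub> q) r \<longleftrightarrow> com p r"
proof -
  obtain i f j g l h where [simp]: "p = (i, f)" "q = (j, g)" "r = (l, h)"
    by (cases p, cases q, cases r)
  have nz: "f k \<noteq> 0" "g k \<noteq> 0" for k using assms by (simp_all add: in_carrier)
  have c: "g (l + k) * h k * B j l k = h (j + k) * g k" for k using assms by simp
  have eq: "f (j + (l + k)) * g (l + k) * \<phi> i j (l + k) * h k * B (i + j) l k
      = (f (l + (j + k)) * h (j + k) * B i l (j + k)) * (g k * \<phi> i j k)" for k
  proof -
    have "f (j + (l + k)) * g (l + k) * \<phi> i j (l + k) * h k * B (i + j) l k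
      = f (j + (l + k)) * g (l + k) * h k * (B (i + j) l k * \<phi> i j (l + k))" by simp
    also have "\<dots> = f (j + (l + k)) * (g (l + k) * h k * B j l k) * \<phi> i j k * B i l (j + k)"
      unfolding hexagon by simp
    also have "g (l + k) * h k * B j l k = h (j + k) * g k" by (rule c)
    finally show ?thesis by (simp add: add.left_commute[of j] mult_ac)
  qed
  have "com (p \<otimes>\<^bsub>doubled\<^esub> q) r \<longleftrightarrow> com (i + j, \<lambda>k. f (j + k) * g k * \<phi> i j k) r"
    by (simp only: \<open>p = (i, f)\<close> \<open>q = (j, g)\<close> mult_eq, rule com_nrm) (simp add: nz)
  also have "\<dots> \<longleftrightarrow> (\<forall>k. (f (l + (j + k)) * h (j + k) * B i l (j + k)) * (g k * \<phi> i j k)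
      = (h (i + (j + k)) * f (j + k)) * (g k * \<phi> i j k))"
    unfolding \<open>r = (l, h)\<close> com.simps eq by (simp add: mult_ac add.assoc)
  also have "\<dots> \<longleftrightarrow> (\<forall>k. f (l + (j + k)) * h (j + k) * B i l (j + k) = h (i + (j + k)) * f (j + k))"
    by (simp add: nz)
  also have "\<dots> \<longleftrightarrow> (\<forall>k. f (l + k) * h k * B i l k = h (i + k) * f k)"
    by (metis add.commute diff_add_cancel)
  finally show ?thesis by simp
qed

lemma com_one: "com \<one>\<^bsub>doubled\<^esub> r"
  by (cases r) (simp add: one_eq)

section \<open>Centralizers in the group of pairs\<close>

definition centralizer :: "('i \<times> ('i \<Rightarrow> complex)) set \<Rightarrow> ('i \<times> ('i \<Rightarrow> complex)) set"
  where "centralizer A = {p \<in> carrier doubled. \<forall>r\<in>A. com p r}"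

lemma subgroup_centralizer: "subgroup (centralizer A) doubled"
proof -
  interpret group doubled by (rule group_doubled)
  show ?thesis
  proof (rule subgroupI)
    show "centralizer A \<noteq> {}" using com_one one_closed unfolding centralizer_def by blast
    fix p assume p: "p \<in> centralizer A"
    then have c: "p \<in> carrier doubled" by (simp add: centralizer_def)
    have "com (inv\<^bsub>doubled\<^esub> p) r" if "r \<in> A" for r
      using com_mult_right[of "inv\<^bsub>doubled\<^esub> p" p r] p that com_one[of r] c
      by (simp add: centralizer_def)
    then show "inv\<^bsub>doubled\<^esub> p \<in> centralizer A" using c by (simp add: centralizer_def)
    fix q assume "q \<in> centralizer A"
    then show "p \<otimes>\<^bsub>doubled\<^esub> q \<in> centralizer A" using p by (simp add: centralizer_def com_mult_right)
  qed (auto simp: centralizer_def)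
qed

text \<open>\<open>com\<close> also prescribes the constant \<open>\<omega> i j\<close> by which the
  two unnormalized products differ; normalization forgets this constant.\<close>

lemma com_imp_commute:
  assumes "p \<in> carrier doubled" "q \<in> carrier doubled" "com p q"
  shows "p \<otimes>\<^bsub>doubled\<^esub> q = q \<otimes>\<^bsub>doubled\<^esub> p"
proof -
  obtain i f j g where [simp]: "p = (i, f)" "q = (j, g)" by (cases p, cases q)
  have nz [simp]: "f k \<noteq> 0" "g k \<noteq> 0" "f 0 = 1" "g 0 = 1" for k using assms by (simp_all add: in_carrier)
  have "f (j + k) * g k * B i j k = g (i + k) * f k" for k using assms(3) by simp
  then have "f (j + k) * g k * \<phi> i j k = g (i + k) * f k * \<phi> j i k * \<omega> i j" for k
    by (simp add: B_def flip: \<open>\<And>k. f (j + k) * g k * B i j k = g (i + k) * f k\<close>)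
  then have "nrm (\<lambda>k. f (j + k) * g k * \<phi> i j k) = nrm (\<lambda>k. g (i + k) * f k * \<phi> j i k)"
    by (intro nrm_prop[where c = "\<omega> i j"]) (simp_all add: mult_ac)
  then show ?thesis
    by (simp add: mult_eq add.commute[of j i])
qed

text \<open>For \<open>p = (i, f)\<close> the values of \<open>f\<close> cancel and
  \<open>B i i k = 1\<close> remains, which holds because the first components are doubles.\<close>

lemma com_self: "p \<in> carrier doubled \<Longrightarrow> com p p"
  by (cases p) (auto simp: in_carrier doubles_def B_double)

text \<open>A root function, instead of a root chosen separately at every point, lets roots of an
  invariant function be invariant; \<open>\<rho> 1 = 1\<close> preserves the normalization at
  0.\<close>

lemma complex_root_choice:
  assumes "N > 0"
  obtains \<rho> where "\<rho> 1 = 1" "\<And>z::complex. \<rho> z ^ N = 1 / z"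
proof -
  have "\<exists>\<rho>::complex \<Rightarrow> complex. \<forall>z. \<rho> z ^ N = 1 / z"
  proof (rule choice, rule)
    fix z :: complex
    show "\<exists>w. w ^ N = 1 / z"
      by (rule exI[of _ "rcis (root N (cmod (1 / z))) (Arg (1 / z) / real N)"])
        (use assms in \<open>simp only: DeMoivre2 real_root_pow_pos2 norm_ge_zero, simp add: rcis_cmod_Arg\<close>)
  qed
  then obtain \<rho> :: "complex \<Rightarrow> complex" where "\<And>z. \<rho> z ^ N = 1 / z" by blast
  then show ?thesis using that[of "\<rho>(1 := 1)"] by simp
qed

lemma fst_inv: "p \<in> carrier doubled \<Longrightarrow> fst (inv\<^bsub>doubled\<^esub> p) = - fst p"
  using fst_mult[of "inv\<^bsub>doubled\<^esub> p" p] group.l_inv[OF group_doubled, of p]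
  by (simp add: one_eq add_eq_0_iff2)

text \<open>The function \<open>f\<close> is transported along the cosets of \<open>fst ` C\<close> from their representatives.\<close>

lemma commuting_section:
  assumes C: "subgroup C doubled" and comC: "\<forall>p\<in>C. \<forall>q\<in>C. com p q"
    and triv: "\<forall>p\<in>C. fst p = 0 \<longrightarrow> p = \<one>\<^bsub>doubled\<^esub>" and x: "x \<in> doubles"
  obtains f where "(x, f) \<in> centralizer C"
proof -
  interpret group doubled by (rule group_doubled)
  define S where "S = fst ` C"
  have Cc: "C \<subseteq> carrier doubled" using C by (rule subgroup.subset)
  have S_add: "s + t \<in> S" if st: "s \<in> S" "t \<in> S" for s t
  proof -
    obtain p q where "p \<in> C" "q \<in> C" "s = fst p" "t = fst q" using st unfolding S_def by blast
    then show ?thesis using subgroup.m_closed[OF C, of p q] unfolding S_def by (metis fst_mult imageI)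
  qed
  have S_minus: "- s \<in> S" if s: "s \<in> S" for s
  proof -
    obtain p where p: "p \<in> C" "s = fst p" using s unfolding S_def by blast
    then have "fst (inv\<^bsub>doubled\<^esub> p) = - s" using Cc by (auto intro: fst_inv)
    then show ?thesis using subgroup.m_inv_closed[OF C p(1)] unfolding S_def by (metis imageI)
  qed
  have S_0: "0 \<in> S" using subgroup.one_closed[OF C] unfolding S_def by (metis fst_conv imageI one_eq)
  have uniq: "p = q" if "p \<in> C" "q \<in> C" "fst p = fst q" for p q
  proof -
    have c: "p \<in> carrier doubled" "q \<in> carrier doubled" using that Cc by auto
    have "p \<otimes>\<^bsub>doubled\<^esub> inv\<^bsub>doubled\<^esub> q \<in> C" using that C by (simp add: subgroup.m_closed subgroup.m_inv_closed)
    moreover have "fst (p \<otimes>\<^bsub>doubled\<^esub> inv\<^bsub>doubled\<^esub> q) = 0" using that c by (simp add: fst_mult fst_inv)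
    ultimately have "p \<otimes>\<^bsub>doubled\<^esub> inv\<^bsub>doubled\<^esub> q = \<one>\<^bsub>doubled\<^esub>" using triv by blast
    then show ?thesis using c inv_equality[of p "inv\<^bsub>doubled\<^esub> q"] by simp
  qed
  define g where "g = (\<lambda>s. snd (SOME p. p \<in> C \<and> fst p = s))"
  have gC: "(s, g s) \<in> C" if "s \<in> S" for s
  proof -
    have "\<exists>p. p \<in> C \<and> fst p = s" using that by (auto simp: S_def)
    from someI_ex[OF this] show ?thesis unfolding g_def by (metis prod.collapse)
  qed
  have g_eq: "h = g s" if "(s, h) \<in> C" for s h
    using uniq[OF that gC, of s] that by (force simp: S_def)
  have g_nz: "g s k \<noteq> 0" if "s \<in> S" for s k using gC[OF that] Cc by (auto simp: in_carrier)
  \<comment> \<open>The ratio \<open>f (s + k) / f k\<close> that commutation of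
    \<open>(x, f)\<close> with \<open>(s, g s)\<close> dictates.\<close>
  define R where "R = (\<lambda>s k. g s (x + k) * B s x k / g s k)"
  have R_nz: "R s k \<noteq> 0" if "s \<in> S" for s k using that by (simp add: R_def g_nz)
  \<comment> \<open>Consistency of the prescribed ratios under translation by \<open>S\<close>; this
    is the hexagon combined with the product formula for \<open>g (s + t)\<close>.\<close>
  have R_add: "R (s + t) k = R s (t + k) * R t k" if st: "s \<in> S" "t \<in> S" for s t k
  proof -
    have "(s, g s) \<otimes>\<^bsub>doubled\<^esub> (t, g t) \<in> C" using gC st by (simp add: subgroup.m_closed[OF C])
    then have gst: "g (s + t) = nrm (\<lambda>k. g s (t + k) * g t k * \<phi> s t k)" using g_eq by (simp add: mult_eq)
    have Bst: "B (s + t) x k = \<phi> s t k * B s x (t + k) * B t x k / \<phi> s t (x + k)"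
      using hexagon[of s t x k] by (simp add: field_simps)
    show ?thesis unfolding R_def gst Bst using g_nz st
      by (simp add: nrm_def field_simps add_ac)
  qed
  define r where "r = (\<lambda>k::'i. SOME k'. k - k' \<in> S)"
  have r: "k - r k \<in> S" for k unfolding r_def by (rule someI[of _ k]) (simp add: S_0)
  have r_inv: "r (s + k) = r k" if "s \<in> S" for s k
  proof -
    have "s + k - k' \<in> S \<longleftrightarrow> k - k' \<in> S" for k'
      using S_add[OF that, of "k - k'"] S_add[OF S_minus[OF that], of "s + k - k'"] by (auto simp: algebra_simps)
    then show ?thesis by (simp add: r_def)
  qed
  define f where "f = (\<lambda>k. R (k - r k) (r k))"
  have f_nz: "\<forall>k. f k \<noteq> 0" by (simp add: f_def R_nz r)
  have f_shift: "f (s + k) = R s k * f k" if "s \<in> S" for s k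
    using R_add[OF that r, of k "r k"] by (simp add: f_def r_inv[OF that] add_diff_eq)
  have "com (x, f) q" if "q \<in> C" for q
  proof -
    obtain s h where [simp]: "q = (s, h)" by (cases q)
    have s: "s \<in> S" "h = g s" using that g_eq by (force simp: S_def)+
    show ?thesis using s(1) by (simp add: s(2) f_shift R_def g_nz B_inv[of x s])
  qed
  then have "(x, nrm f) \<in> centralizer C"
    using x f_nz nrm_nz[OF f_nz] by (simp add: centralizer_def in_carrier com_nrm)
  then show ?thesis by (rule that)
qed

lemma pow_0: "f 0 = 1 \<Longrightarrow> (0, f) [^]\<^bsub>doubled\<^esub> (n::nat) = (0, \<lambda>k. f k ^ n)"
  by (induction n) (simp_all add: one_eq mult_eq nrm_def mult.commute)

text \<open>
  Elements over \<open>0\<close> that commute with everything in sight are invariant functions; hence so are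
  their roots, and \<open>y\<close> can be corrected such that its first power over \<open>fst ` C\<close> lies in \<open>C\<close>.
\<close>

lemma fst_pow_cong:
  assumes "p \<in> carrier doubled" "q \<in> carrier doubled" "fst p = fst q"
  shows "fst (p [^]\<^bsub>doubled\<^esub> (n::int)) = fst (q [^]\<^bsub>doubled\<^esub> n)"
proof -
  interpret group doubled by (rule group_doubled)
  have nat: "fst (p [^]\<^bsub>doubled\<^esub> (m::nat)) = fst (q [^]\<^bsub>doubled\<^esub> m)" for m
    by (induction m) (simp_all add: fst_mult assms)
  show ?thesis
    by (cases n) (simp_all only: int_pow_int int_pow_neg_int nat fst_inv assms nat_pow_closed)
qed

lemma root_correction:
  assumes C: "subgroup C doubled" and comC: "\<forall>p\<in>C. \<forall>q\<in>C. com p q"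
    and y: "y \<in> centralizer C"
  obtains y' where "y' \<in> centralizer C" "fst y' = fst y"
    "\<And>n::int. fst (y' [^]\<^bsub>doubled\<^esub> n) \<in> fst ` C \<Longrightarrow> y' [^]\<^bsub>doubled\<^esub> n \<in> C"
proof -
  interpret group doubled by (rule group_doubled)
  define S where "S = fst ` C"
  have Cc: "C \<subseteq> carrier doubled" using C by (rule subgroup.subset)
  have yc: "y \<in> carrier doubled" using y by (simp add: centralizer_def)
  have S_minus: "- s \<in> S" if s: "s \<in> S" for s
  proof -
    obtain p where p: "p \<in> C" "s = fst p" using s unfolding S_def by blast
    then have "fst (inv\<^bsub>doubled\<^esub> p) = - s" using Cc by (auto intro: fst_inv)
    then show ?thesis using subgroup.m_inv_closed[OF C p(1)] unfolding S_def by (metis imageI)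
  qed
  show ?thesis
  proof (cases "\<exists>n::nat. n > 0 \<and> fst (y [^]\<^bsub>doubled\<^esub> n) \<in> S")
    case False
    \<comment> \<open>No positive power of \<open>y\<close> lies over \<open>S\<close>, nor does a
      negative one since \<open>S\<close> is closed under negation; so \<open>y\<close> itself
      serves.\<close>
    have "n = 0" if n: "fst (y [^]\<^bsub>doubled\<^esub> n) \<in> S" for n :: int
    proof (cases n)
      case (nonneg m)
      then show ?thesis using False n by (auto simp: int_pow_int)
    next
      case (neg m)
      then have "- fst (y [^]\<^bsub>doubled\<^esub> Suc m) \<in> S"
        using n yc by (simp only: int_pow_neg_int fst_inv nat_pow_closed)
      then show ?thesis using False S_minus by force
    qed
    then have "y [^]\<^bsub>doubled\<^esub> n \<in> C" if "fst (y [^]\<^bsub>doubled\<^esub> n) \<in> fst ` C" for n :: int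
      using that subgroup.one_closed[OF C] by (metis S_def int_pow_0)
    then show ?thesis using y by (intro that[of y]) simp_all
  next
    case True
    define N :: nat where "N = (LEAST n. n > 0 \<and> fst (y [^]\<^bsub>doubled\<^esub> n) \<in> S)"
    have N: "N > 0" "fst (y [^]\<^bsub>doubled\<^esub> N) \<in> S"
      using LeastI_ex[OF True] by (simp_all add: N_def)
    have N_least: "n = 0" if "fst (y [^]\<^bsub>doubled\<^esub> n) \<in> S" "n < N" for n :: nat
      using not_less_Least[of n "\<lambda>n. n > 0 \<and> fst (y [^]\<^bsub>doubled\<^esub> n) \<in> S"] that by (auto simp: N_def)
    obtain s where s: "s \<in> C" "fst s = fst (y [^]\<^bsub>doubled\<^esub> N)" using N(2) unfolding S_def by (metis imageE)
    have sc: "s \<in> carrier doubled" using s Cc by auto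
    define Z where "Z = centralizer (C \<union> {y})"
    have Z: "subgroup Z doubled" unfolding Z_def by (rule subgroup_centralizer)
    have yZ: "y \<in> Z" using y com_self[OF yc] by (auto simp: Z_def centralizer_def)
    have sZ: "s \<in> Z" using s(1) comC y sc by (auto simp: Z_def centralizer_def intro: com_sym)
    \<comment> \<open>The defect of the N-th power of \<open>y\<close> from lying in
      \<open>C\<close>. It lies over 0 and commutes with \<open>C\<close> and with \<open>y\<close>,
      since \<open>y\<close> and \<open>s\<close> do.\<close>
    define c where "c = y [^]\<^bsub>doubled\<^esub> N \<otimes>\<^bsub>doubled\<^esub> inv\<^bsub>doubled\<^esub> s"
    have yN: "y [^]\<^bsub>doubled\<^esub> N \<in> Z"
      using subgroup_int_pow_closed[OF Z yZ, of "int N"] by (simp add: int_pow_int)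
    have cZ: "c \<in> Z" unfolding c_def using Z yN sZ by (simp add: subgroup.m_closed subgroup.m_inv_closed)
    then have cc: "c \<in> carrier doubled" by (simp add: Z_def centralizer_def)
    have "fst c = 0" using s(2) sc by (simp add: c_def fst_mult fst_inv)
    then obtain h where h: "c = (0, h)" by (cases c) simp
    have h1: "h 0 = 1" "\<And>k. h k \<noteq> 0" using cc by (simp_all add: h in_carrier)
    obtain \<rho> where \<rho>: "\<rho> 1 = 1" "\<And>z::complex. \<rho> z ^ N = 1 / z"
      using complex_root_choice[OF N(1)] by metis
    \<comment> \<open>Multiplying \<open>y\<close> by \<open>(0, d)\<close> multiplies its N-th
      power by the inverse of \<open>c\<close>, because the two factors commute.\<close>
    define d where "d = (\<lambda>k. \<rho> (h k))"
    have dN: "d k ^ N = 1 / h k" for k by (simp add: d_def \<rho>)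
    have d_nz: "d k \<noteq> 0" for k using dN[of k] h1(2)[of k] N(1) by (auto simp: power_0_left)
    have ec: "(0, d) \<in> carrier doubled" using d_nz h1 \<rho>(1) by (simp add: in_carrier doubles_0 d_def)
    have "com (0, d) r" if r: "r \<in> C \<union> {y}" for r
    proof -
      obtain j g where [simp]: "r = (j, g)" by (cases r)
      have g: "g k \<noteq> 0" for k using r Cc yc by (auto simp: in_carrier)
      have "com c r" using cZ r unfolding Z_def centralizer_def by blast
      then have "h (j + k) = h k" for k using g by (simp add: h)
      then show ?thesis by (simp add: d_def)
    qed
    then have eZ: "(0, d) \<in> Z" using ec by (simp add: Z_def centralizer_def)
    define y' where "y' = y \<otimes>\<^bsub>doubled\<^esub> (0, d)"
    have y'Z: "y' \<in> Z" unfolding y'_def using Z yZ eZ by (simp add: subgroup.m_closed)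
    then have y'C: "y' \<in> centralizer C" and y'c: "y' \<in> carrier doubled" by (simp_all add: Z_def centralizer_def)
    have fst_y': "fst y' = fst y" by (simp add: y'_def fst_mult)
    have e_pow: "(0, d) [^]\<^bsub>doubled\<^esub> N = inv\<^bsub>doubled\<^esub> c"
    proof (rule inv_equality[symmetric])
      show "(0, d) [^]\<^bsub>doubled\<^esub> N \<otimes>\<^bsub>doubled\<^esub> c = \<one>\<^bsub>doubled\<^esub>"
        using h1 ec by (simp add: pow_0 in_carrier h mult_eq one_eq dN nrm_def)
    qed (use cc ec in simp_all)
    have "com y (0, d)" using eZ com_sym by (auto simp: Z_def centralizer_def)
    then have "y' [^]\<^bsub>doubled\<^esub> N = y [^]\<^bsub>doubled\<^esub> N \<otimes>\<^bsub>doubled\<^esub> inv\<^bsub>doubled\<^esub> c"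
      unfolding y'_def e_pow[symmetric] by (intro pow_mult_distrib com_imp_commute yc ec)
    also have "y [^]\<^bsub>doubled\<^esub> N = c \<otimes>\<^bsub>doubled\<^esub> s" using yc sc by (simp add: c_def m_assoc)
    also have "c \<otimes>\<^bsub>doubled\<^esub> s = s \<otimes>\<^bsub>doubled\<^esub> c"
      using cZ s(1) by (intro com_imp_commute cc sc) (simp add: Z_def centralizer_def)
    finally have y'N: "y' [^]\<^bsub>doubled\<^esub> N = s" using sc cc by (simp add: m_assoc)
    \<comment> \<open>Division of \<open>n\<close> by \<open>N\<close> with remainder; minimality of
      \<open>N\<close> rules out a nonzero remainder.\<close>
    have "y' [^]\<^bsub>doubled\<^esub> n \<in> C" if n: "fst (y' [^]\<^bsub>doubled\<^esub> n) \<in> fst ` C" for n :: int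
    proof -
      define q m where "q = n div int N" and "m = nat (n mod int N)"
      have m: "n = int N * q + int m" "m < N" using N(1) by (simp_all add: q_def m_def nat_less_iff)
      have "y' [^]\<^bsub>doubled\<^esub> n = y' [^]\<^bsub>doubled\<^esub> (int N * q) \<otimes>\<^bsub>doubled\<^esub> y' [^]\<^bsub>doubled\<^esub> int m"
        unfolding m(1) by (rule int_pow_mult[OF y'c, symmetric, THEN sym])
      also have "y' [^]\<^bsub>doubled\<^esub> (int N * q) = s [^]\<^bsub>doubled\<^esub> q"
        using int_pow_pow[OF y'c, of "int N" q] by (simp add: int_pow_int y'N)
      finally have y'n: "y' [^]\<^bsub>doubled\<^esub> n = s [^]\<^bsub>doubled\<^esub> q \<otimes>\<^bsub>doubled\<^esub> y' [^]\<^bsub>doubled\<^esub> m"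
        by (simp add: int_pow_int)
      have sq: "s [^]\<^bsub>doubled\<^esub> q \<in> C" by (rule subgroup_int_pow_closed[OF C s(1)])
      obtain p where p: "p \<in> C" "fst p = fst (y' [^]\<^bsub>doubled\<^esub> n)" using n by (metis imageE)
      have "fst (y' [^]\<^bsub>doubled\<^esub> m) = fst (inv\<^bsub>doubled\<^esub> (s [^]\<^bsub>doubled\<^esub> q) \<otimes>\<^bsub>doubled\<^esub> p)"
        using sc by (simp add: p fst_mult fst_inv y'n)
      moreover have "inv\<^bsub>doubled\<^esub> (s [^]\<^bsub>doubled\<^esub> q) \<otimes>\<^bsub>doubled\<^esub> p \<in> C"
        using sq p C by (simp add: subgroup.m_closed subgroup.m_inv_closed)
      ultimately have "fst (y' [^]\<^bsub>doubled\<^esub> m) \<in> S" unfolding S_def by (metis imageI)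
      then have "fst (y [^]\<^bsub>doubled\<^esub> m) \<in> S"
        using fst_pow_cong[OF y'c yc fst_y', of "int m"] by (simp add: int_pow_int)
      then have "m = 0" using m(2) N_least by blast
      then show ?thesis using sq sc by (simp add: y'n)
    qed
    then show ?thesis using y'C fst_y' by (intro that[of y']) auto
  qed
qed

section \<open>Maximal commuting subgroups that are graphs\<close>

definition admissible :: "('i \<times> ('i \<Rightarrow> complex)) set \<Rightarrow> bool"
  where "admissible C \<longleftrightarrow> subgroup C doubled \<and> (\<forall>p\<in>C. \<forall>q\<in>C. com p q) \<and>
    (\<forall>p\<in>C. fst p = 0 \<longrightarrow> p = \<one>\<^bsub>doubled\<^esub>)"

lemma admissible_extend:
  assumes adm: "admissible C" and x: "x \<in> doubles"
  obtains C' where "admissible C'" "C \<subseteq> C'" "x \<in> fst ` C'"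
proof -
  interpret group doubled by (rule group_doubled)
  have C: "subgroup C doubled" and comC: "\<forall>p\<in>C. \<forall>q\<in>C. com p q"
    and triv: "\<forall>p\<in>C. fst p = 0 \<longrightarrow> p = \<one>\<^bsub>doubled\<^esub>"
    using adm by (simp_all add: admissible_def)
  have Cc: "C \<subseteq> carrier doubled" using C by (rule subgroup.subset)
  obtain f where "(x, f) \<in> centralizer C" by (rule commuting_section[OF C comC triv x])
  from root_correction[OF C comC this] obtain y where y: "y \<in> centralizer C" "fst y = x"
    "\<And>n::int. fst (y [^]\<^bsub>doubled\<^esub> n) \<in> fst ` C \<Longrightarrow> y [^]\<^bsub>doubled\<^esub> n \<in> C"
    by (metis fst_conv)
  have yc: "y \<in> carrier doubled" using y(1) by (simp add: centralizer_def)
  define C' where "C' = {p \<otimes>\<^bsub>doubled\<^esub> y [^]\<^bsub>doubled\<^esub> n | p n. p \<in> C \<and> n \<in> (UNIV :: int set)}"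
  have C'I: "p \<otimes>\<^bsub>doubled\<^esub> y [^]\<^bsub>doubled\<^esub> n \<in> C'" if "p \<in> C" for p and n :: int
    using that unfolding C'_def by blast
  have C'E: "\<exists>p\<in>C. \<exists>n::int. q = p \<otimes>\<^bsub>doubled\<^esub> y [^]\<^bsub>doubled\<^esub> n" if "q \<in> C'" for q
    using that unfolding C'_def by blast
  have pow_com: "y [^]\<^bsub>doubled\<^esub> n \<in> centralizer C" for n :: int
    by (rule subgroup_int_pow_closed[OF subgroup_centralizer y(1)])
  have comm: "y [^]\<^bsub>doubled\<^esub> n \<otimes>\<^bsub>doubled\<^esub> p = p \<otimes>\<^bsub>doubled\<^esub> y [^]\<^bsub>doubled\<^esub> n" if "p \<in> C" for p and n :: int
    using pow_com[of n] that Cc by (intro com_imp_commute) (auto simp: centralizer_def)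
  have Z1: "C' \<subseteq> centralizer (C \<union> {y})"
  proof
    fix q assume "q \<in> C'"
    then obtain p n where q: "p \<in> C" "q = p \<otimes>\<^bsub>doubled\<^esub> y [^]\<^bsub>doubled\<^esub> (n::int)" using C'E by blast
    have "p \<in> centralizer (C \<union> {y})" using q(1) comC y(1) Cc by (auto simp: centralizer_def intro: com_sym)
    moreover have "y \<in> centralizer (C \<union> {y})" using y(1) com_self[OF yc] by (auto simp: centralizer_def)
    ultimately show "q \<in> centralizer (C \<union> {y})"
      unfolding q(2) by (intro subgroup.m_closed[OF subgroup_centralizer] subgroup_int_pow_closed[OF subgroup_centralizer])
  qed
  have com': "com q r" if q: "q \<in> C'" and r: "r \<in> C'" for q r
  proof -
    obtain p n where r': "p \<in> C" "r = p \<otimes>\<^bsub>doubled\<^esub> y [^]\<^bsub>doubled\<^esub> (n::int)" using C'E[OF r] by blast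
    have "com p q" "com y q" using Z1 q r'(1) by (auto simp: centralizer_def intro: com_sym)
    then have "p \<in> centralizer {q}" "y \<in> centralizer {q}" using r'(1) Cc yc by (auto simp: centralizer_def)
    then have "r \<in> centralizer {q}"
      unfolding r'(2) by (intro subgroup.m_closed[OF subgroup_centralizer] subgroup_int_pow_closed[OF subgroup_centralizer])
    then show ?thesis by (auto simp: centralizer_def intro: com_sym)
  qed
  have sub: "subgroup C' doubled"
  proof (rule subgroupI)
    show "C' \<subseteq> carrier doubled" using Z1 by (auto simp: centralizer_def)
    show "C' \<noteq> {}" using C'I[OF subgroup.one_closed[OF C]] by blast
    fix q assume "q \<in> C'"
    then obtain p n where q: "p \<in> C" "q = p \<otimes>\<^bsub>doubled\<^esub> y [^]\<^bsub>doubled\<^esub> (n::int)" using C'E by blast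
    have pc: "p \<in> carrier doubled" using q Cc by auto
    have ip: "inv\<^bsub>doubled\<^esub> p \<in> C" using q C by (simp add: subgroup.m_inv_closed)
    have "inv\<^bsub>doubled\<^esub> q = inv\<^bsub>doubled\<^esub> p \<otimes>\<^bsub>doubled\<^esub> y [^]\<^bsub>doubled\<^esub> (- n)"
      unfolding q(2) using pc yc comm[OF ip, of "- n"] by (simp add: inv_mult_group int_pow_neg)
    then show "inv\<^bsub>doubled\<^esub> q \<in> C'" using C'I[OF ip] by simp
    fix r assume "r \<in> C'"
    then obtain p' n' where r: "p' \<in> C" "r = p' \<otimes>\<^bsub>doubled\<^esub> y [^]\<^bsub>doubled\<^esub> (n'::int)" using C'E by blast
    have p'c: "p' \<in> carrier doubled" using r Cc by auto
    have "q \<otimes>\<^bsub>doubled\<^esub> r = p \<otimes>\<^bsub>doubled\<^esub> (y [^]\<^bsub>doubled\<^esub> n \<otimes>\<^bsub>doubled\<^esub> p') \<otimes>\<^bsub>doubled\<^esub> y [^]\<^bsub>doubled\<^esub> n'"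
      unfolding q(2) r(2) using pc p'c yc by (simp add: m_assoc)
    also have "\<dots> = (p \<otimes>\<^bsub>doubled\<^esub> p') \<otimes>\<^bsub>doubled\<^esub> y [^]\<^bsub>doubled\<^esub> (n + n')"
      unfolding comm[OF r(1)] using pc p'c yc by (simp add: m_assoc int_pow_mult)
    finally show "q \<otimes>\<^bsub>doubled\<^esub> r \<in> C'" using C'I[OF subgroup.m_closed[OF C q(1) r(1)]] by simp
  qed
  have "q = \<one>\<^bsub>doubled\<^esub>" if q: "q \<in> C'" "fst q = 0" for q
  proof -
    obtain p n where q': "p \<in> C" "q = p \<otimes>\<^bsub>doubled\<^esub> y [^]\<^bsub>doubled\<^esub> (n::int)" using C'E[OF q(1)] by blast
    have pc: "p \<in> carrier doubled" using q' Cc by auto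
    have ip: "inv\<^bsub>doubled\<^esub> p \<in> C" using q' C by (simp add: subgroup.m_inv_closed)
    have "fst (y [^]\<^bsub>doubled\<^esub> n) = fst (inv\<^bsub>doubled\<^esub> p)"
      using q(2) pc by (simp add: q'(2) fst_mult fst_inv eq_neg_iff_add_eq_0 add.commute)
    then have "y [^]\<^bsub>doubled\<^esub> n \<in> C" using y(3) ip by (metis imageI)
    then have "q \<in> C" unfolding q'(2) by (rule subgroup.m_closed[OF C q'(1)])
    then show ?thesis using triv q(2) by blast
  qed
  then have "admissible C'" using sub com' by (auto simp: admissible_def)
  moreover have "C \<subseteq> C'"
  proof
    fix p assume "p \<in> C"
    then show "p \<in> C'" using C'I[of p 0] Cc by (auto simp: int_pow_0)
  qed
  moreover have "x \<in> fst ` C'"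
  proof -
    have "fst (\<one>\<^bsub>doubled\<^esub> \<otimes>\<^bsub>doubled\<^esub> y [^]\<^bsub>doubled\<^esub> (1::int)) = x" using y(2) yc by (simp add: int_pow_1)
    then show ?thesis using C'I[OF subgroup.one_closed[OF C], of 1] by (metis imageI)
  qed
  ultimately show ?thesis by (rule that)
qed

lemma admissible_Union:
  assumes "\<C> \<noteq> {}" "subset.chain {C. admissible C} \<C>"
  shows "admissible (\<Union>\<C>)"
proof -
  interpret group doubled by (rule group_doubled)
  have adm: "admissible C" if "C \<in> \<C>" for C using assms(2) that by (auto simp: subset_chain_def)
  have common: "\<exists>C\<in>\<C>. p \<in> C \<and> q \<in> C" if "p \<in> \<Union>\<C>" "q \<in> \<Union>\<C>" for p q
    using that assms(2) unfolding subset_chain_def by blast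
  have "subgroup (\<Union>\<C>) doubled"
  proof (rule subgroupI)
    show "\<Union>\<C> \<subseteq> carrier doubled"
      using adm by (intro Union_least) (simp add: admissible_def subgroup.subset)
    obtain C0 where "C0 \<in> \<C>" using assms(1) by blast
    then show "\<Union>\<C> \<noteq> {}" using adm[of C0] by (auto simp: admissible_def dest: subgroup.one_closed)
    fix p assume "p \<in> \<Union>\<C>"
    then show "inv\<^bsub>doubled\<^esub> p \<in> \<Union>\<C>" using adm unfolding admissible_def by (meson UnionE UnionI subgroup.m_inv_closed)
    fix q assume "q \<in> \<Union>\<C>"
    with \<open>p \<in> \<Union>\<C>\<close> common obtain C where "C \<in> \<C>" "p \<in> C" "q \<in> C" by meson
    then show "p \<otimes>\<^bsub>doubled\<^esub> q \<in> \<Union>\<C>" using adm[of C] by (auto simp: admissible_def dest: subgroup.m_closed)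
  qed
  then show ?thesis using adm common unfolding admissible_def by (meson UnionE)
qed

lemma admissible_one: "admissible {\<one>\<^bsub>doubled\<^esub>}"
  using group.triv_subgroup[OF group_doubled] com_one by (simp add: admissible_def)

text \<open>\<open>\<mu> i k\<close> will rescale the structure map of type \<open>(i, k)\<close>.
  Normalization at 0 and triviality for degree 0 keep the actions and their skews unchanged, as the
  vacuum axioms demand.\<close>

lemma trivialization:
  obtains \<mu> :: "'i \<Rightarrow> 'i \<Rightarrow> complex" where
    "\<And>i k. i \<in> doubles \<Longrightarrow> \<mu> i k \<noteq> 0" "\<And>i. i \<in> doubles \<Longrightarrow> \<mu> i 0 = 1" "\<And>k. \<mu> 0 k = 1"
    "\<And>i j k. i \<in> doubles \<Longrightarrow> j \<in> doubles \<Longrightarrow> \<mu> i (j + k) * \<mu> j k * B i j k = \<mu> j (i + k) * \<mu> i k"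
proof -
  obtain C where adm: "admissible C" and max: "\<And>C'. admissible C' \<Longrightarrow> C \<subseteq> C' \<Longrightarrow> C' = C"
    using subset_Zorn_nonempty[of "{C. admissible C}"] admissible_Union admissible_one by blast
  have "\<exists>f. (i, f) \<in> C" if i: "i \<in> doubles" for i
  proof -
    obtain C' where "admissible C'" "C \<subseteq> C'" "i \<in> fst ` C'" by (rule admissible_extend[OF adm i])
    then show ?thesis using max by force
  qed
  then obtain \<mu> where \<mu>: "\<And>i. i \<in> doubles \<Longrightarrow> (i, \<mu> i) \<in> C" by metis
  have c: "C \<subseteq> carrier doubled" using adm by (auto simp: admissible_def dest: subgroup.subset)
  have "(0, \<mu> 0) = \<one>\<^bsub>doubled\<^esub>" using adm \<mu>[OF doubles_0] by (auto simp: admissible_def)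
  moreover have "com (i, \<mu> i) (j, \<mu> j)" if "i \<in> doubles" "j \<in> doubles" for i j
    using adm \<mu>[OF that(1)] \<mu>[OF that(2)] unfolding admissible_def by blast
  moreover have "(i, \<mu> i) \<in> carrier doubled" if "i \<in> doubles" for i using c \<mu>[OF that] by blast
  ultimately show ?thesis by (intro that[of \<mu>]) (auto simp: in_carrier one_eq)
qed

end

section \<open>Commutation factors of intertwining operators\<close>

lemma fls_scaleC_nth [simp]: "(c *\<^sub>C F) $$ n = c *\<^sub>C (F $$ n)"
  by (simp add: scaleC_fls_def fls_map_nth)

text \<open>
  \<open>P\<close> and \<open>Q\<close> are the expansions of \<open>c Z / (z-w)^N\<close> in \<open>M((z))((w))\<close> and of \<open>Z / (z-w)^N\<close> in \<open>M((w))((z-w))\<close>;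
  in \<open>Q p n\<close> the exponent of \<open>z-w\<close> comes first.
\<close>

definition expands :: "(int \<Rightarrow> int \<Rightarrow> 'v::complex_vector) \<Rightarrow> complex \<Rightarrow> (int \<Rightarrow> int \<Rightarrow> 'v) \<Rightarrow> nat \<Rightarrow> (int \<Rightarrow> int \<Rightarrow> 'v) \<Rightarrow> bool"
  where "expands P c Q N Z \<longleftrightarrow> bounded_below Z \<and> (delta ^^ N) P = c *\<^sub>C Z \<and>
    (\<forall>p n. Q p n = (if p + int N < 0 then 0 else diag (nat (p + int N)) Z (n + p + int N)))"

lemma expands_Suc:
  assumes "expands P c Q N Z"
  shows "expands P c Q (Suc N) (delta Z)"
proof -
  have b: "bounded_below Z" and d: "(delta ^^ N) P = c *\<^sub>C Z"
    and q: "\<And>p n. Q p n = (if p + int N < 0 then 0 else diag (nat (p + int N)) Z (n + p + int N))"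
    using assms by (auto simp: expands_def)
  have "(delta ^^ Suc N) P = c *\<^sub>C delta Z"
    using delta_pow_scale[of 1 c Z] by (simp add: d)
  moreover have "Q p n = (if p + int (Suc N) < 0 then 0 else diag (nat (p + int (Suc N))) (delta Z) (n + p + int (Suc N)))" for p n
  proof (cases "p + int N < 0")
    case True then show ?thesis by (simp add: q diag_delta[OF b])
  next
    case False
    then have "nat (p + int (Suc N)) = Suc (nat (p + int N))" by simp
    then show ?thesis using False by (simp add: q diag_delta[OF b] algebra_simps)
  qed
  ultimately show ?thesis using bounded_below_delta[OF b] by (simp add: expands_def)
qed

text \<open>If the term of highest pole order in z - w is missing from \<open>Q\<close>, the
  numerator vanishes on the diagonal and a factor z - w cancels. On the side of \<open>P\<close> the
  cancellation is legitimate because multiplication by z - w is injective there.\<close>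

lemma expands_pred:
  assumes P: "\<forall>m n. n < K \<longrightarrow> P m n = 0" and ex: "expands P c Q (Suc N) Z" and Q: "\<forall>p n. p < - int N \<longrightarrow> Q p n = 0"
  obtains Z' where "expands P c Q N Z'"
proof -
  have b: "bounded_below Z" and d: "(delta ^^ Suc N) P = c *\<^sub>C Z"
    and q: "\<And>p n. Q p n = (if p + int (Suc N) < 0 then 0 else diag (nat (p + int (Suc N))) Z (n + p + int (Suc N)))"
    using ex by (auto simp: expands_def)
  have "diag 0 Z n = 0" for n
    using q[of "- int (Suc N)" n] Q by simp
  then obtain Z' where Z': "bounded_below Z'" "delta Z' = Z" by (rule diag_0_divide[OF b])
  obtain K' where K': "\<forall>m n. m < K' \<or> n < K' \<longrightarrow> Z' m n = 0" using Z'(1) unfolding bounded_below_def by blast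
  have "(delta ^^ N) P - c *\<^sub>C Z' = 0"
  proof (rule delta_inj[where K = "min K K'"])
    fix m n :: int assume "n < min K K'"
    then show "((delta ^^ N) P - c *\<^sub>C Z') m n = 0"
      using K' delta_pow_bdd2[of K P n N m] P by (simp add: scaleC_fun_def)
  next
    show "delta ((delta ^^ N) P - c *\<^sub>C Z') = 0"
      using delta_pow_diff[of 1 "(delta ^^ N) P" "c *\<^sub>C Z'"] delta_pow_scale[of 1 c Z'] d by (simp add: Z'(2))
  qed
  then have "(delta ^^ N) P = c *\<^sub>C Z'" by simp
  moreover have "Q p n = (if p + int N < 0 then 0 else diag (nat (p + int N)) Z' (n + p + int N))" for p n
  proof (cases "p + int N < 0")
    case True then show ?thesis using Q by simp
  next
    case False
    then have "nat (p + int (Suc N)) = Suc (nat (p + int N))" by simp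
    then show ?thesis using False by (simp add: q flip: Z'(2)) (simp add: diag_delta[OF Z'(1)] algebra_simps)
  qed
  ultimately show ?thesis using Z'(1) by (intro that[of Z']) (simp add: expands_def)
qed

text \<open>The numerator is multiplied by z - w to raise the pole order and divided by it to lower
  the order, so that \<open>Q\<close> alone decides which orders are possible.\<close>

lemma expands_adjust:
  assumes P: "\<forall>m n. n < K \<longrightarrow> P m n = 0" and ex: "expands P c Q N Z" and Q: "\<forall>p n. p < - int M \<longrightarrow> Q p n = 0"
  obtains Z' where "expands P c Q M Z'"
proof -
  have up: "\<exists>Z'. expands P c Q (N + r) Z'" for r
    by (induction r) (use ex expands_Suc in force)+
  have down: "\<exists>Z'. expands P c Q M Z'" if "expands P c Q (M + r) Z''" for r Z''
    using that
  proof (induction r arbitrary: Z'')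
    case (Suc r)
    have "\<forall>p n. p < - int (M + r) \<longrightarrow> Q p n = 0" using Q by simp
    then obtain Z1 where "expands P c Q (M + r) Z1"
      using expands_pred[OF P, of c Q "M + r" Z''] Suc.prems by (metis add_Suc_right)
    then show ?case by (rule Suc.IH)
  qed auto
  show ?thesis
  proof (cases "N \<le> M")
    case True
    then show ?thesis using up[of "M - N"] that by auto
  next
    case False
    then show ?thesis using down[of "N - M" Z] ex that by auto
  qed
qed

section \<open>Series in three variables z, w, t, multiplied by z - w, z - t and w - t\<close>

definition D12 :: "(int \<Rightarrow> int \<Rightarrow> int \<Rightarrow> 'v::complex_vector) \<Rightarrow> int \<Rightarrow> int \<Rightarrow> int \<Rightarrow> 'v"
  where "D12 G = (\<lambda>m n s. G (m - 1) n s - G m (n - 1) s)"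

definition D13 :: "(int \<Rightarrow> int \<Rightarrow> int \<Rightarrow> 'v::complex_vector) \<Rightarrow> int \<Rightarrow> int \<Rightarrow> int \<Rightarrow> 'v"
  where "D13 G = (\<lambda>m n s. G (m - 1) n s - G m n (s - 1))"

definition D23 :: "(int \<Rightarrow> int \<Rightarrow> int \<Rightarrow> 'v::complex_vector) \<Rightarrow> int \<Rightarrow> int \<Rightarrow> int \<Rightarrow> 'v"
  where "D23 G = (\<lambda>m n s. G m (n - 1) s - G m n (s - 1))"

lemma D12_pow: "(D12 ^^ N) G = (\<lambda>m n s. (delta ^^ N) (\<lambda>m n. G m n s) m n)"
  by (induction N) (simp_all add: D12_def delta_def)

lemma D13_pow: "(D13 ^^ N) G = (\<lambda>m n s. (delta ^^ N) (\<lambda>m s. G m n s) m s)"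
  by (induction N) (simp_all add: D13_def delta_def)

lemma D23_pow: "(D23 ^^ N) G = (\<lambda>m n s. (delta ^^ N) (\<lambda>n s. G m n s) n s)"
  by (induction N) (simp_all add: D23_def delta_def)

lemma pow_commute:
  assumes "\<And>x. f (g x) = g (f x)" shows "(f ^^ a) ((g ^^ b) x) = (g ^^ b) ((f ^^ a) x)"
proof -
  have 1: "f ((g ^^ b) x) = (g ^^ b) (f x)" for x by (induction b) (simp_all add: assms)
  show ?thesis by (induction a) (simp_all add: 1)
qed

lemma D12_D13: "(D12 ^^ a) ((D13 ^^ b) G) = (D13 ^^ b) ((D12 ^^ a) G)"
  by (rule pow_commute) (simp add: D12_def D13_def fun_eq_iff)

lemma D12_D23: "(D12 ^^ a) ((D23 ^^ b) G) = (D23 ^^ b) ((D12 ^^ a) G)"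
  by (rule pow_commute) (simp add: D12_def D23_def fun_eq_iff)

lemma D13_D23: "(D13 ^^ a) ((D23 ^^ b) G) = (D23 ^^ b) ((D13 ^^ a) G)"
  by (rule pow_commute) (simp add: D13_def D23_def fun_eq_iff)

lemma D13_scale: "(D13 ^^ N) (c *\<^sub>C G) = c *\<^sub>C (D13 ^^ N) G"
  by (induction N) (simp_all add: D13_def fun_eq_iff scaleC_fun_def cvec.scale_right_diff_distrib)

lemma D23_scale: "(D23 ^^ N) (c *\<^sub>C G) = c *\<^sub>C (D23 ^^ N) G"
  by (induction N) (simp_all add: D23_def fun_eq_iff scaleC_fun_def cvec.scale_right_diff_distrib)

lemma D12_scale: "(D12 ^^ N) (c *\<^sub>C G) = c *\<^sub>C (D12 ^^ N) G"
  by (induction N) (simp_all add: D12_def fun_eq_iff scaleC_fun_def cvec.scale_right_diff_distrib)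

lemma D13_diff: "(D13 ^^ N) (F - G) = (D13 ^^ N) F - (D13 ^^ N) G"
  by (induction N) (simp_all add: D13_def fun_eq_iff)

lemma D23_diff: "(D23 ^^ N) (F - G) = (D23 ^^ N) F - (D23 ^^ N) G"
  by (induction N) (simp_all add: D23_def fun_eq_iff)

text \<open>The bound may vary with \<open>s\<close>: numerators are obtained separately for each
  power of t, and restriction to z = w needs no more.\<close>

definition slice_bounded :: "(int \<Rightarrow> int \<Rightarrow> int \<Rightarrow> 'v::zero) \<Rightarrow> bool"
  where "slice_bounded G \<longleftrightarrow> (\<forall>s. bounded_below (\<lambda>m n. G m n s))"

definition diag12 :: "nat \<Rightarrow> (int \<Rightarrow> int \<Rightarrow> int \<Rightarrow> 'v::complex_vector) \<Rightarrow> int \<Rightarrow> int \<Rightarrow> 'v"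
  where "diag12 q G = (\<lambda>d s. diag q (\<lambda>m n. G m n s) d)"

lemma diag12_D23:
  assumes "slice_bounded G"
  shows "diag12 q (D23 G) = delta (diag12 q G)"
proof (intro ext)
  fix d s
  have b: "bounded_below (\<lambda>m n. G m n s)" for s using assms by (simp add: slice_bounded_def)
  have "(\<lambda>m n. D23 G m n s) = (\<lambda>m n. G m (n - 1) s) - (\<lambda>m n. G m n (s - 1))" by (simp add: D23_def fun_eq_iff)
  then show "diag12 q (D23 G) d s = delta (diag12 q G) d s"
    using diag_diff[OF bounded_below_shift2[OF b] b] diag_shift2 by (simp add: diag12_def delta_def)
qed

lemma slice_bounded_D23: "slice_bounded G \<Longrightarrow> slice_bounded (D23 G)"
  unfolding slice_bounded_def
proof
  fix s assume b: "\<forall>s. bounded_below (\<lambda>m n. G m n s)"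
  have "(\<lambda>m n. D23 G m n s) = (\<lambda>m n. G m (n - 1) s) - (\<lambda>m n. G m n (s - 1))" by (simp add: D23_def fun_eq_iff)
  then show "bounded_below (\<lambda>m n. D23 G m n s)"
    using bounded_below_diff[OF bounded_below_shift2[OF b[rule_format, of s]] b[rule_format, of "s - 1"]] by simp
qed

lemma slice_bounded_D13: "slice_bounded G \<Longrightarrow> slice_bounded (D13 G)"
  unfolding slice_bounded_def
proof
  fix s assume b: "\<forall>s. bounded_below (\<lambda>m n. G m n s)"
  have "(\<lambda>m n. D13 G m n s) = (\<lambda>m n. G (m - 1) n s) - (\<lambda>m n. G m n (s - 1))" by (simp add: D13_def fun_eq_iff)
  then show "bounded_below (\<lambda>m n. D13 G m n s)"
    using bounded_below_diff[OF bounded_below_shift1[OF b[rule_format, of s]] b[rule_format, of "s - 1"]] by simp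
qed

text \<open>Near z = w one has z - t = (w-t) + (z-w); the second summand lowers the index of the
  diagonal coefficient.\<close>

lemma diag12_D13:
  assumes "slice_bounded G"
  shows "diag12 q (D13 G) = delta (diag12 q G) + (if q = 0 then 0 else (\<lambda>d s. diag12 (q - 1) G (d - 1) s))"
proof (intro ext)
  fix d s
  have b: "bounded_below (\<lambda>m n. G m n s)" for s using assms by (simp add: slice_bounded_def)
  have "(\<lambda>m n. D13 G m n s) = (\<lambda>m n. G (m - 1) n s) - (\<lambda>m n. G m n (s - 1))" by (simp add: D13_def fun_eq_iff)
  then show "diag12 q (D13 G) d s = (delta (diag12 q G) + (if q = 0 then 0 else (\<lambda>d s. diag12 (q - 1) G (d - 1) s))) d s"
    using diag_diff[OF bounded_below_shift1[OF b] b] diag_shift1[OF b] by (simp add: diag12_def delta_def)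
qed

lemma delta_pow_shift: "(delta ^^ N) (\<lambda>d s. X (d + c) s) = (\<lambda>d s. (delta ^^ N) X (d + c) s)"
  by (induction N) (simp_all add: delta_def fun_eq_iff algebra_simps)

text \<open>
  The argument of Dong's lemma: on the diagonal \<open>z = w\<close> a factor \<open>(z-t)^a\<close> becomes \<open>(w-t)^a\<close>, and the
  \<open>q\<close>-th derivative in \<open>z\<close> is annihilated by \<open>q\<close> additional factors.
\<close>

lemma diag12_D13_pow:
  assumes "slice_bounded G" "(D13 ^^ a) G = 0"
  shows "(delta ^^ (a + q)) (diag12 q G) = 0"
  using assms
proof (induction a arbitrary: q G)
  case 0
  then have "diag12 q G = 0" by (simp add: diag12_def diag_def fun_eq_iff)
  then show ?case by (simp only: delta_pow_0)
next
  case (Suc a)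
  note G = Suc.prems
  have 1: "(delta ^^ (a + q)) (diag12 q (D13 G)) = 0" for q
    by (rule Suc.IH[OF slice_bounded_D13[OF G(1)]]) (use G(2) in \<open>simp only: funpow_Suc_right comp_apply\<close>)
  show ?case
  proof (induction q)
    case 0
    then show ?case using 1[of 0] by (simp add: diag12_D13[OF G(1)] funpow_swap1)
  next
    case (Suc q)
    have "delta (diag12 (Suc q) G) = diag12 (Suc q) (D13 G) - (\<lambda>d s. diag12 q G (d + (- 1)) s)"
      by (simp add: diag12_D13[OF G(1)])
    then have "(delta ^^ (a + Suc q)) (delta (diag12 (Suc q) G)) = - (\<lambda>d s. (delta ^^ (a + Suc q)) (diag12 q G) (d + (- 1)) s)"
      by (simp only: delta_pow_diff 1 delta_pow_shift) simp
    also have "\<dots> = 0" using Suc.IH by (simp add: fun_eq_iff)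
    finally show ?case by (simp add: funpow_swap1)
  qed
qed

lemma diag12_D13_D23_pow:
  assumes G: "slice_bounded G" and z: "(D13 ^^ a) ((D23 ^^ b) G) = 0"
  shows "(delta ^^ (a + q + b)) (diag12 q G) = 0"
proof -
  have sb: "slice_bounded ((D23 ^^ b) G)" for b by (induction b) (simp_all add: G slice_bounded_D23)
  have "diag12 q ((D23 ^^ b) G) = (delta ^^ b) (diag12 q G)" for b
    by (induction b) (simp_all add: diag12_D23 sb)
  then show ?thesis using diag12_D13_pow[OF sb z, of q] by (simp add: funpow_add)
qed

text \<open>What remains of a commutativity datum for the comparison of scalars.
  \<open>skew_iterate\<close> is skew symmetry inserted into an iterate: the exponential of L(-1)
  produces the binomial coefficients, the change from z - w to w - z the signs.
  \<open>nonzero4\<close> is the nonvanishing of products of four elements, and the last two clauses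
  come from the intertwining condition relative to the action of the algebra.\<close>

locale fusion = braiding \<phi> \<omega>
  for \<phi> :: "'i::ab_group_add \<Rightarrow> 'i \<Rightarrow> 'i \<Rightarrow> complex" and \<omega> +
  fixes Y :: "'i \<Rightarrow> 'i \<Rightarrow> 'v::complex_vector \<Rightarrow> 'v \<Rightarrow> 'v fls"
  assumes Y_0_left: "Y i k 0 x = 0"
    and Y_add: "Y i k u (x + y) = Y i k u x + Y i k u y"
    and Y_scale: "Y i k u (c *\<^sub>C x) = c *\<^sub>C Y i k u x"
    and associative: "\<exists>N Z. expands (\<lambda>m n. Y i (j + k) u (Y j k v x $$ n) $$ m) (\<phi> i j k)
      (\<lambda>p n. Y (i + j) k (Y i j u v $$ p) x $$ n) N Z"
    and skew_iterate: "\<forall>p < - int N. Y i j u v $$ p = 0 \<Longrightarrow>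
      Y (i + j) k (Y j i v u $$ (int q - int N)) x $$ n = (\<omega> i j * (-1) ^ N) *\<^sub>C
        (\<Sum>r\<le>q. ((-1) ^ (q - r) * (of_int (n + int r) gchoose r)) *\<^sub>C
          (Y (i + j) k (Y i j u v $$ (int q - int r - int N)) x $$ (n + int r)))"
    and nonzero4: "\<exists>y u v x n m s. Y l (i + j + k) y (Y i (j + k) u (Y j k v x $$ n) $$ m) $$ s \<noteq> 0"
    and unit_expands: "\<exists>N Z. expands (\<lambda>m n. Y 0 (j + k) u (Y j k v x $$ n) $$ m) 1
      (\<lambda>p n. Y (0 + j) k (Y 0 j u v $$ p) x $$ n) N Z"
    and unit_local: "\<exists>N. (delta ^^ N) (\<lambda>m n. Y 0 (j + k) u (Y j k v x $$ n) $$ m)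
      = (delta ^^ N) (\<lambda>m n. Y j k v (Y 0 k u x $$ m) $$ n)"
begin

lemma Y_0_right: "Y i k u 0 = 0"
  using Y_scale[of i k u 0 0] by simp

lemma Y_diff: "Y i k u (x - y) = Y i k u x - Y i k u y"
  using Y_add[of i k u "x - y" y] by simp

lemma comp_bounded: "\<exists>K. \<forall>m n. n < K \<longrightarrow> Y i l u (Y j k v x $$ n) $$ m = 0"
  by (rule exI[of _ "fls_subdegree (Y j k v x)"]) (simp add: Y_0_right)

lemma comp_zero:
  assumes "(delta ^^ N) (\<lambda>m n. Y i l u (Y j k v x $$ n) $$ m) = 0"
  shows "Y i l u (Y j k v x $$ n) $$ m = 0"
proof -
  obtain K where "\<forall>m n. n < K \<longrightarrow> Y i l u (Y j k v x $$ n) $$ m = 0" using comp_bounded by blast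
  then have "(\<lambda>m n. Y i l u (Y j k v x $$ n) $$ m) = 0" 
    by (intro delta_pow_inj[where K = K, OF _ assms]) simp
  then show ?thesis by (simp add: fun_eq_iff)
qed

text \<open>The order of the pole at \<open>z = w\<close> can be read off from \<open>Y i j u v\<close>, hence does not depend on \<open>x\<close>.\<close>

lemma associative_uniform:
  assumes "\<forall>p < - int N. Y i j u v $$ p = 0"
  obtains Z where "expands (\<lambda>m n. Y i (j + k) u (Y j k v x $$ n) $$ m) (\<phi> i j k)
      (\<lambda>p n. Y (i + j) k (Y i j u v $$ p) x $$ n) N Z"
proof -
  obtain N' Z where Z: "expands (\<lambda>m n. Y i (j + k) u (Y j k v x $$ n) $$ m) (\<phi> i j k)
      (\<lambda>p n. Y (i + j) k (Y i j u v $$ p) x $$ n) N' Z" using associative by blast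
  obtain K where K: "\<forall>m n. n < K \<longrightarrow> Y i (j + k) u (Y j k v x $$ n) $$ m = 0" using comp_bounded by blast
  have 0: "\<forall>p n. p < - int N \<longrightarrow> Y (i + j) k (Y i j u v $$ p) x $$ n = 0" using assms by (simp add: Y_0_left)
  show ?thesis by (rule expands_adjust[OF K Z 0]) (rule that)
qed

lemma expands_nth:
  assumes "expands P c Q N Z" shows "Q (int q - int N) n = diag q Z (n + int q)"
  using assms by (simp add: expands_def)

text \<open>Skew symmetry says that the numerators for the two orders have proportional diagonal
  coefficients after exchanging z and w. Diagonal coefficients determine a numerator, so
  \<open>Z2\<close> is a multiple of the transpose of \<open>Z1\<close>, and the constants assemble
  to \<open>B i j k\<close>.\<close>

lemma locality:
  assumes 1: "\<forall>p < - int N. Y i j u v $$ p = 0" and 2: "\<forall>p < - int N. Y j i v u $$ p = 0"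
  shows "(delta ^^ N) (\<lambda>m n. Y i (j + k) u (Y j k v x $$ n) $$ m)
    = B i j k *\<^sub>C (delta ^^ N) (\<lambda>m n. Y j (i + k) v (Y i k u x $$ m) $$ n)"
proof -
  obtain Z1 where Z1: "expands (\<lambda>m n. Y i (j + k) u (Y j k v x $$ n) $$ m) (\<phi> i j k)
      (\<lambda>p n. Y (i + j) k (Y i j u v $$ p) x $$ n) N Z1" by (rule associative_uniform[OF 1])
  obtain Z2 where Z2: "expands (\<lambda>m n. Y j (i + k) v (Y i k u x $$ n) $$ m) (\<phi> j i k)
      (\<lambda>p n. Y (j + i) k (Y j i v u $$ p) x $$ n) N Z2" by (rule associative_uniform[OF 2])
  have b: "bounded_below Z1" "bounded_below Z2" using Z1 Z2 by (simp_all add: expands_def)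
  \<comment> \<open>The sign arises from (z-w)^N = (-1)^N (w-z)^N and cancels below against the one
    from transposing \<open>delta ^^ N\<close>.\<close>
  define c where "c = \<omega> i j * (-1) ^ N"
  have "diag q Z2 d = diag q (c *\<^sub>C (\<lambda>m n. Z1 n m)) d" for q d
  proof -
    define n where "n = d - int q"
    have d: "d = n + int q" by (simp add: n_def)
    have "diag q Z2 d = Y (i + j) k (Y j i v u $$ (int q - int N)) x $$ n"
      using expands_nth[OF Z2, of q n] by (simp add: d add.commute[of j i])
    also have "\<dots> = c *\<^sub>C (\<Sum>r\<le>q. ((-1) ^ (q - r) * (of_int (n + int r) gchoose r)) *\<^sub>C
          (Y (i + j) k (Y i j u v $$ (int q - int r - int N)) x $$ (n + int r)))"
      unfolding c_def by (rule skew_iterate[OF 1])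
    also have "\<dots> = c *\<^sub>C (\<Sum>r\<le>q. ((-1) ^ (q - r) * (of_int (n + int r) gchoose r)) *\<^sub>C diag (q - r) Z1 (n + int q))"
    proof (intro arg_cong[where f = "\<lambda>x. c *\<^sub>C x"] sum.cong refl)
      fix r assume "r \<in> {..q}"
      then show "((-1) ^ (q - r) * (of_int (n + int r) gchoose r)) *\<^sub>C
          (Y (i + j) k (Y i j u v $$ (int q - int r - int N)) x $$ (n + int r))
        = ((-1) ^ (q - r) * (of_int (n + int r) gchoose r)) *\<^sub>C diag (q - r) Z1 (n + int q)"
        using expands_nth[OF Z1, of "q - r" "n + int r"] by (simp add: of_nat_diff add.assoc)
    qed
    also have "\<dots> = diag q (c *\<^sub>C (\<lambda>m n. Z1 n m)) d"
      by (simp only: d diag_transpose[OF b(1)] diag_scale[OF bounded_below_transpose[OF b(1)]])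
    finally show ?thesis .
  qed
  then have "Z2 - c *\<^sub>C (\<lambda>m n. Z1 n m) = 0"
    by (intro diag_eq_0_imp_0) (simp_all add: b bounded_below_diff bounded_below_scale bounded_below_transpose diag_diff)
  then have Z2': "Z2 = c *\<^sub>C (\<lambda>m n. Z1 n m)" by simp
  have "(delta ^^ N) (\<lambda>m n. Y j (i + k) v (Y i k u x $$ m) $$ n)
      = (\<lambda>m n. ((-1) ^ N) *\<^sub>C (delta ^^ N) (\<lambda>m n. Y j (i + k) v (Y i k u x $$ n) $$ m) n m)"
    by (rule delta_pow_transpose)
  also have "(delta ^^ N) (\<lambda>m n. Y j (i + k) v (Y i k u x $$ n) $$ m) = \<phi> j i k *\<^sub>C Z2"
    using Z2 by (simp add: expands_def)
  also have "(\<lambda>m n. ((-1) ^ N) *\<^sub>C (\<phi> j i k *\<^sub>C Z2) n m) = (\<phi> j i k * \<omega> i j) *\<^sub>C Z1"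
  proof -
    have "(-1) ^ N * (-1) ^ N = (1::complex)" by (simp flip: power_add)
    then have "(-1) ^ N * (\<phi> j i k * c) = \<phi> j i k * \<omega> i j" unfolding c_def by (simp only: mult.left_commute) simp
    then show ?thesis unfolding Z2' scaleC_fun_def scaleC_scaleC by (simp only: mult_ac)
  qed
  finally have "(delta ^^ N) (\<lambda>m n. Y j (i + k) v (Y i k u x $$ m) $$ n) = (\<phi> j i k * \<omega> i j) *\<^sub>C Z1" .
  moreover have "(delta ^^ N) (\<lambda>m n. Y i (j + k) u (Y j k v x $$ n) $$ m) = \<phi> i j k *\<^sub>C Z1"
    using Z1 by (simp add: expands_def)
  ultimately show ?thesis by (simp add: B_def)
qed

lemma ex_pole_bound: "\<exists>N. \<forall>p < - int N. F $$ p = 0" for F :: "'v fls"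
  by (rule exI[of _ "nat (- fls_subdegree F)"]) auto

text \<open>The exponent precedes \<open>k\<close> and \<open>x\<close> in the quantifiers: it will
  be applied to all coefficients of a further series simultaneously.\<close>

lemma local_ex: "\<exists>N. \<forall>k x. (delta ^^ N) (\<lambda>m n. Y i (j + k) u (Y j k v x $$ n) $$ m)
    = B i j k *\<^sub>C (delta ^^ N) (\<lambda>m n. Y j (i + k) v (Y i k u x $$ m) $$ n)"
proof -
  obtain N1 N2 where "\<forall>p < - int N1. Y i j u v $$ p = 0" "\<forall>p < - int N2. Y j i v u $$ p = 0"
    using ex_pole_bound by metis
  then have "\<forall>p < - int (max N1 N2). Y i j u v $$ p = 0" "\<forall>p < - int (max N1 N2). Y j i v u $$ p = 0" by auto
  from locality[OF this] show ?thesis by blast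
qed

lemma comp_nonzero: "\<exists>u v x n m. Y i (j + k) u (Y j k v x $$ n) $$ m \<noteq> 0"
proof -
  obtain y u v x n m s where "Y 0 (i + j + k) y (Y i (j + k) u (Y j k v x $$ n) $$ m) $$ s \<noteq> 0"
    using nonzero4 by blast
  then have "Y i (j + k) u (Y j k v x $$ n) $$ m \<noteq> 0" by (auto simp: Y_0_right)
  then show ?thesis by blast
qed

text \<open>Exchanging twice leads back to the same product, and some such product is
  nonzero.\<close>

lemma B_antisym: "B i j k * B j i k = 1"
proof -
  obtain u v x n m where nz: "Y i (j + k) u (Y j k v x $$ n) $$ m \<noteq> 0" using comp_nonzero by blast
  let ?P = "\<lambda>m n. Y i (j + k) u (Y j k v x $$ n) $$ m" and ?R = "\<lambda>m n. Y j (i + k) v (Y i k u x $$ m) $$ n"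
  obtain N1 N2 where N1: "(delta ^^ N1) ?P = B i j k *\<^sub>C (delta ^^ N1) ?R"
    and N2: "(delta ^^ N2) (\<lambda>m n. ?R n m) = B j i k *\<^sub>C (delta ^^ N2) (\<lambda>m n. ?P n m)"
    using local_ex[of i j u v] local_ex[of j i v u] by metis
  define N where "N = N1 + N2"
  have 1: "(delta ^^ N) ?P = B i j k *\<^sub>C (delta ^^ N) ?R"
    using delta_pow_mono[of N1 ?P "B i j k *\<^sub>C ?R" N] N1 by (simp add: delta_pow_scale N_def)
  have "(delta ^^ N) (\<lambda>m n. ?R n m) = B j i k *\<^sub>C (delta ^^ N) (\<lambda>m n. ?P n m)"
    using delta_pow_mono[of N2 "\<lambda>m n. ?R n m" "B j i k *\<^sub>C (\<lambda>m n. ?P n m)" N] N2 by (simp add: delta_pow_scale N_def)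
  then have "(-1) ^ N *\<^sub>C (delta ^^ N) ?R m n = B j i k *\<^sub>C (-1) ^ N *\<^sub>C (delta ^^ N) ?P m n" for m n
    unfolding delta_pow_transpose[of N ?R] delta_pow_transpose[of N ?P] by (auto simp: fun_eq_iff scaleC_fun_def)
  then have "(-1) ^ N *\<^sub>C (delta ^^ N) ?R m n = (-1) ^ N *\<^sub>C B j i k *\<^sub>C (delta ^^ N) ?P m n" for m n
    by (simp add: mult.commute)
  then have 2: "(delta ^^ N) ?R = B j i k *\<^sub>C (delta ^^ N) ?P"
    by (auto simp: fun_eq_iff scaleC_fun_def simp del: cvec.scale_scale)
  have "(delta ^^ N) ?P \<noteq> 0" using comp_zero nz by blast
  moreover have "(1 - B i j k * B j i k) *\<^sub>C (delta ^^ N) ?P = 0"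
    using 1 unfolding 2 by (simp add: cvec.scale_left_diff_distrib)
  ultimately show ?thesis by simp
qed

text \<open>The intertwining condition expands the same iterate with factor 1. At a common pole
  order both numerators have equal diagonal coefficients, hence coincide, and a nonzero product
  forces the factors to agree.\<close>

lemma unit_assoc: "\<phi> 0 j k = 1"
proof -
  obtain u v x n m where nz: "Y 0 (j + k) u (Y j k v x $$ n) $$ m \<noteq> 0" using comp_nonzero by blast
  let ?P = "\<lambda>m n. Y 0 (j + k) u (Y j k v x $$ n) $$ m"
  let ?Q = "\<lambda>p n. Y (0 + j) k (Y 0 j u v $$ p) x $$ n"
  obtain N Z1 where N: "expands ?P 1 ?Q N Z1" using unit_expands by blast
  have "\<forall>p< - int N. \<forall>n. ?Q p n = 0" using N by (simp add: expands_def)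
  then have Q: "\<forall>p n. p < - int N \<longrightarrow> ?Q p n = 0" by blast
  obtain K where K: "\<forall>m n. n < K \<longrightarrow> ?P m n = 0" using comp_bounded by blast
  obtain N' Z' where "expands ?P (\<phi> 0 j k) ?Q N' Z'" using associative by blast
  then obtain Z2 where Z2: "expands ?P (\<phi> 0 j k) ?Q N Z2" using expands_adjust[OF K _ Q] by metis
  have b: "bounded_below Z1" "bounded_below Z2" using N Z2 by (simp_all add: expands_def)
  have "diag q Z1 d = diag q Z2 d" for q d
    using expands_nth[OF N, of q "d - int q"] expands_nth[OF Z2, of q "d - int q"] by simp
  then have "Z1 - Z2 = 0"
    by (intro diag_eq_0_imp_0) (simp_all add: b bounded_below_diff diag_diff)
  then have "(delta ^^ N) ?P = \<phi> 0 j k *\<^sub>C (delta ^^ N) ?P"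
    using N Z2 by (simp add: expands_def scaleC_one)
  then have "(1 - \<phi> 0 j k) *\<^sub>C (delta ^^ N) ?P = 0" by (simp add: cvec.scale_left_diff_distrib scaleC_one)
  moreover have "(delta ^^ N) ?P \<noteq> 0" using comp_zero nz by blast
  ultimately show ?thesis by simp
qed

lemma B_unit: "B 0 j k = 1"
proof -
  obtain u v x n m where nz: "Y 0 (j + k) u (Y j k v x $$ n) $$ m \<noteq> 0" using comp_nonzero by blast
  let ?P = "\<lambda>m n. Y 0 (j + k) u (Y j k v x $$ n) $$ m" and ?R = "\<lambda>m n. Y j k v (Y 0 k u x $$ m) $$ n"
  obtain N1 N2 where N1: "(delta ^^ N1) ?P = B 0 j k *\<^sub>C (delta ^^ N1) ?R"
    and N2: "(delta ^^ N2) ?P = (delta ^^ N2) ?R"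
    using local_ex[of 0 j u v] unit_local[of j k u v x] by fastforce
  define N where "N = N1 + N2"
  have 1: "(delta ^^ N) ?P = B 0 j k *\<^sub>C (delta ^^ N) ?R"
    using delta_pow_mono[of N1 ?P "B 0 j k *\<^sub>C ?R" N] N1 by (simp add: delta_pow_scale N_def)
  have 2: "(delta ^^ N) ?P = (delta ^^ N) ?R"
    using delta_pow_mono[OF N2, of N] by (simp add: N_def)
  have "(delta ^^ N) ?P \<noteq> 0" using comp_zero nz by blast
  moreover have "(1 - B 0 j k) *\<^sub>C (delta ^^ N) ?P = 0"
    using 1 2 by (simp add: cvec.scale_left_diff_distrib)
  ultimately show ?thesis by simp
qed

text \<open>Operators of degree \<open>i + j\<close> are reached through the coefficients of a
  product of degrees \<open>i\<close> and \<open>j\<close> in powers of z - w. \<open>T1\<close>,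
  \<open>T2\<close>, \<open>T3\<close> are the products in the orders i j l, i l j, l i j; powers of
  w - t and z - t link them, and a power of z - w exposes numerators \<open>G1\<close>,
  \<open>G2\<close>, whose diagonal coefficients inherit a locality relation as in Dong's
  lemma.\<close>

lemma B_hexagon: "B (i + j) l k * \<phi> i j (l + k) = \<phi> i j k * B i l (j + k) * B j l k"
proof -
  obtain y u v x where nz: "\<exists>n m s. Y l (i + j + k) y (Y i (j + k) u (Y j k v x $$ n) $$ m) $$ s \<noteq> 0"
    using nonzero4 by blast
  define T1 where "T1 = (\<lambda>m n s. Y i (j + (l + k)) u (Y j (l + k) v (Y l k y x $$ s) $$ n) $$ m)"
  define T2 where "T2 = (\<lambda>m n s. Y i (l + (j + k)) u (Y l (j + k) y (Y j k v x $$ n) $$ s) $$ m)"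
  define T3 where "T3 = (\<lambda>m n s. Y l (i + (j + k)) y (Y i (j + k) u (Y j k v x $$ n) $$ m) $$ s)"
  obtain N where N: "\<forall>p < - int N. Y i j u v $$ p = 0" using ex_pole_bound by blast
  obtain La where La: "\<And>k x. (delta ^^ La) (\<lambda>n s. Y j (l + k) v (Y l k y x $$ s) $$ n)
      = B j l k *\<^sub>C (delta ^^ La) (\<lambda>n s. Y l (j + k) y (Y j k v x $$ n) $$ s)"
    using local_ex[of j l v y] by blast
  obtain Lb where Lb: "\<And>k x. (delta ^^ Lb) (\<lambda>m s. Y i (l + k) u (Y l k y x $$ s) $$ m)
      = B i l k *\<^sub>C (delta ^^ Lb) (\<lambda>m s. Y l (i + k) y (Y i k u x $$ m) $$ s)"
    using local_ex[of i l u y] by blast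
  have hom: "(\<lambda>x. Y i k u x $$ m) (x - y) = (\<lambda>x. Y i k u x $$ m) x - (\<lambda>x. Y i k u x $$ m) y" for i k u m x y
    by (simp add: Y_diff)
  have T12: "(D23 ^^ La) T1 = B j l k *\<^sub>C (D23 ^^ La) T2"
  proof (intro ext)
    fix m n s
    have "(D23 ^^ La) T1 m n s = Y i (j + (l + k)) u ((delta ^^ La) (\<lambda>n s. Y j (l + k) v (Y l k y x $$ s) $$ n) n s) $$ m"
      by (simp only: D23_pow T1_def delta_pow_hom[of "\<lambda>x. Y i (j + (l + k)) u x $$ m", OF hom])
    also have "\<dots> = B j l k *\<^sub>C (Y i (j + (l + k)) u ((delta ^^ La) (\<lambda>n s. Y l (j + k) y (Y j k v x $$ n) $$ s) n s) $$ m)"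
      by (simp add: La scaleC_fun_def Y_scale fls_scaleC_nth)
    also have "\<dots> = (B j l k *\<^sub>C (D23 ^^ La) T2) m n s"
      by (simp only: scaleC_fun_def D23_pow T2_def add.left_commute[of l] delta_pow_hom[of "\<lambda>x. Y i (j + (l + k)) u x $$ m", OF hom])
    finally show "(D23 ^^ La) T1 m n s = (B j l k *\<^sub>C (D23 ^^ La) T2) m n s" .
  qed
  \<comment> \<open>Here one exponent \<open>Lb\<close> has to serve all coefficients
    \<open>Y j k v x $$ n\<close>.\<close>
  have T23: "(D13 ^^ Lb) T2 = B i l (j + k) *\<^sub>C (D13 ^^ Lb) T3"
    by (simp only: D13_pow T2_def T3_def Lb scaleC_fun_def)
  define X where "X = (\<lambda>G :: int \<Rightarrow> int \<Rightarrow> int \<Rightarrow> 'v. (D13 ^^ Lb) ((D23 ^^ La) G))"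
  have X_scale: "X (c *\<^sub>C G) = c *\<^sub>C X G" for c G by (simp only: X_def D23_scale D13_scale)
  have T13: "X T1 = (B j l k * B i l (j + k)) *\<^sub>C X T3"
  proof -
    have "X T1 = B j l k *\<^sub>C X T2" by (simp only: X_def T12 D13_scale)
    also have "X T2 = B i l (j + k) *\<^sub>C X T3" by (simp only: X_def D13_D23 T23 D23_scale)
    finally show ?thesis by simp
  qed
  \<comment> \<open>The pole order \<open>N\<close> is that of \<open>Y i j u v\<close> and is
    common to all \<open>s\<close>; the numerators are chosen for each \<open>s\<close>.\<close>
  have "\<exists>Z. \<forall>s. expands (\<lambda>m n. T1 m n s) (\<phi> i j (l + k))
      (\<lambda>p n. Y (i + j) (l + k) (Y i j u v $$ p) (Y l k y x $$ s) $$ n) N (Z s)"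
  proof (rule choice, rule allI)
    fix s
    show "\<exists>Z. expands (\<lambda>m n. T1 m n s) (\<phi> i j (l + k))
      (\<lambda>p n. Y (i + j) (l + k) (Y i j u v $$ p) (Y l k y x $$ s) $$ n) N Z"
      unfolding T1_def by (rule associative_uniform[OF N]) blast
  qed
  then obtain Z1 where Z1: "\<And>s. expands (\<lambda>m n. T1 m n s) (\<phi> i j (l + k))
      (\<lambda>p n. Y (i + j) (l + k) (Y i j u v $$ p) (Y l k y x $$ s) $$ n) N (Z1 s)" by blast
  obtain Z2 where Z2: "expands (\<lambda>m n. Y i (j + k) u (Y j k v x $$ n) $$ m) (\<phi> i j k)
      (\<lambda>p n. Y (i + j) k (Y i j u v $$ p) x $$ n) N Z2" by (rule associative_uniform[OF N])
  have bZ2: "bounded_below Z2" using Z2 by (simp add: expands_def)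
  define G1 where "G1 = (\<lambda>m n s. Z1 s m n)"
  define G2 where "G2 = (\<lambda>m n s. Y l (i + (j + k)) y (Z2 m n) $$ s)"
  have b1: "slice_bounded G1" using Z1 by (simp add: slice_bounded_def G1_def expands_def)
  have b2: "slice_bounded G2"
    using bounded_below_hom[OF bZ2, of "\<lambda>x. Y l (i + (j + k)) y x $$ s" for s]
    by (simp add: slice_bounded_def G2_def Y_0_right)
  have TG1: "(D12 ^^ N) T1 = \<phi> i j (l + k) *\<^sub>C G1"
    using Z1 by (simp add: D12_pow G1_def expands_def scaleC_fun_def)
  have TG2: "(D12 ^^ N) T3 = \<phi> i j k *\<^sub>C G2"
  proof (intro ext)
    fix m n s
    have "(D12 ^^ N) T3 m n s = Y l (i + (j + k)) y ((delta ^^ N) (\<lambda>m n. Y i (j + k) u (Y j k v x $$ n) $$ m) m n) $$ s"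
      by (simp only: D12_pow T3_def delta_pow_hom[of "\<lambda>x. Y l (i + (j + k)) y x $$ s", OF hom])
    also have "\<dots> = (\<phi> i j k *\<^sub>C G2) m n s"
      using Z2 by (simp add: expands_def scaleC_fun_def Y_scale fls_scaleC_nth G2_def)
    finally show "(D12 ^^ N) T3 m n s = (\<phi> i j k *\<^sub>C G2) m n s" .
  qed
  \<comment> \<open>The value that the hexagon prescribes for \<open>B (i + j) l k\<close>.\<close>
  define \<gamma> where "\<gamma> = B j l k * B i l (j + k) * \<phi> i j k / \<phi> i j (l + k)"
  have "\<phi> i j (l + k) *\<^sub>C X G1 = (D12 ^^ N) (X T1)"
    by (simp only: X_def D12_D13 D12_D23 TG1 D13_scale D23_scale)
  also have "\<dots> = (B j l k * B i l (j + k)) *\<^sub>C (\<phi> i j k *\<^sub>C X G2)"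
    unfolding T13 by (simp only: X_def D12_scale D12_D13 D12_D23 TG2 D13_scale D23_scale)
  finally have "\<phi> i j (l + k) *\<^sub>C X G1 = \<phi> i j (l + k) *\<^sub>C \<gamma> *\<^sub>C X G2"
    by (simp add: \<gamma>_def)
  then have "X G1 = \<gamma> *\<^sub>C X G2" by (simp del: cvec.scale_scale)
  then have X0: "X (G1 - \<gamma> *\<^sub>C G2) = 0"
    by (simp add: X_def D13_diff D23_diff D13_scale D23_scale)
  have sb2: "slice_bounded (\<gamma> *\<^sub>C G2)"
    using b2 bounded_below_scale by (auto simp: slice_bounded_def scaleC_fun_def)
  have sb: "slice_bounded (G1 - \<gamma> *\<^sub>C G2)"
    unfolding slice_bounded_def
  proof
    fix s
    have "(\<lambda>m n. (G1 - \<gamma> *\<^sub>C G2) m n s) = (\<lambda>m n. G1 m n s) - (\<lambda>m n. (\<gamma> *\<^sub>C G2) m n s)"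
      by (simp add: fun_eq_iff)
    moreover have "bounded_below (\<lambda>m n. G1 m n s)" "bounded_below (\<lambda>m n. (\<gamma> *\<^sub>C G2) m n s)"
      using b1 sb2 by (simp_all add: slice_bounded_def)
    ultimately show "bounded_below (\<lambda>m n. (G1 - \<gamma> *\<^sub>C G2) m n s)"
      by (simp only: bounded_below_diff)
  qed
  have "\<gamma> = B (i + j) l k"
  proof (rule ccontr)
    assume ne: "\<gamma> \<noteq> B (i + j) l k"
    \<comment> \<open>For a coefficient \<open>a\<close> of \<open>Y i j u v\<close>, the
      three-variable relation makes \<open>E1\<close> and \<open>E2\<close> agree up to the factor
      \<open>\<gamma>\<close>, whereas locality in degrees \<open>i + j\<close> and \<open>l\<close>
      gives the factor \<open>B (i + j) l k\<close>. If the factors differ, \<open>E2\<close>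
      vanishes.\<close>
    have dz: "diag q (\<lambda>m n. G2 m n s) d = 0" for q d s
    proof -
      define a where "a = Y i j u v $$ (int q - int N)"
      define E1 where "E1 = (\<lambda>n s. Y (i + j) (l + k) a (Y l k y x $$ s) $$ n)"
      define E2 where "E2 = (\<lambda>n s. Y l (i + j + k) y (Y (i + j) k a x $$ n) $$ s)"
      have d2: "diag12 q G2 (n + int q) s = E2 n s" for n s
        using diag_hom[OF bZ2, of "\<lambda>x. Y l (i + (j + k)) y x $$ s" q "n + int q"] expands_nth[OF Z2, of q n]
        by (simp add: diag12_def G2_def E2_def a_def Y_add Y_scale fls_scaleC_nth add.assoc)
      have d1: "diag12 q G1 (n + int q) s = E1 n s" for n s
        using expands_nth[OF Z1[of s], of q n] by (simp add: diag12_def G1_def E1_def a_def)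
      have "diag12 q (G1 - \<gamma> *\<^sub>C G2) (n + int q) s = (E1 - \<gamma> *\<^sub>C E2) n s" for n s
      proof -
        have "(\<lambda>m n. (G1 - \<gamma> *\<^sub>C G2) m n s) = (\<lambda>m n. G1 m n s) - \<gamma> *\<^sub>C (\<lambda>m n. G2 m n s)"
          by (simp add: fun_eq_iff scaleC_fun_def)
        then show ?thesis using d1[of n s] d2[of n s] b1 b2
          by (simp add: diag12_def slice_bounded_def diag_diff bounded_below_scale diag_scale)
            (simp add: scaleC_fun_def)
      qed
      then have E12: "(\<lambda>n s. diag12 q (G1 - \<gamma> *\<^sub>C G2) (n + int q) s) = E1 - \<gamma> *\<^sub>C E2" by (simp add: fun_eq_iff)
      have "(delta ^^ (Lb + q + La)) (diag12 q (G1 - \<gamma> *\<^sub>C G2)) = 0"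
        by (rule diag12_D13_D23_pow[OF sb]) (use X0 in \<open>simp only: X_def\<close>)
      then have R: "(delta ^^ (Lb + q + La)) (E1 - \<gamma> *\<^sub>C E2) = 0"
        unfolding E12[symmetric] delta_pow_shift by (simp add: fun_eq_iff)
      obtain L where L: "(delta ^^ L) E1 = B (i + j) l k *\<^sub>C (delta ^^ L) E2"
        unfolding E1_def E2_def using local_ex[of "i + j" l a y] by blast
      define M where "M = Lb + q + La + L"
      have "(delta ^^ M) (E1 - \<gamma> *\<^sub>C E2) = (delta ^^ M) 0"
        by (rule delta_pow_mono[of "Lb + q + La"]) (use R in \<open>simp_all add: delta_pow_0 M_def\<close>)
      moreover have "(delta ^^ M) E1 = (delta ^^ M) (B (i + j) l k *\<^sub>C E2)"
        by (rule delta_pow_mono[of L]) (simp_all add: L M_def delta_pow_scale)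
      ultimately have "(B (i + j) l k - \<gamma>) *\<^sub>C (delta ^^ M) E2 = 0"
        by (simp add: delta_pow_diff delta_pow_scale delta_pow_0 cvec.scale_left_diff_distrib)
      then have "(delta ^^ M) E2 = 0" using ne by simp
      moreover have "\<forall>n s. n < fls_subdegree (Y (i + j) k a x) \<longrightarrow> E2 n s = 0" by (simp add: E2_def Y_0_right)
      ultimately have "E2 = 0" by (intro delta_pow_inj'[of "fls_subdegree (Y (i + j) k a x)" E2 M]) auto
      then show ?thesis using d2[of "d - int q" s] by (simp add: diag12_def)
    qed
    have "(\<lambda>m n. G2 m n s) = 0" for s
      using b2 dz by (intro diag_eq_0_imp_0) (simp_all add: slice_bounded_def)
    then have "G2 = 0" by (auto simp: fun_eq_iff)
    then have TZ: "(D12 ^^ N) T3 = 0" by (simp add: TG2)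
    have "T3 m n s = 0" for m n s
    proof -
      have "(\<lambda>m n. T3 m n s) = 0"
      proof (rule delta_pow_inj[of "fls_subdegree (Y j k v x)" _ N])
        show "(delta ^^ N) (\<lambda>m n. T3 m n s) = 0" using TZ by (simp add: D12_pow fun_eq_iff)
      qed (simp add: T3_def Y_0_right)
      then show ?thesis by (simp add: fun_eq_iff)
    qed
    then show False using nz by (simp add: T3_def add.assoc)
  qed
  then show ?thesis by (simp add: \<gamma>_def field_simps)
qed

sublocale abelian_cocycle \<phi> \<omega>
  by unfold_locales (fact B_antisym B_hexagon unit_assoc B_unit)+

end

section \<open>Expansions of rational functions\<close>

lemma fls_nth_sum [simp]: "(\<Sum>a\<in>A. F a) $$ n = (\<Sum>a\<in>A. F a $$ n)"
  by (induction A rule: infinite_finite_induct) simp_all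

lemma powser2_nth_0: "f \<in> powser2 M \<Longrightarrow> a < 0 \<or> b < 0 \<Longrightarrow> f a b = 0"
  by (auto simp: powser2_def)

text \<open>The coefficient of x^k in (1-x)^(-N); the recursion below is (1-x) (1-x)^(-N-1) =
  (1-x)^(-N).\<close>

definition inv_pow_coeff :: "nat \<Rightarrow> nat \<Rightarrow> complex"
  where "inv_pow_coeff N k = (-1) ^ k * ((- of_nat N) gchoose k)"

lemma inv_pow_coeff_Suc: "inv_pow_coeff (Suc N) (Suc k) - inv_pow_coeff (Suc N) k = inv_pow_coeff N (Suc k)"
proof -
  have "(- of_nat N :: complex) gchoose Suc k
      = ((- of_nat (Suc N)) gchoose k) + ((- of_nat (Suc N)) gchoose Suc k)"
    using gbinomial_Suc_Suc[of "- of_nat (Suc N) :: complex" k] by simp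
  then show ?thesis by (simp add: inv_pow_coeff_def algebra_simps del: of_nat_Suc)
qed

lemma nat_set_eq: "{k. int k \<le> a} = (if a < 0 then {} else {..nat a})"
  by auto

lemma expand_z_w_nth:
  assumes f: "f \<in> powser2 M"
  shows "expand_z_w N f $$ n $$ m = (\<Sum>k | int k \<le> n + int N.
    inv_pow_coeff N k *\<^sub>C f (m + 2 * int N + int k) (n + int N - int k))"
proof -
  have 1: "Abs_fls (\<lambda>m. \<Sum>k | int k \<le> n + int N.
      ((-1) ^ k * ((- of_nat N) gchoose k)) *\<^sub>C f (m + 2 * int N + int k) (n + int N - int k)) $$ m
    = (\<Sum>k | int k \<le> n + int N.
      ((-1) ^ k * ((- of_nat N) gchoose k)) *\<^sub>C f (m + 2 * int N + int k) (n + int N - int k))" for n m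
    by (rule nth_Abs_fls_lower_bound[of "- 2 * int N - (n + int N)"])
      (auto intro!: sum.neutral simp: powser2_nth_0[OF f])
  have "expand_z_w N f $$ n = Abs_fls (\<lambda>m. \<Sum>k | int k \<le> n + int N.
      ((-1) ^ k * ((- of_nat N) gchoose k)) *\<^sub>C f (m + 2 * int N + int k) (n + int N - int k))"
    unfolding expand_z_w_def
    by (rule nth_Abs_fls_lower_bound[of "- int N"])
      (auto simp: fls_eq_iff 1 nat_set_eq)
  then show ?thesis by (simp only: 1 inv_pow_coeff_def)
qed

lemma expand_z_w_bounded: "f \<in> powser2 M \<Longrightarrow> n < - int N \<Longrightarrow> expand_z_w N f $$ n = 0"
  by (simp add: fls_eq_iff expand_z_w_nth nat_set_eq)

lemma delta_pow_expand_z_w: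
  assumes f: "f \<in> powser2 M"
  shows "(delta ^^ N) (\<lambda>m n. expand_z_w N f $$ n $$ m) = (\<lambda>m n. f (m + int N) (n + int N))"
proof -
  \<comment> \<open>The expansion of f / ((zw)^N (z-w)^r), so that each application of
    \<open>delta\<close> lowers \<open>r\<close> by one.\<close>
  define e where "e = (\<lambda>r m n. \<Sum>k | int k \<le> n + int N.
    inv_pow_coeff r k *\<^sub>C f (m + int r + int k + int N) (n - int k + int N))"
  have step: "delta (e (Suc r)) = e r" for r
  proof (intro ext)
    fix m n
    show "delta (e (Suc r)) m n = e r m n"
    proof (cases "n + int N < 0")
      case True then show ?thesis by (simp add: delta_def e_def nat_set_eq)
    next
      case False
      define b where "b = nat (n + int N)"
      have n: "n = int b - int N" using False by (simp add: b_def)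
      define g where "g = (\<lambda>k. f (m + int r + int k + int N) (n - int k + int N))"
      have A: "e (Suc r) (m - 1) n = (\<Sum>k\<le>b. inv_pow_coeff (Suc r) k *\<^sub>C g k)"
        unfolding e_def g_def using False by (simp add: nat_set_eq b_def algebra_simps)
      have B: "e (Suc r) m (n - 1) = (\<Sum>k<b. inv_pow_coeff (Suc r) k *\<^sub>C g (Suc k))"
      proof -
        have "{k. int k \<le> n - 1 + int N} = {..<b}" by (auto simp: n)
        then show ?thesis unfolding e_def g_def by (simp add: algebra_simps)
      qed
      have C: "e r m n = (\<Sum>k\<le>b. inv_pow_coeff r k *\<^sub>C g k)"
        unfolding e_def g_def using False by (simp add: nat_set_eq b_def algebra_simps)
      have split: "(\<Sum>k\<le>b. h k) = h 0 + (\<Sum>k<b. h (Suc k))" for h :: "nat \<Rightarrow> 'a"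
        by (rule sum.atMost_shift)
      show ?thesis
        unfolding delta_def A B C split
        by (simp add: inv_pow_coeff_def[of _ 0] sum_subtractf[symmetric] cvec.scale_left_diff_distrib[symmetric]
            inv_pow_coeff_Suc add_diff_eq[symmetric])
    qed
  qed
  have "(delta ^^ r) (e r) = e 0" for r
    by (induction r) (simp_all only: funpow_Suc_right comp_apply step funpow_0)
  moreover have "(\<lambda>m n. expand_z_w N f $$ n $$ m) = e N"
    by (simp add: expand_z_w_nth[OF f] e_def fun_eq_iff algebra_simps)
  moreover have "e 0 = (\<lambda>m n. f (m + int N) (n + int N))"
  proof (intro ext)
    fix m n
    have z: "inv_pow_coeff 0 k = (if k = 0 then 1 else 0)" for k by (cases k) (simp_all add: inv_pow_coeff_def)
    show "e 0 m n = f (m + int N) (n + int N)"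
      by (cases "n + int N < 0") (simp_all add: e_def nat_set_eq z powser2_nth_0[OF f] if_distrib[of "\<lambda>c. c *\<^sub>C _"] sum.delta' cong: if_cong)
  qed
  ultimately show ?thesis by simp
qed

lemma powser2_transpose: "f \<in> powser2 M \<Longrightarrow> (\<lambda>a b. f b a) \<in> powser2 M"
  by (auto simp: powser2_def)

text \<open>Exchange of variables together with (z-w)^(-N) = (-1)^N (w-z)^(-N) reduces the second
  expansion to the first.\<close>

lemma expand_w_z_eq:
  assumes f: "f \<in> powser2 M"
  shows "expand_w_z N f $$ m $$ n = ((-1) ^ N) *\<^sub>C (expand_z_w N (\<lambda>a b. f b a) $$ m $$ n)"
proof -
  have 1: "Abs_fls (\<lambda>n. \<Sum>k | int k \<le> m + int N.
      ((-1) ^ N * (-1) ^ k * ((- of_nat N) gchoose k)) *\<^sub>C f (m + int N - int k) (n + 2 * int N + int k)) $$ n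
    = (\<Sum>k | int k \<le> m + int N.
      ((-1) ^ N * (-1) ^ k * ((- of_nat N) gchoose k)) *\<^sub>C f (m + int N - int k) (n + 2 * int N + int k))" for n m
    by (rule nth_Abs_fls_lower_bound[of "- 2 * int N - (m + int N)"])
      (auto intro!: sum.neutral simp: powser2_nth_0[OF f])
  have "expand_w_z N f $$ m = Abs_fls (\<lambda>n. \<Sum>k | int k \<le> m + int N.
      ((-1) ^ N * (-1) ^ k * ((- of_nat N) gchoose k)) *\<^sub>C f (m + int N - int k) (n + 2 * int N + int k))"
    unfolding expand_w_z_def
    by (rule nth_Abs_fls_lower_bound[of "- int N"])
      (auto simp: fls_eq_iff 1 nat_set_eq)
  then have "expand_w_z N f $$ m $$ n = (\<Sum>k | int k \<le> m + int N.
      ((-1) ^ N * (-1) ^ k * ((- of_nat N) gchoose k)) *\<^sub>C f (m + int N - int k) (n + 2 * int N + int k))"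
    by (simp only: 1)
  then show ?thesis
    by (simp only: expand_z_w_nth[OF powser2_transpose[OF f]] inv_pow_coeff_def cvec.scale_sum_right scaleC_scaleC mult.assoc)
qed

lemma expand_w_z_bounded:
  assumes "f \<in> powser2 M" "m < - int N"
  shows "expand_w_z N f $$ m = 0"
  using expand_z_w_bounded[OF powser2_transpose[OF assms(1)] assms(2)]
  by (simp add: fls_eq_iff expand_w_z_eq[OF assms(1)])

lemma delta_pow_expand_w_z:
  assumes f: "f \<in> powser2 M"
  shows "(delta ^^ N) (\<lambda>m n. expand_w_z N f $$ m $$ n) = (\<lambda>m n. f (m + int N) (n + int N))"
proof -
  have s: "(-1) ^ N * (-1) ^ N = (1::complex)" by (simp flip: power_add)
  define X where "X = (\<lambda>m n. expand_z_w N (\<lambda>a b. f b a) $$ n $$ m)"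
  have "(\<lambda>m n. expand_w_z N f $$ m $$ n) = ((-1) ^ N) *\<^sub>C (\<lambda>m n. X n m)"
    by (simp add: fun_eq_iff scaleC_fun_def expand_w_z_eq[OF f] X_def)
  then have "(delta ^^ N) (\<lambda>m n. expand_w_z N f $$ m $$ n)
     = ((-1) ^ N) *\<^sub>C (\<lambda>m n. ((-1) ^ N) *\<^sub>C (delta ^^ N) X n m)"
    by (simp only: delta_pow_scale delta_pow_transpose[of N X])
  then show ?thesis
    unfolding X_def delta_pow_expand_z_w[OF powser2_transpose[OF f]] by (simp add: scaleC_fun_def s)
qed

lemma expand_w_zw_nth:
  assumes f: "f \<in> powser2 M"
  shows "expand_w_zw N f $$ p $$ n = (if p + int N < 0 then 0
    else diag (nat (p + int N)) (\<lambda>m n. f (m + int N) (n + int N)) (n + p + int N))"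
proof -
  have 1: "Abs_fls (\<lambda>n. if p + int N < 0 then 0
      else \<Sum>a = 0..n + p + 3 * int N. (of_int (a - int N) gchoose nat (p + int N)) *\<^sub>C f a (n + p + 3 * int N - a)) $$ n
    = (if p + int N < 0 then 0
      else \<Sum>a = 0..n + p + 3 * int N. (of_int (a - int N) gchoose nat (p + int N)) *\<^sub>C f a (n + p + 3 * int N - a))" for n p
    by (rule nth_Abs_fls_lower_bound[of "- p - 3 * int N"]) auto
  have "expand_w_zw N f $$ p = Abs_fls (\<lambda>n. if p + int N < 0 then 0
      else \<Sum>a = 0..n + p + 3 * int N. (of_int (a - int N) gchoose nat (p + int N)) *\<^sub>C f a (n + p + 3 * int N - a))"
    unfolding expand_w_zw_def
    by (rule nth_Abs_fls_lower_bound[of "- int N"]) (auto simp: fls_eq_iff 1)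
  moreover have "diag (nat (p + int N)) (\<lambda>m n. f (m + int N) (n + int N)) (n + p + int N)
    = (\<Sum>a = 0..n + p + 3 * int N. (of_int (a - int N) gchoose nat (p + int N)) *\<^sub>C f a (n + p + 3 * int N - a))"
  proof -
    have "diag (nat (p + int N)) (\<lambda>m n. f (m + int N) (n + int N)) (n + p + int N)
      = (\<Sum>m = - int N..n + p + 2 * int N. (of_int m gchoose nat (p + int N)) *\<^sub>C f (m + int N) (n + p + int N - m + int N))"
      by (rule diag_eq_sum) (auto simp: powser2_nth_0[OF f])
    also have "\<dots> = (\<Sum>a = 0..n + p + 3 * int N. (of_int (a - int N) gchoose nat (p + int N)) *\<^sub>C f a (n + p + 3 * int N - a))"
      by (rule sum.reindex_bij_witness[where i="\<lambda>a. a - int N" and j="\<lambda>m. m + int N"]) (auto simp: algebra_simps)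
    finally show ?thesis .
  qed
  ultimately show ?thesis by (simp only: 1)
qed

lemma expands_expand:
  assumes f: "f \<in> powser2 M" and P: "\<And>m n. P $$ n $$ m = c *\<^sub>C (expand_z_w N f $$ n $$ m)"
  shows "expands (\<lambda>m n. P $$ n $$ m) c (\<lambda>p n. expand_w_zw N f $$ p $$ n) N (\<lambda>m n. f (m + int N) (n + int N))"
proof -
  have b: "bounded_below (\<lambda>m n. f (m + int N) (n + int N))"
    unfolding bounded_below_def by (rule exI[of _ "- int N"]) (auto simp: powser2_nth_0[OF f])
  have "(\<lambda>m n. P $$ n $$ m) = c *\<^sub>C (\<lambda>m n. expand_z_w N f $$ n $$ m)"
    by (simp add: P fun_eq_iff scaleC_fun_def)
  then show ?thesis
    using b by (simp add: expands_def expand_w_zw_nth[OF f] delta_pow_scale delta_pow_expand_z_w[OF f])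
qed

text \<open>The common value of both sides is bounded below in w because of \<open>P\<close> and in
  z because of \<open>R\<close>. Hence it is a power series up to a power of zw, and injectivity of
  multiplication by z - w identifies \<open>P\<close> and \<open>R\<close> with its
  expansions.\<close>

lemma same_zw_wzI:
  assumes M: "cvec.subspace M" and P: "\<And>m n. P $$ n $$ m \<in> M" and R: "\<And>m n. R $$ m $$ n \<in> M"
    and eq: "(delta ^^ N) (\<lambda>m n. P $$ n $$ m) = (delta ^^ N) (\<lambda>m n. R $$ m $$ n)"
  shows "same_zw_wz M P R"
proof -
  \<comment> \<open>Large enough for the one exponent \<open>N'\<close> to bound the poles at z, w
    and z - w.\<close>
  define K where "K = nat (- fls_subdegree P) + nat (- fls_subdegree R)"
  define N' where "N' = N + K"
  define f where "f = (\<lambda>a b. (delta ^^ N') (\<lambda>m n. P $$ n $$ m) (a - int N') (b - int N'))"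
  have eq': "(delta ^^ N') (\<lambda>m n. P $$ n $$ m) = (delta ^^ N') (\<lambda>m n. R $$ m $$ n)"
    by (rule delta_pow_mono[OF eq]) (simp add: N'_def)
  have P0: "P $$ n $$ m = 0" if "n < - int N'" for m n
  proof -
    have "n < fls_subdegree P" using that unfolding N'_def K_def by linarith
    then show ?thesis by simp
  qed
  have R0: "R $$ m $$ n = 0" if "m < - int N'" for m n
  proof -
    have "m < fls_subdegree R" using that unfolding N'_def K_def by linarith
    then show ?thesis by simp
  qed
  have z2: "(delta ^^ N') (\<lambda>m n. P $$ n $$ m) m n = 0" if "n < - int N'" for m n
    by (rule delta_pow_bdd2[OF _ that]) (rule P0)
  have z1: "(delta ^^ N') (\<lambda>m n. P $$ n $$ m) m n = 0" if "m < - int N'" for m n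
    unfolding eq' by (rule delta_pow_bdd1[OF _ that]) (rule R0)
  have f: "f \<in> powser2 M"
    unfolding powser2_def f_def using z1 z2 delta_pow_in[OF M, of "\<lambda>m n. P $$ n $$ m", OF P] by auto
  have "(\<lambda>m n. P $$ n $$ m) - (\<lambda>m n. expand_z_w N' f $$ n $$ m) = 0"
    by (rule delta_pow_inj[where K = "- int N'" and N = N'])
      (simp_all add: P0 expand_z_w_bounded[OF f] delta_pow_diff delta_pow_expand_z_w[OF f], simp add: f_def fun_eq_iff)
  then have "P = expand_z_w N' f" by (simp add: fls_eq_iff fun_eq_iff)
  moreover have "(\<lambda>m n. R $$ m $$ n) - (\<lambda>m n. expand_w_z N' f $$ m $$ n) = 0"
    by (rule delta_pow_inj'[where K = "- int N'" and N = N'])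
      (simp_all add: R0 expand_w_z_bounded[OF f] delta_pow_diff delta_pow_expand_w_z[OF f], simp add: f_def fun_eq_iff eq')
  then have "R = expand_w_z N' f" by (simp add: fls_eq_iff fun_eq_iff)
  ultimately show ?thesis unfolding same_zw_wz_def using f by blast
qed

lemma same_all_local:
  assumes "same_all M P Q R"
  shows "\<exists>N. (delta ^^ N) (\<lambda>m n. P $$ n $$ m) = (delta ^^ N) (\<lambda>m n. R $$ m $$ n)"
proof -
  obtain N f where "f \<in> powser2 M" "P = expand_z_w N f" "R = expand_w_z N f"
    using assms unfolding same_all_def by blast
  then show ?thesis by (intro exI[of _ N]) (simp add: delta_pow_expand_z_w delta_pow_expand_w_z)
qed

lemma same_all_expands:
  assumes "same_all M P Q R"
  shows "\<exists>N Z. expands (\<lambda>m n. P $$ n $$ m) 1 (\<lambda>p n. Q $$ p $$ n) N Z"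
proof -
  obtain N f where f: "f \<in> powser2 M" "P = expand_z_w N f" "Q = expand_w_zw N f"
    using assms unfolding same_all_def by blast
  show ?thesis using expands_expand[OF f(1), of P 1 N] unfolding f(2,3) scaleC_one by blast
qed

lemma ddz_nth: "ddz F $$ n = of_int (n + 1) *\<^sub>C (F $$ (n + 1))"
  unfolding ddz_def by (rule nth_Abs_fls_lower_bound[of "fls_subdegree F - 1"]) simp

lemma neg_arg_nth: "neg_arg F $$ n = (if even n then F $$ n else - (F $$ n))"
  unfolding neg_arg_def by (rule nth_Abs_fls_lower_bound[of "fls_subdegree F"]) simp

lemma exp_z_nth:
  assumes D: "D 0 = 0" and F: "\<forall>p < - int N. F $$ p = 0"
  shows "exp_z D F $$ (int q - int N)
    = (\<Sum>k\<le>q. inverse (fact k) *\<^sub>C (D ^^ k) (F $$ (int q - int N - int k)))"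
proof -
  have Dk: "(D ^^ k) 0 = 0" for k by (induction k) (simp_all add: D)
  have F': "int k \<le> n + int N" if "F $$ (n - int k) \<noteq> 0" for n k
  proof (rule ccontr)
    assume "\<not> int k \<le> n + int N"
    then have "n - int k < - int N" by simp
    then show False using F that by blast
  qed
  have "exp_z D F $$ (int q - int N) = (\<Sum>k | F $$ (int q - int N - int k) \<noteq> 0.
    inverse (fact k) *\<^sub>C (D ^^ k) (F $$ (int q - int N - int k)))"
    unfolding exp_z_def
  proof (rule nth_Abs_fls_lower_bound[of "- int N"], intro allI impI)
    fix n assume "n < - int N"
    then have "{k. F $$ (n - int k) \<noteq> 0} = {}" using F' by fastforce
    then show "(\<Sum>k | F $$ (n - int k) \<noteq> 0. inverse (fact k) *\<^sub>C (D ^^ k) (F $$ (n - int k))) = 0" by simp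
  qed
  also have "\<dots> = (\<Sum>k\<le>q. inverse (fact k) *\<^sub>C (D ^^ k) (F $$ (int q - int N - int k)))"
    by (rule sum.mono_neutral_left) (use F' in \<open>force simp: Dk\<close>)+
  finally show ?thesis .
qed

section \<open>Intertwining operators of a commutativity datum\<close>

lemma one_dimensional_spanD:
  assumes "one_dimensional S"
  obtains e where "e \<in> S" "e \<noteq> 0" "S = cvec.span {e}"
proof -
  have S: "cvec.subspace S" "cvec.dim S = 1" using assms by (auto simp: one_dimensional_def)
  obtain B where B: "B \<subseteq> S" "cvec.independent B" "S \<subseteq> cvec.span B" "card B = cvec.dim S"
    by (rule cvec.basis_exists)
  then obtain e where e: "B = {e}" using S(2) by (auto simp: card_1_singleton_iff)
  have "cvec.span B \<subseteq> S" by (rule cvec.span_minimal[OF B(1) S(1)])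
  then show ?thesis using B e by (intro that[of e]) auto
qed

lemma one_dimensional_nonzero: "one_dimensional S \<Longrightarrow> \<exists>a\<in>S. a \<noteq> 0"
  by (metis one_dimensional_spanD)

lemma one_dimensional_scale:
  assumes "one_dimensional S" "a \<in> S" "a \<noteq> 0" "b \<in> S"
  shows "\<exists>c. b = c *\<^sub>C a"
proof -
  obtain e where e: "e \<noteq> 0" "S = cvec.span {e}" by (rule one_dimensional_spanD[OF assms(1)])
  obtain ca cb where c: "a = ca *\<^sub>C e" "b = cb *\<^sub>C e"
    using assms(2,4) unfolding e(2) cvec.span_singleton by blast
  then have "b = (cb / ca) *\<^sub>C a" using assms(3) by auto
  then show ?thesis by blast
qed

lemma one_dimensional_basis:
  assumes "one_dimensional S" "a \<in> S" "a \<noteq> 0"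
  shows "is_basis S {a}"
proof -
  have "S \<subseteq> cvec.span {a}" using one_dimensional_scale[OF assms] by (auto simp: cvec.span_singleton)
  moreover have "cvec.span {a} \<subseteq> S"
    using assms by (intro cvec.span_minimal) (auto simp: one_dimensional_def)
  ultimately show ?thesis using assms(3) by (auto simp: is_basis_def)
qed

lemma is_basis_singleton: "is_basis S {a} \<Longrightarrow> a \<noteq> 0 \<and> a \<in> S"
  by (auto simp: is_basis_def intro: cvec.span_base)

text \<open>Two one-element bases give a one-element basis of the target, and basis vectors are
  nonzero.\<close>

lemma tensor2_iso_nonzero:
  assumes "tensor2_iso h P Q R" "one_dimensional P" "one_dimensional Q" "p \<in> P" "p \<noteq> 0" "q \<in> Q" "q \<noteq> 0"
  shows "h p q \<noteq> 0 \<and> h p q \<in> R"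
proof -
  have "is_basis R ((\<lambda>(b, c). h b c) ` ({p} \<times> {q}))"
    using assms(1) one_dimensional_basis[OF assms(2,4,5)] one_dimensional_basis[OF assms(3,6,7)]
    unfolding tensor2_iso_def by blast
  then show ?thesis by (auto dest!: is_basis_singleton)
qed

lemma tensor3_iso_nonzero:
  assumes "tensor3_iso h P Q S R" "one_dimensional P" "one_dimensional Q" "one_dimensional S"
    "p \<in> P" "p \<noteq> 0" "q \<in> Q" "q \<noteq> 0" "s \<in> S" "s \<noteq> 0"
  shows "h p q s \<noteq> 0"
proof -
  have "is_basis R ((\<lambda>(b, c, d). h b c d) ` ({p} \<times> {q} \<times> {s}))"
    using assms(1) one_dimensional_basis[OF assms(2,5,6)] one_dimensional_basis[OF assms(3,7,8)]
      one_dimensional_basis[OF assms(4,9,10)]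
    unfolding tensor3_iso_def by blast
  then show ?thesis by (auto dest!: is_basis_singleton)
qed

lemma tensor2_map_0:
  assumes "tensor2_map U1 U2 W h" "cvec.subspace U1" "cvec.subspace U2"
  shows "h 0 x = 0" "h u 0 = 0"
proof -
  have U: "0 \<in> U1" "0 \<in> U2" using assms by (auto intro: cvec.subspace_0)
  show "h 0 x = 0"
  proof (cases "x \<in> U2")
    case True
    then have "h (0 *\<^sub>C 0) x = 0 *\<^sub>C h 0 x" using assms(1) U unfolding tensor2_map_def bilinear_on_def linear_on_def by blast
    then show ?thesis by simp
  qed (use assms in \<open>simp add: tensor2_map_def\<close>)
  show "h u 0 = 0"
  proof (cases "u \<in> U1")
    case True
    then have "h u (0 *\<^sub>C 0) = 0 *\<^sub>C h u 0" using assms(1) U unfolding tensor2_map_def bilinear_on_def linear_on_def by blast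
    then show ?thesis by simp
  qed (use assms in \<open>simp add: tensor2_map_def\<close>)
qed

lemma tensor2_map_add:
  assumes "tensor2_map U1 U2 W h"
  shows "u \<in> U1 \<Longrightarrow> x \<in> U2 \<Longrightarrow> y \<in> U2 \<Longrightarrow> h u (x + y) = h u x + h u y"
    "u \<in> U1 \<Longrightarrow> v \<in> U1 \<Longrightarrow> x \<in> U2 \<Longrightarrow> h (u + v) x = h u x + h v x"
    "u \<in> U1 \<Longrightarrow> x \<in> U2 \<Longrightarrow> h u (c *\<^sub>C x) = c *\<^sub>C h u x"
    "u \<in> U1 \<Longrightarrow> x \<in> U2 \<Longrightarrow> h (c *\<^sub>C u) x = c *\<^sub>C h u x"
    "u \<in> U1 \<Longrightarrow> x \<in> U2 \<Longrightarrow> h u x \<in> W"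
  using assms unfolding tensor2_map_def bilinear_on_def linear_on_def by blast+

lemma tensor2_map_sum:
  assumes "tensor2_map U1 U2 W h" "cvec.subspace U1" "cvec.subspace U2" "\<And>r. r \<in> A \<Longrightarrow> u r \<in> U1" "x \<in> U2"
  shows "h (\<Sum>r\<in>A. u r) x = (\<Sum>r\<in>A. h (u r) x)"
  using assms(4)
proof (induction A rule: infinite_finite_induct)
  case (insert a A)
  have "(\<Sum>r\<in>A. u r) \<in> U1" by (rule cvec.subspace_sum[OF assms(2)]) (use insert in auto)
  then show ?case using insert by (simp add: tensor2_map_add(2)[OF assms(1)] assms)
qed (simp_all add: tensor2_map_0[OF assms(1-3)])

section \<open>Lowest coefficients, skew operators and evenness\<close>

lemma exp_z_lead:
  assumes D: "D 0 = 0" and F: "\<forall>r<p. F $$ r = 0"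
  shows "exp_z D F $$ p = F $$ p"
proof -
  have Dk: "(D ^^ k) 0 = 0" for k by (induction k) (simp_all add: D)
  define N where "N = nat (- fls_subdegree F) + nat (- p)"
  define q where "q = nat (p + int N)"
  have p: "p = int q - int N" by (simp add: q_def N_def)
  have N: "\<forall>r< - int N. F $$ r = 0"
  proof (intro allI impI)
    fix r assume "r < - int N"
    then have "r < fls_subdegree F" unfolding N_def by linarith
    then show "F $$ r = 0" by simp
  qed
  have "exp_z D F $$ p = (\<Sum>k\<le>q. inverse (fact k) *\<^sub>C (D ^^ k) (F $$ (p - int k)))"
    unfolding p by (rule exp_z_nth[where D = D and F = F and N = N, OF D N])
  also have "\<dots> = (\<Sum>k\<in>{0}. inverse (fact k) *\<^sub>C (D ^^ k) (F $$ (p - int k)))"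
    by (rule sum.mono_neutral_right) (use F in \<open>auto simp: Dk\<close>)
  finally show ?thesis by simp
qed

text \<open>The terms of the exponential beyond the identity raise the exponent of z, so at lowest
  order only the sign from z -> -z remains.\<close>

lemma skew_lead:
  assumes "D 0 = 0" "\<forall>r<p. Y u v $$ r = 0"
  shows "skew D Y v u $$ p = (if even p then Y u v $$ p else - (Y u v $$ p))"
  unfolding skew_def using assms by (subst exp_z_lead) (simp_all add: neg_arg_nth)

lemma skew_nonzero:
  assumes "D 0 = 0" "Y \<noteq> 0" shows "skew D Y \<noteq> 0"
proof
  assume z: "skew D Y = 0"
  obtain u v where "Y u v \<noteq> 0" using assms(2) by (auto simp: fun_eq_iff)
  moreover have "skew D Y v u $$ fls_subdegree (Y u v) = 0" by (simp add: z)
  ultimately show False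
    using skew_lead[of D "fls_subdegree (Y u v)" Y u v] assms(1) by (auto split: if_splits)
qed

text \<open>The lowest coefficient of \<open>Y u v\<close> changes by the sign \<open>(-1)^n\<close> under the skew operation.\<close>

lemma even_intertwinerI:
  assumes t: "tensor2_map U U W Y" and sk: "skew D Y = Y" and D: "D 0 = 0" and U: "cvec.subspace U"
  shows "even_intertwiner U Y"
proof (cases "\<exists>u\<in>U. Y u u \<noteq> 0")
  case True
  then obtain u where u: "u \<in> U" "Y u u \<noteq> 0" by blast
  define p where "p = fls_subdegree (Y u u)"
  have p0: "Y u u $$ p \<noteq> 0" using u by (simp add: p_def)
  have "Y u u $$ p = (if even p then Y u u $$ p else - (Y u u $$ p))"
    using skew_lead[of D p Y u u] D by (simp add: sk p_def)
  moreover have "x \<noteq> - x" if "x \<noteq> 0" for x :: 'b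
  proof
    assume "x = - x"
    then have "(2::complex) *\<^sub>C x = 0" using scaleC_add_left[of 1 1 x] by (simp add: scaleC_one eq_neg_iff_add_eq_0)
    then show False using that by simp
  qed
  ultimately have "even p" using p0 by (auto split: if_splits)
  then show ?thesis using u unfolding even_intertwiner_def p_def by blast
next
  case False
  then have z: "Y u u = 0" if "u \<in> U" for u using that by blast
  \<comment> \<open>Polarization of \<open>Y u u = 0\<close>; combined with skew invariance it
    excludes an even lowest exponent.\<close>
  have anti: "Y v u = - Y u v" if "u \<in> U" "v \<in> U" for u v
  proof -
    have "Y (u + v) (u + v) = 0" by (rule z) (use U that in \<open>simp add: cvec.subspace_add\<close>)
    then have "Y u v + Y v u = 0"
      using that U by (simp add: tensor2_map_add(1,2)[OF t] cvec.subspace_add z[OF that(1)] z[OF that(2)] add.commute)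
    then show ?thesis by (simp add: eq_neg_iff_add_eq_0 add.commute)
  qed
  have "odd (fls_subdegree (Y u v))" if uv: "u \<in> U" "v \<in> U" "Y u v \<noteq> 0" for u v
  proof
    assume e: "even (fls_subdegree (Y u v))"
    define p where "p = fls_subdegree (Y u v)"
    have "Y v u $$ p = Y u v $$ p" using skew_lead[of D p Y u v] D e by (simp add: sk p_def)
    then have "- (Y u v $$ p) = Y u v $$ p" by (simp add: anti[OF uv(1,2)])
    then have "(2::complex) *\<^sub>C (Y u v $$ p) = 0"
      using scaleC_add_left[of 1 1 "Y u v $$ p"] by (simp add: scaleC_one neg_eq_iff_add_eq_0)
    then show False using uv by (simp add: p_def)
  qed
  then show ?thesis using z unfolding even_intertwiner_def by blast
qed

section \<open>Scalars attached to a commutativity datum\<close>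

locale fusion_datum =
  fixes T :: "'g setting"
    and V :: "('g, 'v::complex_vector) vertex"
    and M :: "'i::ab_group_add \<Rightarrow> ('g, 'v, 'v) vmod"
    and \<I> :: "'i \<Rightarrow> 'i \<Rightarrow> ('v \<Rightarrow> 'v \<Rightarrow> 'v fls) set"
  assumes alg: "vertex_algebra T V"
    and modules: "\<And>i. vmodule T V (M i)"
    and M_0: "M 0 = vmod.truncate V"
    and datum: "commutativity_datum T V M \<I>"
begin

abbreviation W :: "'i \<Rightarrow> 'v set" where "W i \<equiv> vs (M i)"

lemma subspace_W: "cvec.subspace (W i)"
  using modules by (simp add: vmodule_def)

lemma M_0_simps: "vs (M 0) = vs V" "act (M 0) = act V" "Lop (M 0) = Lop V" "gact (M 0) = gact V"
  by (simp_all add: M_0 vmod.truncate_def)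

lemma modes_m1: "-1 \<in> modes k"
  by (cases k) auto

lemma Lop_linear: "n \<in> modes (kind T) \<Longrightarrow> linear_on (W i) (W i) (Lop (M i) n)"
  using modules[of i] by (auto simp: vmodule_def lie_operators_def)

lemma Lop_0: "n \<in> modes (kind T) \<Longrightarrow> Lop (M i) n 0 = 0"
proof -
  assume "n \<in> modes (kind T)"
  then have "Lop (M i) n (0 *\<^sub>C 0) = 0 *\<^sub>C Lop (M i) n 0"
    using Lop_linear cvec.subspace_0[OF subspace_W] unfolding linear_on_def by blast
  then show ?thesis by simp
qed

lemma Lop_in: "n \<in> modes (kind T) \<Longrightarrow> x \<in> W i \<Longrightarrow> Lop (M i) n x \<in> W i"
  using Lop_linear unfolding linear_on_def by blast

lemma one_dim: "one_dimensional (\<I> i j)"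
  using datum by (auto simp: commutativity_datum_def associativity_datum_def)

lemma intertwinerD: "Y \<in> \<I> i j \<Longrightarrow> Y \<in> intertwiners T V (M i) (M j) (M (i + j))"
  using datum by (auto simp: commutativity_datum_def associativity_datum_def)

lemma tensor2: "Y \<in> \<I> i j \<Longrightarrow> tensor2_map (W i) (W j) (laurent (W (i + j))) Y"
  using intertwinerD by (auto simp: intertwiners_def)

lemmas I_0 = tensor2_map_0[OF tensor2 subspace_W subspace_W]
  and I_add = tensor2_map_add[OF tensor2]

lemma I_in:
  assumes "Y \<in> \<I> i j" shows "Y u v $$ n \<in> W (i + j)"
proof (cases "u \<in> W i \<and> v \<in> W j")
  case True
  then show ?thesis using I_add(5)[OF assms] by (auto simp: laurent_def)
next
  case False
  then have "Y u v = 0" using tensor2[OF assms] by (auto simp: tensor2_map_def)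
  then show ?thesis using cvec.subspace_0[OF subspace_W] by simp
qed

lemma I_spans: "\<I> 0 i = cvec.span {act (M i)}" "\<I> i 0 = cvec.span {skew (Lop (M i) (-1)) (act (M i))}"
  using datum by (auto simp: commutativity_datum_def associativity_datum_def)

text \<open>Along 0 the spanning vectors singled out by condition (iii) are taken, so that the unit
  relations hold exactly and not only up to scalars.\<close>

definition base :: "'i \<Rightarrow> 'i \<Rightarrow> 'v \<Rightarrow> 'v \<Rightarrow> 'v fls"
  where "base i j = (if i = 0 then act (M j) else if j = 0 then skew (Lop (M i) (-1)) (act (M i))
    else (SOME Y. Y \<in> \<I> i j \<and> Y \<noteq> 0))"

lemma base: "base i j \<in> \<I> i j \<and> base i j \<noteq> 0"
proof -
  have sp: "a \<in> S \<and> a \<noteq> 0" if "one_dimensional S" "S = cvec.span {a}" for a and S :: "('v \<Rightarrow> 'v \<Rightarrow> 'v fls) set"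
  proof -
    have "a \<noteq> 0" using one_dimensional_nonzero[OF that(1)] that(2) by (auto simp: cvec.span_singleton)
    then show ?thesis using that(2) by (simp add: cvec.span_base)
  qed
  have ex: "\<exists>Y. Y \<in> \<I> i j \<and> Y \<noteq> 0" using one_dimensional_nonzero[OF one_dim] by blast
  show ?thesis
    unfolding base_def using sp[OF one_dim[of 0 j] I_spans(1)] sp[OF one_dim[of i 0] I_spans(2)] someI_ex[OF ex]
    by auto
qed

lemmas base_in = conjunct1[OF base] and base_nz = conjunct2[OF base]

definition proj :: "'i \<Rightarrow> 'v \<Rightarrow> 'v"
  where "proj i = (SOME p. p ` UNIV \<subseteq> W i \<and> Vector_Spaces.linear scaleC scaleC p \<and> (\<forall>v\<in>W i. p v = v))"

lemma proj: "proj i ` UNIV \<subseteq> W i \<and> Vector_Spaces.linear scaleC scaleC (proj i) \<and> (\<forall>v\<in>W i. proj i v = v)"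
proof -
  interpret vector_space_pair "scaleC :: complex \<Rightarrow> 'v \<Rightarrow> 'v" "scaleC :: complex \<Rightarrow> 'v \<Rightarrow> 'v" ..
  have "\<exists>p. p ` UNIV \<subseteq> W i \<and> Vector_Spaces.linear scaleC scaleC p \<and> (\<forall>v\<in>W i. p (id v) = v)"
    by (rule linear_exists_left_inverse_on[OF cvec.linear_id subspace_W]) simp
  then show ?thesis unfolding id_apply proj_def by (rule someI_ex)
qed

lemma proj_in [simp]: "proj i x \<in> W i" using proj[of i] by blast
lemma proj_id: "x \<in> W i \<Longrightarrow> proj i x = x" using proj[of i] by blast

lemma proj_add: "proj i (x + y) = proj i x + proj i y"
  and proj_scale: "proj i (c *\<^sub>C x) = c *\<^sub>C proj i x"
proof -
  have "Vector_Spaces.linear scaleC scaleC (proj i)" using proj[of i] by blast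
  then show "proj i (x + y) = proj i x + proj i y" "proj i (c *\<^sub>C x) = c *\<^sub>C proj i x"
    by (simp_all add: Vector_Spaces.linear_iff)
qed

lemma proj_0 [simp]: "proj i 0 = 0" using proj_scale[of i 0 0] by simp

text \<open>The projections make the structure maps bilinear on the whole type.\<close>

definition Y :: "'i \<Rightarrow> 'i \<Rightarrow> 'v \<Rightarrow> 'v \<Rightarrow> 'v fls"
  where "Y i k u x = base i k (proj i u) (proj k x)"

lemma Y_eq: "u \<in> W i \<Longrightarrow> x \<in> W k \<Longrightarrow> Y i k u x = base i k u x"
  by (simp add: Y_def proj_id)

lemma Y_in [simp]: "Y i k u x $$ n \<in> W (i + k)"
  unfolding Y_def by (rule I_in[OF base_in])

lemma comp_right_nth:
  assumes "Y1 \<in> \<I> i j" shows "comp_right Y1 Y2 u v x $$ n $$ m = Y1 u (Y2 v x $$ n) $$ m"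
  unfolding comp_right_def by (simp add: fls_map_nth I_0[OF assms])

lemma comp_left_nth:
  assumes "Y1 \<in> \<I> i j" shows "comp_left Y1 Y2 u v x $$ p $$ n = Y1 (Y2 u v $$ p) x $$ n"
  unfolding comp_left_def by (simp add: fls_map_nth I_0[OF assms])

lemma Y_right: "Y i (j + k) u (Y j k v x $$ n) $$ m
    = comp_right (base i (j + k)) (base j k) (proj i u) (proj j v) (proj k x) $$ n $$ m"
  by (simp add: comp_right_nth[OF base_in] Y_def[of i] proj_id) (simp add: Y_def)

lemma Y_left: "Y (i + j) k (Y i j u v $$ p) x $$ n
    = comp_left (base (i + j) k) (base i j) (proj i u) (proj j v) (proj k x) $$ p $$ n"
  by (simp add: comp_left_nth[OF base_in] Y_def[of "i + j"] proj_id) (simp add: Y_def)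

text \<open>The product and the map that the iterate expands are nonzero vectors of the same line,
  hence proportional by a nonzero scalar.\<close>

lemma assoc_ex: "\<exists>c. c \<noteq> 0 \<and> (\<forall>u v x. \<exists>N Z. expands (\<lambda>m n. Y i (j + k) u (Y j k v x $$ n) $$ m) c
      (\<lambda>p n. Y (i + j) k (Y i j u v $$ p) x $$ n) N Z)"
proof -
  obtain K h where K: "one_dimensional K" "tensor2_iso comp_right (\<I> i (j + k)) (\<I> j k) K"
    "tensor2_iso h (\<I> (i + j) k) (\<I> i j) K"
    and h: "\<forall>m1\<in>\<I> (i + j) k. \<forall>m2\<in>\<I> i j. \<forall>u\<in>W i. \<forall>v\<in>W j. \<forall>x\<in>W k.
            same_zw_assoc (W (i + j + k)) (h m1 m2 u v x) (comp_left m1 m2 u v x)"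
    using datum unfolding commutativity_datum_def associativity_datum_def by meson
  have 1: "comp_right (base i (j + k)) (base j k) \<noteq> 0 \<and> comp_right (base i (j + k)) (base j k) \<in> K"
    by (rule tensor2_iso_nonzero[OF K(2) one_dim one_dim base_in base_nz base_in base_nz])
  have 2: "h (base (i + j) k) (base i j) \<noteq> 0 \<and> h (base (i + j) k) (base i j) \<in> K"
    by (rule tensor2_iso_nonzero[OF K(3) one_dim one_dim base_in base_nz base_in base_nz])
  obtain c where c: "comp_right (base i (j + k)) (base j k) = c *\<^sub>C h (base (i + j) k) (base i j)"
    using one_dimensional_scale[OF K(1)] 1 2 by blast
  have "c \<noteq> 0" using c 1 by auto
  moreover have "\<exists>N Z. expands (\<lambda>m n. Y i (j + k) u (Y j k v x $$ n) $$ m) c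
      (\<lambda>p n. Y (i + j) k (Y i j u v $$ p) x $$ n) N Z" for u v x
  proof -
    have "same_zw_assoc (W (i + j + k)) (h (base (i + j) k) (base i j) (proj i u) (proj j v) (proj k x))
        (comp_left (base (i + j) k) (base i j) (proj i u) (proj j v) (proj k x))"
      using h base_in by simp
    then obtain N f where f: "f \<in> powser2 (W (i + j + k))"
      "h (base (i + j) k) (base i j) (proj i u) (proj j v) (proj k x) = expand_z_w N f"
      "comp_left (base (i + j) k) (base i j) (proj i u) (proj j v) (proj k x) = expand_w_zw N f"
      unfolding same_zw_assoc_def by blast
    show ?thesis unfolding Y_right Y_left f(3)
      by (intro exI, rule expands_expand[OF f(1)]) (simp add: c scaleC_fun_def f(2))
  qed
  ultimately show ?thesis by blast
qed

definition phi :: "'i \<Rightarrow> 'i \<Rightarrow> 'i \<Rightarrow> complex"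
  where "phi i j k = (SOME c. c \<noteq> 0 \<and> (\<forall>u v x. \<exists>N Z. expands (\<lambda>m n. Y i (j + k) u (Y j k v x $$ n) $$ m) c
      (\<lambda>p n. Y (i + j) k (Y i j u v $$ p) x $$ n) N Z))"

lemma phi: "phi i j k \<noteq> 0" "\<exists>N Z. expands (\<lambda>m n. Y i (j + k) u (Y j k v x $$ n) $$ m) (phi i j k)
      (\<lambda>p n. Y (i + j) k (Y i j u v $$ p) x $$ n) N Z"
  using someI_ex[OF assoc_ex[of i j k]] unfolding phi_def by blast+

lemma skew_ex: "\<exists>c. c \<noteq> 0 \<and> base j i = c *\<^sub>C skew (Lop (M (i + j)) (-1)) (base i j)"
proof -
  have "skew (Lop (M (i + j)) (-1)) (base i j) \<in> \<I> j i"
    using datum base unfolding commutativity_datum_def by blast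
  moreover have "skew (Lop (M (i + j)) (-1)) (base i j) \<noteq> 0"
    by (rule skew_nonzero[OF _ base_nz]) (simp add: Lop_0 modes_m1)
  ultimately obtain c where c: "base j i = c *\<^sub>C skew (Lop (M (i + j)) (-1)) (base i j)"
    using one_dimensional_scale[OF one_dim _ _ base_in] by blast
  then have "c \<noteq> 0" using base_nz[of j i] by auto
  then show ?thesis using c by blast
qed

definition om :: "'i \<Rightarrow> 'i \<Rightarrow> complex"
  where "om i j = (SOME c. c \<noteq> 0 \<and> base j i = c *\<^sub>C skew (Lop (M (i + j)) (-1)) (base i j))"

lemma om: "om i j \<noteq> 0" "base j i = om i j *\<^sub>C skew (Lop (M (i + j)) (-1)) (base i j)"
  using someI_ex[OF skew_ex[of j i]] unfolding om_def by blast+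

text \<open>Iteration of the L(-1)-derivative property. The product (n+1)...(n+r) is written with a
  factorial, which cancels that of the exponential series.\<close>

lemma derivative_pow:
  assumes "a \<in> W i"
  shows "(Lop (M i) (-1) ^^ r) a \<in> W i \<and> Y i k ((Lop (M i) (-1) ^^ r) a) x $$ n
    = (fact r * (of_int (n + int r) gchoose r)) *\<^sub>C (Y i k a x $$ (n + int r))"
proof (induction r arbitrary: n)
  case 0
  then show ?case using assms by simp
next
  case (Suc r)
  define b where "b = (Lop (M i) (-1) ^^ r) a"
  have b: "b \<in> W i" using Suc.IH[of 0] by (simp add: b_def)
  have "ddz (Y i k b x) = Y i k (Lop (M i) (-1) b) x"
    using intertwinerD[OF base_in[of i k]] b Lop_in[OF modes_m1 b]
    by (simp add: Y_def proj_id intertwiners_def)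
  then have "Y i k (Lop (M i) (-1) b) x $$ n = of_int (n + 1) *\<^sub>C (Y i k b x $$ (n + 1))"
    by (metis ddz_nth)
  also have "Y i k b x $$ (n + 1) = (fact r * (of_int (n + 1 + int r) gchoose r)) *\<^sub>C (Y i k a x $$ (n + 1 + int r))"
    using Suc.IH[of "n + 1"] by (simp add: b_def)
  also have "of_int (n + 1) *\<^sub>C (fact r * (of_int (n + 1 + int r) gchoose r)) *\<^sub>C (Y i k a x $$ (n + 1 + int r))
    = (fact (Suc r) * (of_int (n + int (Suc r)) gchoose (Suc r))) *\<^sub>C (Y i k a x $$ (n + int (Suc r)))"
  proof -
    define y :: complex where "y = of_int (n + 1 + int r)"
    have "of_nat (Suc r) * (y gchoose Suc r) = (y - of_nat r) * (y gchoose r)"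
      using gbinomial_mult_1[of y r] by (simp add: algebra_simps)
    moreover have "y - of_nat r = of_int (n + 1)" by (simp add: y_def)
    ultimately have "of_int (n + 1) * (fact r * (y gchoose r)) = fact (Suc r) * (y gchoose Suc r)"
      by (simp add: mult.left_commute mult.assoc del: of_nat_Suc)
    moreover have "n + int (Suc r) = n + 1 + int r" by simp
    ultimately show ?thesis by (simp only: scaleC_scaleC y_def)
  qed
  finally show ?case using Lop_in[OF modes_m1 b] by (simp add: b_def)
qed

lemma Y_sum_left:
  assumes "\<And>r. r \<in> A \<Longrightarrow> a r \<in> W i"
  shows "Y i k (\<Sum>r\<in>A. a r) x = (\<Sum>r\<in>A. Y i k (a r) x)"
proof -
  have "(\<Sum>r\<in>A. a r) \<in> W i" by (rule cvec.subspace_sum[OF subspace_W]) (use assms in auto)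
  moreover have "base i k (\<Sum>r\<in>A. a r) (proj k x) = (\<Sum>r\<in>A. base i k (a r) (proj k x))"
    by (rule tensor2_map_sum[OF tensor2[OF base_in[of i k]] subspace_W subspace_W]) (simp_all add: assms)
  ultimately show ?thesis by (simp add: Y_def proj_id assms)
qed

lemma Y_scale_left: "a \<in> W i \<Longrightarrow> Y i k (c *\<^sub>C a) x = c *\<^sub>C Y i k a x"
  using I_add(4)[OF base_in[of i k]] by (simp add: Y_def proj_scale)

text \<open>Up to \<open>om i j\<close>, the series for \<open>v\<close>, \<open>u\<close> in z - w
  is exp((z-w) L(-1)) applied to the one for \<open>u\<close>, \<open>v\<close> in w - z. Inside the
  outer operator the exponential acts by differentiation in w.\<close>

lemma skew_iterate:
  assumes N: "\<forall>p< - int N. Y i j u v $$ p = 0"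
  shows "Y (i + j) k (Y j i v u $$ (int q - int N)) x $$ n = (om i j * (-1) ^ N) *\<^sub>C
        (\<Sum>r\<le>q. ((-1) ^ (q - r) * (of_int (n + int r) gchoose r)) *\<^sub>C
          (Y (i + j) k (Y i j u v $$ (int q - int r - int N)) x $$ (n + int r)))"
proof -
  define D where "D = Lop (M (i + j)) (-1)"
  define F where "F = Y i j u v"
  have D0: "D 0 = 0" by (simp add: D_def Lop_0 modes_m1)
  have Fin: "F $$ p \<in> W (i + j)" for p by (simp add: F_def)
  have nF: "neg_arg F $$ (int q - int N - int r) = ((-1) ^ N * (-1) ^ (q - r)) *\<^sub>C (F $$ (int q - int r - int N))" if "r \<le> q" for r
  proof -
    have "even (int q - int N - int r) \<longleftrightarrow> even (N + (q - r))" using that by presburger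
    then show ?thesis by (auto simp: neg_arg_nth power_add[symmetric] scaleC_one algebra_simps)
  qed
  have N': "\<forall>p< - int N. neg_arg F $$ p = 0" using N by (simp add: neg_arg_nth F_def)
  have Din: "(D ^^ r) (c *\<^sub>C (F $$ p)) \<in> W (i + j)" for r c p
    using derivative_pow[of "c *\<^sub>C (F $$ p)" "i + j"] Fin cvec.subspace_scale[OF subspace_W] unfolding D_def by blast
  have "Y j i v u = om i j *\<^sub>C exp_z D (neg_arg F)"
    unfolding Y_def[of j i] om(2)[of j i] by (simp add: scaleC_fun_def skew_def D_def F_def Y_def)
  then have "Y j i v u $$ (int q - int N) = om i j *\<^sub>C (\<Sum>r\<le>q. inverse (fact r) *\<^sub>C
      (D ^^ r) (((-1) ^ N * (-1) ^ (q - r)) *\<^sub>C (F $$ (int q - int r - int N))))"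
    by (simp add: exp_z_nth[where D = D and F = "neg_arg F" and N = N, OF D0 N'] nF cong: sum.cong_simp)
  also have "\<dots> = (\<Sum>r\<le>q. (om i j * inverse (fact r)) *\<^sub>C
      (D ^^ r) (((-1) ^ N * (-1) ^ (q - r)) *\<^sub>C (F $$ (int q - int r - int N))))"
    by (simp add: cvec.scale_sum_right)
  finally have "Y (i + j) k (Y j i v u $$ (int q - int N)) x $$ n
      = (\<Sum>r\<le>q. (om i j * inverse (fact r)) *\<^sub>C (Y (i + j) k
      ((D ^^ r) (((-1) ^ N * (-1) ^ (q - r)) *\<^sub>C (F $$ (int q - int r - int N)))) x $$ n))"
    by (simp add: Y_sum_left Din cvec.subspace_scale[OF subspace_W] Y_scale_left)
  also have "\<dots> = (\<Sum>r\<le>q. (om i j * inverse (fact r)) *\<^sub>C (fact r * (of_int (n + int r) gchoose r)) *\<^sub>C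
      ((-1) ^ N * (-1) ^ (q - r)) *\<^sub>C (Y (i + j) k (F $$ (int q - int r - int N)) x $$ (n + int r)))"
  proof (rule sum.cong[OF refl])
    fix r
    have "((-1) ^ N * (-1) ^ (q - r)) *\<^sub>C (F $$ (int q - int r - int N)) \<in> W (i + j)"
      using Fin cvec.subspace_scale[OF subspace_W] by blast
    from derivative_pow[OF this, of r k x n]
    show "(om i j * inverse (fact r)) *\<^sub>C (Y (i + j) k
      ((D ^^ r) (((-1) ^ N * (-1) ^ (q - r)) *\<^sub>C (F $$ (int q - int r - int N)))) x $$ n)
     = (om i j * inverse (fact r)) *\<^sub>C (fact r * (of_int (n + int r) gchoose r)) *\<^sub>C
      ((-1) ^ N * (-1) ^ (q - r)) *\<^sub>C (Y (i + j) k (F $$ (int q - int r - int N)) x $$ (n + int r))"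
      by (simp only: D_def Y_scale_left[OF Fin] fls_scaleC_nth)
  qed
  also have "\<dots> = (om i j * (-1) ^ N) *\<^sub>C
        (\<Sum>r\<le>q. ((-1) ^ (q - r) * (of_int (n + int r) gchoose r)) *\<^sub>C
          (Y (i + j) k (F $$ (int q - int r - int N)) x $$ (n + int r)))"
    by (simp add: cvec.scale_sum_right field_simps)
  finally show ?thesis by (simp only: F_def)
qed

text \<open>Condition (ii) makes the triple composition nonzero. Coefficients with an argument
  outside its module vanish, so a nonzero one occurs at arguments where \<open>Y\<close> and
  \<open>base\<close> agree.\<close>

lemma nonzero4: "\<exists>y u v x n m s. Y l (i + j + k) y (Y i (j + k) u (Y j k v x $$ n) $$ m) $$ s \<noteq> 0"
proof -
  have "comp_right3 (base l (i + j + k)) (base i (j + k)) (base j k) \<noteq> 0"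
  proof -
    obtain K where "tensor3_iso comp_right3 (\<I> l (i + j + k)) (\<I> i (j + k)) (\<I> j k) K"
      using datum unfolding commutativity_datum_def associativity_datum_def by meson
    then show ?thesis by (rule tensor3_iso_nonzero) (simp_all add: one_dim base)
  qed
  then obtain y u v x where "comp_right3 (base l (i + j + k)) (base i (j + k)) (base j k) y u v x \<noteq> 0"
    by (auto simp: fun_eq_iff)
  then obtain n m s where nz: "comp_right3 (base l (i + j + k)) (base i (j + k)) (base j k) y u v x $$ n $$ m $$ s \<noteq> 0"
    by (auto simp: fls_eq_iff)
  have z: "comp_right (base l (i + j + k)) (base i (j + k)) y u 0 = 0"
    by (simp add: fls_eq_iff comp_right_nth[OF base_in] I_0[OF base_in])
  have nz': "base l (i + j + k) y (base i (j + k) u (base j k v x $$ n) $$ m) $$ s \<noteq> 0"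
    using nz by (simp add: comp_right3_def fls_map_nth z comp_right_nth[OF base_in])
  have out: "base a b u x = 0" if "u \<notin> W a \<or> x \<notin> W b" for a b u x
    using tensor2[OF base_in[of a b]] that by (simp add: tensor2_map_def)
  have y: "y \<in> W l" by (rule ccontr) (use nz' in \<open>simp add: out\<close>)
  have u: "u \<in> W i" by (rule ccontr) (use nz' in \<open>simp add: out I_0[OF base_in]\<close>)
  have vx: "v \<in> W j" "x \<in> W k"
    by (rule ccontr, use nz' in \<open>simp add: out I_0[OF base_in]\<close>)+
  have in1: "base j k v x $$ n \<in> W (j + k)" by (rule I_in[OF base_in])
  have in2: "base i (j + k) u (base j k v x $$ n) $$ m \<in> W (i + j + k)"
    using I_in[OF base_in[of i "j + k"]] by (simp add: add.assoc)
  show ?thesis using nz' y u vx in1 in2 Y_eq by metis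
qed

text \<open>The intertwining condition of \<open>base j k\<close>, read as a statement about degrees
  \<open>0\<close>, \<open>j\<close>, \<open>k\<close> since \<open>base 0\<close> is the
  action.\<close>

lemma module_same_all:
  "same_all (W (j + k)) (comp_right (act (M (j + k))) (base j k) (proj 0 u) (proj j v) (proj k x))
    (comp_left (base j k) (act (M j)) (proj 0 u) (proj j v) (proj k x))
    (comp_right (base j k) (act (M k)) (proj j v) (proj 0 u) (proj k x))"
  using intertwinerD[OF base_in[of j k]] proj_in[of 0] by (simp add: intertwiners_def M_0_simps)

lemma unit_local: "\<exists>N. (delta ^^ N) (\<lambda>m n. Y 0 (j + k) u (Y j k v x $$ n) $$ m)
      = (delta ^^ N) (\<lambda>m n. Y j k v (Y 0 k u x $$ m) $$ n)"
  using same_all_local[OF module_same_all[of j k u v x]] Y_right[of 0 j k u v x] Y_right[of j 0 k v u x]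
  by (simp add: base_def)

lemma unit_expands: "\<exists>N Z. expands (\<lambda>m n. Y 0 (j + k) u (Y j k v x $$ n) $$ m) 1
      (\<lambda>p n. Y (0 + j) k (Y 0 j u v $$ p) x $$ n) N Z"
  using same_all_expands[OF module_same_all[of j k u v x]] Y_right[of 0 j k u v x] Y_left[of 0 j k u v _ x]
  by (simp add: base_def)

end


section \<open>Rescaled structure maps and evenness on doubles\<close>

context fusion_datum
begin

sublocale fusion phi om Y
proof unfold_locales
  fix i j k :: 'i and u v x y :: 'v and c :: complex and N q :: nat and n :: int
  show "phi i j k \<noteq> 0" "om i j \<noteq> 0" by (rule phi om)+
  show "Y i k 0 x = 0" by (simp add: Y_def I_0[OF base_in])
  show "Y i k u (x + y) = Y i k u x + Y i k u y"
    by (simp add: Y_def proj_add I_add(1)[OF base_in])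
  show "Y i k u (c *\<^sub>C x) = c *\<^sub>C Y i k u x"
    by (simp add: Y_def proj_scale I_add(3)[OF base_in])
  show "\<exists>N Z. expands (\<lambda>m n. Y i (j + k) u (Y j k v x $$ n) $$ m) (phi i j k)
      (\<lambda>p n. Y (i + j) k (Y i j u v $$ p) x $$ n) N Z" by (rule phi)
qed (fact skew_iterate nonzero4 unit_expands unit_local)+

text \<open>Rescaling by \<open>\<mu>\<close> multiplies the products in the two orders by
  \<open>\<mu> i (j + k) * \<mu> j k\<close> and \<open>\<mu> j (i + k) * \<mu> i k\<close>, whose
  ratio cancels \<open>B i j k\<close>.\<close>

lemma coherent_choice:
  obtains m where
    "\<And>i j. i \<in> doubles \<Longrightarrow> m i j \<in> \<I> i j \<and> m i j \<noteq> 0"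
    "\<And>j. m 0 j = act (M j)"
    "\<And>i. i \<in> doubles \<Longrightarrow> i \<noteq> 0 \<Longrightarrow> m i 0 = skew (Lop (M i) (-1)) (act (M i))"
    "\<And>i j k u v x. i \<in> doubles \<Longrightarrow> j \<in> doubles \<Longrightarrow> u \<in> W i \<Longrightarrow> v \<in> W j \<Longrightarrow> x \<in> W k \<Longrightarrow>
      \<exists>N. (delta ^^ N) (\<lambda>a b. m i (j + k) u (m j k v x $$ b) $$ a)
        = (delta ^^ N) (\<lambda>a b. m j (i + k) v (m i k u x $$ a) $$ b)"
proof -
  obtain \<mu> where \<mu>: "\<And>i k. i \<in> doubles \<Longrightarrow> \<mu> i k \<noteq> 0" "\<And>i. i \<in> doubles \<Longrightarrow> \<mu> i 0 = 1" "\<And>k. \<mu> 0 k = 1"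
    "\<And>i j k. i \<in> doubles \<Longrightarrow> j \<in> doubles \<Longrightarrow> \<mu> i (j + k) * \<mu> j k * B i j k = \<mu> j (i + k) * \<mu> i k"
    using trivialization by metis
  define m where "m = (\<lambda>i j. \<mu> i j *\<^sub>C base i j)"
  have m_comp: "m i l u (m j k v x $$ b) $$ a = (\<mu> i l * \<mu> j k) *\<^sub>C (Y i l u (Y j k v x $$ b) $$ a)"
    if "u \<in> W i" "v \<in> W j" "x \<in> W k" "l = j + k" for i j k l u v x a b
    using that I_in[OF base_in, of j k v x b]
    by (simp add: m_def scaleC_fun_def Y_eq I_add(3)[OF base_in])
  show ?thesis
  proof (rule that[of m])
    fix i j k u v x
    assume ij: "i \<in> doubles" "j \<in> doubles" and uvx: "u \<in> W i" "v \<in> W j" "x \<in> W k"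
    obtain N where N: "(delta ^^ N) (\<lambda>a b. Y i (j + k) u (Y j k v x $$ b) $$ a)
      = B i j k *\<^sub>C (delta ^^ N) (\<lambda>a b. Y j (i + k) v (Y i k u x $$ a) $$ b)" using local_ex by blast
    have "(delta ^^ N) (\<lambda>a b. m i (j + k) u (m j k v x $$ b) $$ a)
      = (\<mu> i (j + k) * \<mu> j k) *\<^sub>C (delta ^^ N) (\<lambda>a b. Y i (j + k) u (Y j k v x $$ b) $$ a)"
      by (simp add: m_comp uvx flip: delta_pow_scale) (simp add: scaleC_fun_def)
    also have "\<dots> = (\<mu> j (i + k) * \<mu> i k) *\<^sub>C (delta ^^ N) (\<lambda>a b. Y j (i + k) v (Y i k u x $$ a) $$ b)"
      using \<mu>(4)[OF ij, of k] by (simp add: N)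
    also have "\<dots> = (delta ^^ N) (\<lambda>a b. m j (i + k) v (m i k u x $$ a) $$ b)"
      by (simp add: m_comp uvx flip: delta_pow_scale) (simp add: scaleC_fun_def)
    finally show "\<exists>N. (delta ^^ N) (\<lambda>a b. m i (j + k) u (m j k v x $$ b) $$ a)
        = (delta ^^ N) (\<lambda>a b. m j (i + k) v (m i k u x $$ a) $$ b)" by blast
  next
    fix i j assume "i \<in> (doubles :: 'i set)"
    then show "m i j \<in> \<I> i j \<and> m i j \<noteq> 0"
      using \<mu>(1) base[of i j] one_dim[of i j] by (auto simp: m_def one_dimensional_def cvec.subspace_scale)
  qed (simp_all add: m_def \<mu> base_def scaleC_one)
qed

text \<open>\<open>om i i = 1\<close> says that \<open>base i i\<close> equals its own skew;
  evenness is unaffected by nonzero scalars.\<close>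

lemma even_datum_doubles:
  assumes "i \<in> doubles" "m \<in> \<I> i i" "m \<noteq> 0"
  shows "even_intertwiner (W i) m"
proof -
  define D where "D = Lop (M (i + i)) (-1)"
  have "om i i = 1" using assms(1) om_double unfolding doubles_def by blast
  then have base_skew: "skew D (base i i) = base i i" using om(2)[of i i] by (simp add: D_def scaleC_one)
  obtain c where c: "m = c *\<^sub>C base i i" using one_dimensional_scale[OF one_dim base_in base_nz assms(2)] by blast
  then have cnz: "c \<noteq> 0" using assms(3) by auto
  have "even_intertwiner (W i) (base i i)"
    by (rule even_intertwinerI[OF tensor2[OF base_in] base_skew])
      (simp_all add: D_def Lop_0 modes_m1 subspace_W)
  moreover have "fls_subdegree (c *\<^sub>C F) = fls_subdegree F" for F :: "'v fls"
    using cnz by (simp add: fls_subdegree_def)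
  ultimately show ?thesis
    unfolding c even_intertwiner_def using cnz by (simp add: scaleC_fun_def)
qed

end

section \<open>The direct sum\<close>

lemma single_add: "single k (x + y) = single k x + (single k y :: 'i \<Rightarrow> 'v::ab_group_add)"
  by (simp add: single_def fun_eq_iff)

lemma single_diff: "single k (x - y) = single k x - (single k y :: 'i \<Rightarrow> 'v::ab_group_add)"
  by (simp add: single_def fun_eq_iff)

lemma single_scale: "single k (c *\<^sub>C x) = c *\<^sub>C (single k x :: 'i \<Rightarrow> 'v::complex_vector)"
  by (simp add: single_def scaleC_fun_def fun_eq_iff)

lemma single_0: "single k 0 = (0 :: 'i \<Rightarrow> 'v::ab_group_add)"
  by (simp add: single_def fun_eq_iff)

lemma single_sum: "single k (\<Sum>a\<in>A. F a) = (\<Sum>a\<in>A. single k (F a) :: 'i \<Rightarrow> 'v::ab_group_add)"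
  by (induction A rule: infinite_finite_induct) (simp_all add: single_0 single_add)

lemma fls_map_single_nth: "fls_map (single k) F $$ n = (single k (F $$ n) :: 'i \<Rightarrow> 'v::ab_group_add)"
  by (rule fls_map_nth) (rule single_0)

lemma dsum_space_subspace:
  assumes "\<And>k. k \<in> S \<Longrightarrow> cvec.subspace (U k)"
  shows "cvec.subspace (dsum_space S U)"
proof (rule cvec.subspaceI)
  show "0 \<in> dsum_space S U" using assms by (auto simp: dsum_space_def intro: cvec.subspace_0)
next
  fix f g assume fg: "f \<in> dsum_space S U" "g \<in> dsum_space S U"
  have "{k. (f + g) k \<noteq> 0} \<subseteq> {k. f k \<noteq> 0} \<union> {k. g k \<noteq> 0}" by auto
  then have "finite {k. (f + g) k \<noteq> 0}" by (rule finite_subset) (use fg in \<open>auto simp: dsum_space_def\<close>)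
  then show "f + g \<in> dsum_space S U" using fg assms by (auto simp: dsum_space_def cvec.subspace_add)
next
  fix c f assume f: "f \<in> dsum_space S U"
  have "{k. (c *\<^sub>C f) k \<noteq> 0} \<subseteq> {k. f k \<noteq> 0}" by (auto simp: scaleC_fun_def)
  then have "finite {k. (c *\<^sub>C f) k \<noteq> 0}" by (rule finite_subset) (use f in \<open>auto simp: dsum_space_def\<close>)
  then show "c *\<^sub>C f \<in> dsum_space S U" using f assms by (auto simp: dsum_space_def cvec.subspace_scale scaleC_fun_def)
qed

lemma single_in_dsum_space:
  assumes "k \<in> S" "x \<in> U k" "\<And>k. k \<in> S \<Longrightarrow> cvec.subspace (U k)"
  shows "single k x \<in> dsum_space S U"
proof -
  have "{j. single k x j \<noteq> 0} \<subseteq> {k}" by (auto simp: single_def)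
  then have "finite {j. single k x j \<noteq> 0}" by (rule finite_subset) simp
  then show ?thesis using assms by (auto simp: dsum_space_def single_def intro: cvec.subspace_0)
qed

text \<open>Elements are finite sums of homogeneous ones, so additive statements need a check on
  \<open>single k x\<close> only.\<close>

lemma dsum_space_induct [consumes 2, case_names single add]:
  assumes f: "f \<in> dsum_space S U" and sub: "\<And>k. k \<in> S \<Longrightarrow> cvec.subspace (U k)"
    and single: "\<And>k x. k \<in> S \<Longrightarrow> x \<in> U k \<Longrightarrow> P (single k x)"
    and add: "\<And>f g. f \<in> dsum_space S U \<Longrightarrow> g \<in> dsum_space S U \<Longrightarrow> P f \<Longrightarrow> P g \<Longrightarrow> P (f + g)"
    and ne: "S \<noteq> {}"
  shows "P f"
proof -
  have "finite {k. f k \<noteq> 0}" using f by (simp add: dsum_space_def)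
  moreover have "\<forall>f. f \<in> dsum_space S U \<longrightarrow> {k. f k \<noteq> 0} \<subseteq> A \<longrightarrow> P f" if "finite A" for A
    using that
  proof (induction A)
    case empty
    obtain k where "k \<in> S" using ne by blast
    then have "P (single k 0)" using sub by (intro single) (auto intro: cvec.subspace_0)
    then have "P 0" by (simp add: single_0)
    moreover have "f = 0" if "{k. f k \<noteq> 0} \<subseteq> {}" for f :: "'a \<Rightarrow> 'b" using that by (auto simp: fun_eq_iff)
    ultimately show ?case by blast
  next
    case (insert a A)
    show ?case
    proof (intro allI impI)
      fix f assume f: "f \<in> dsum_space S U" "{k. f k \<noteq> 0} \<subseteq> insert a A"
      show "P f"
      proof (cases "a \<in> S")
        case False
        then have "f a = 0" using f(1) by (simp add: dsum_space_def)
        then show ?thesis using f insert.IH by blast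
      next
        case True
        have fa: "f a \<in> U a" using True f(1) by (simp add: dsum_space_def)
        define g where "g = f - single a (f a)"
        have g: "g \<in> dsum_space S U" unfolding g_def
          by (intro cvec.subspace_diff dsum_space_subspace sub f single_in_dsum_space True fa)
        have "{k. g k \<noteq> 0} \<subseteq> A" using f(2) by (auto simp: g_def single_def split: if_splits)
        then have "P g" using g insert.IH by blast
        then have "P (single a (f a) + g)"
          by (intro add g single True fa single_in_dsum_space sub)
        then show ?thesis by (simp add: g_def)
      qed
    qed
  qed
  ultimately show ?thesis using f by blast
qed

declare plus_fun_apply [simp del] zero_fun_apply [simp del]

section \<open>The bilinear multiplication on the direct sum\<close>

locale fusion_choice = fusion_datum T V M \<I>
  for T :: "'g setting"
    and V :: "('g, 'v::complex_vector) vertex"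
    and M :: "'i::ab_group_add \<Rightarrow> ('g, 'v, 'v) vmod"
    and \<I> :: "'i \<Rightarrow> 'i \<Rightarrow> ('v \<Rightarrow> 'v \<Rightarrow> 'v fls) set" +
  fixes m :: "'i \<Rightarrow> 'i \<Rightarrow> 'v \<Rightarrow> 'v \<Rightarrow> 'v fls"
  assumes compat: "compatible T V doubles M"
    and m_in: "i \<in> doubles \<Longrightarrow> m i j \<in> \<I> i j"
    and m_0_left: "m 0 j = act (M j)"
    and m_0_right: "i \<in> doubles \<Longrightarrow> i \<noteq> 0 \<Longrightarrow> m i 0 = skew (Lop (M i) (-1)) (act (M i))"
    and m_local: "i \<in> doubles \<Longrightarrow> j \<in> doubles \<Longrightarrow> u \<in> W i \<Longrightarrow> v \<in> W j \<Longrightarrow> x \<in> W k \<Longrightarrow>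
      \<exists>N. (delta ^^ N) (\<lambda>a b. m i (j + k) u (m j k v x $$ b) $$ a)
        = (delta ^^ N) (\<lambda>a b. m j (i + k) v (m i k u x $$ a) $$ b)"
begin

definition X :: "('g, 'i \<Rightarrow> 'v) vertex" where "X = dsum_vertex V doubles M m"

abbreviation DS :: "('i \<Rightarrow> 'v) set" where "DS \<equiv> dsum_space doubles W"

lemma vs_X: "vs X = DS" by (simp add: X_def dsum_vertex_def)

lemma act_X: "act X f h = (if f \<in> DS \<and> h \<in> DS
    then \<Sum>i | f i \<noteq> 0. \<Sum>j | h j \<noteq> 0. fls_map (single (i + j)) (m i j (f i) (h j)) else 0)"
  by (simp add: X_def dsum_vertex_def)

lemma Lop_X: "Lop X n f k = (if k \<in> doubles then Lop (M k) n (f k) else 0)"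
  by (simp add: X_def dsum_vertex_def)

lemma gact_X: "gact X g f k = (if k \<in> doubles then gact (M k) g (f k) else 0)"
  by (simp add: X_def dsum_vertex_def)

lemma vac_X: "vac X = single 0 (vac V)" by (simp add: X_def dsum_vertex_def)

lemma omega_X: "omega X = single 0 (omega V)" by (simp add: X_def dsum_vertex_def)

lemma subspace_DS: "cvec.subspace DS"
  by (intro dsum_space_subspace subspace_W)

lemma single_DS: "i \<in> doubles \<Longrightarrow> x \<in> W i \<Longrightarrow> single i x \<in> DS"
  by (intro single_in_dsum_space subspace_W)

lemma DS_induct [consumes 1, case_names single add]:
  assumes "f \<in> DS" "\<And>k x. k \<in> doubles \<Longrightarrow> x \<in> W k \<Longrightarrow> P (single k x)"
    "\<And>f g. f \<in> DS \<Longrightarrow> g \<in> DS \<Longrightarrow> P f \<Longrightarrow> P g \<Longrightarrow> P (f + g)"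
  shows "P f"
  using assms doubles_0 by (intro dsum_space_induct[of f doubles W P]) (auto simp: subspace_W)

lemmas m_zero = I_0[OF m_in] and m_add = I_add[OF m_in] and m_W = I_in[OF m_in]

lemma DS_supp: "f \<in> DS \<Longrightarrow> finite {i. f i \<noteq> 0}" "f \<in> DS \<Longrightarrow> {i. f i \<noteq> 0} \<subseteq> doubles"
  "f \<in> DS \<Longrightarrow> i \<in> doubles \<Longrightarrow> f i \<in> W i"
  by (auto simp: dsum_space_def)

text \<open>Index sets larger than the supports allow sums for different elements to be compared
  term by term.\<close>

lemma act_X_sum:
  assumes f: "f \<in> DS" and h: "h \<in> DS" and A: "finite A" "{i. f i \<noteq> 0} \<subseteq> A" "A \<subseteq> doubles"
    and J: "finite J" "{j. h j \<noteq> 0} \<subseteq> J"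
  shows "act X f h = (\<Sum>i\<in>A. \<Sum>j\<in>J. fls_map (single (i + j)) (m i j (f i) (h j)))"
proof -
  have z: "fls_map (single k) 0 = (0 :: ('i \<Rightarrow> 'v) fls)" for k :: 'i by (simp add: fls_eq_iff fls_map_single_nth single_0)
  have inner: "(\<Sum>j | h j \<noteq> 0. fls_map (single (i + j)) (m i j (f i) (h j)))
     = (\<Sum>j\<in>J. fls_map (single (i + j)) (m i j (f i) (h j)))" if "i \<in> doubles" for i
    by (rule sum.mono_neutral_left) (use J that in \<open>auto simp: m_zero z\<close>)
  have "act X f h = (\<Sum>i | f i \<noteq> 0. \<Sum>j\<in>J. fls_map (single (i + j)) (m i j (f i) (h j)))"
    unfolding act_X using f h A by (simp, intro sum.cong refl inner) auto
  also have "\<dots> = (\<Sum>i\<in>A. \<Sum>j\<in>J. fls_map (single (i + j)) (m i j (f i) (h j)))"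
    by (rule sum.mono_neutral_left) (use A in \<open>auto simp: m_zero z\<close>)
  finally show ?thesis .
qed

lemma fls_map_single_add: "fls_map (single k) (F + G) = fls_map (single k) F + (fls_map (single k) G :: ('i \<Rightarrow> 'v) fls)"
  by (simp add: fls_eq_iff fls_map_single_nth single_add)

lemma fls_map_single_scale: "fls_map (single k) (c *\<^sub>C F) = c *\<^sub>C (fls_map (single k) F :: ('i \<Rightarrow> 'v) fls)"
  by (simp add: fls_eq_iff fls_map_single_nth single_scale)

lemma act_X_add_left:
  assumes "f \<in> DS" "g \<in> DS" "h \<in> DS" shows "act X (f + g) h = act X f h + act X g h"
proof -
  define A where "A = {i. f i \<noteq> 0} \<union> {i. g i \<noteq> 0}"
  define J where "J = {j. h j \<noteq> 0}"
  have A: "finite A" "{i. f i \<noteq> 0} \<subseteq> A" "{i. g i \<noteq> 0} \<subseteq> A" "{i. (f + g) i \<noteq> 0} \<subseteq> A" "A \<subseteq> doubles"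
    using DS_supp assms by (auto simp: A_def plus_fun_apply)
  have J: "finite J" "{j. h j \<noteq> 0} \<subseteq> J" "J \<subseteq> doubles" using DS_supp assms by (auto simp: J_def)
  have "m i j ((f + g) i) (h j) = m i j (f i) (h j) + m i j (g i) (h j)" if "i \<in> A" "j \<in> J" for i j
  proof -
    have "i \<in> doubles" "j \<in> doubles" using that A J by auto
    then show ?thesis using assms DS_supp(3) by (simp add: m_add(2) plus_fun_apply)
  qed
  then show ?thesis
    using act_X_sum[OF _ assms(3) A(1) A(2) A(5) J(1,2)] act_X_sum[OF _ assms(3) A(1) A(3) A(5) J(1,2)]
      act_X_sum[OF _ assms(3) A(1) A(4) A(5) J(1,2)] assms cvec.subspace_add[OF subspace_DS assms(1,2)]
    by (simp add: fls_map_single_add sum.distrib)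
qed

lemma act_X_add_right:
  assumes "f \<in> DS" "g \<in> DS" "h \<in> DS" shows "act X h (f + g) = act X h f + act X h g"
proof -
  define A where "A = {i. f i \<noteq> 0} \<union> {i. g i \<noteq> 0}"
  define J where "J = {j. h j \<noteq> 0}"
  have A: "finite A" "{i. f i \<noteq> 0} \<subseteq> A" "{i. g i \<noteq> 0} \<subseteq> A" "{i. (f + g) i \<noteq> 0} \<subseteq> A" "A \<subseteq> doubles"
    using DS_supp assms by (auto simp: A_def plus_fun_apply)
  have J: "finite J" "{j. h j \<noteq> 0} \<subseteq> J" "J \<subseteq> doubles" using DS_supp assms by (auto simp: J_def)
  have "m i j (h i) ((f + g) j) = m i j (h i) (f j) + m i j (h i) (g j)" if "i \<in> J" "j \<in> A" for i j
  proof -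
    have "i \<in> doubles" "j \<in> doubles" using that A J by auto
    then show ?thesis using assms DS_supp(3) by (simp add: m_add(1) plus_fun_apply)
  qed
  then show ?thesis
    using act_X_sum[OF assms(3) _ J(1,2,3) A(1,2)] act_X_sum[OF assms(3) _ J(1,2,3) A(1,3)]
      act_X_sum[OF assms(3) _ J(1,2,3) A(1,4)] assms cvec.subspace_add[OF subspace_DS assms(1,2)]
    by (simp add: fls_map_single_add sum.distrib)
qed

lemma act_X_scale:
  assumes "f \<in> DS" "h \<in> DS"
  shows "act X (c *\<^sub>C f) h = c *\<^sub>C act X f h" "act X f (c *\<^sub>C h) = c *\<^sub>C act X f h"
proof -
  define A where "A = {i. f i \<noteq> 0}"
  define J where "J = {j. h j \<noteq> 0}"
  have A: "finite A" "{i. f i \<noteq> 0} \<subseteq> A" "{i. (c *\<^sub>C f) i \<noteq> 0} \<subseteq> A" "A \<subseteq> doubles"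
    using DS_supp assms by (auto simp: A_def scaleC_fun_def)
  have J: "finite J" "{j. h j \<noteq> 0} \<subseteq> J" "{j. (c *\<^sub>C h) j \<noteq> 0} \<subseteq> J" "J \<subseteq> doubles"
    using DS_supp assms by (auto simp: J_def scaleC_fun_def)
  have in': "f i \<in> W i" "h j \<in> W j" "i \<in> doubles" if "i \<in> A" "j \<in> J" for i j
    using that A J assms DS_supp(3) by auto
  have sc: "c *\<^sub>C f \<in> DS" "c *\<^sub>C h \<in> DS" using assms by (simp_all add: cvec.subspace_scale[OF subspace_DS])
  show "act X (c *\<^sub>C f) h = c *\<^sub>C act X f h"
    unfolding act_X_sum[OF assms A(1,2,4) J(1,2)] act_X_sum[OF sc(1) assms(2) A(1,3,4) J(1,2)]
    by (simp add: cvec.scale_sum_right scaleC_fun_def m_add(4) in' fls_map_single_scale cong: sum.cong_simp)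
  show "act X f (c *\<^sub>C h) = c *\<^sub>C act X f h"
    unfolding act_X_sum[OF assms A(1,2,4) J(1,2)] act_X_sum[OF assms(1) sc(2) A(1,2,4) J(1,3)]
    by (simp add: cvec.scale_sum_right scaleC_fun_def m_add(3) in' fls_map_single_scale cong: sum.cong_simp)
qed

lemma act_X_single:
  assumes "i \<in> doubles" "j \<in> doubles" "x \<in> W i" "y \<in> W j"
  shows "act X (single i x) (single j y) = fls_map (single (i + j)) (m i j x y)"
  by (subst act_X_sum[where A = "{i}" and J = "{j}"])
    (use assms in \<open>simp_all add: single_DS, auto simp: single_def split: if_splits\<close>)

lemma act_X_single_nth:
  assumes "i \<in> doubles" "j \<in> doubles" "x \<in> W i" "y \<in> W j"
  shows "act X (single i x) (single j y) $$ n = single (i + j) (m i j x y $$ n)"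
  by (simp add: act_X_single[OF assms] fls_map_single_nth)

lemma act_X_in: "f \<in> DS \<Longrightarrow> h \<in> DS \<Longrightarrow> act X f h $$ n \<in> DS"
proof (induction f rule: DS_induct)
  case (single i x)
  show ?case using single(3)
  proof (induction h rule: DS_induct)
    case (single j y)
    show ?case unfolding act_X_single_nth[OF \<open>i \<in> doubles\<close> single(1) \<open>x \<in> W i\<close> single(2)]
      by (rule single_DS[OF doubles_add m_W]) (use \<open>i \<in> doubles\<close> single in auto)
  next
    case (add f g)
    then show ?case using single_DS[OF single(1,2)] cvec.subspace_add[OF subspace_DS] by (simp add: act_X_add_right)
  qed
next
  case (add f g)
  then show ?case using cvec.subspace_add[OF subspace_DS] by (simp add: act_X_add_left)
qed

lemma tensor2_X: "tensor2_map DS DS (laurent DS) (act X)"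
  unfolding tensor2_map_def bilinear_on_def linear_on_def
  by (auto simp: laurent_def act_X_in act_X_add_left act_X_add_right act_X_scale) (auto simp: act_X)

lemmas act_X_0 = tensor2_map_0[OF tensor2_X subspace_DS subspace_DS]

lemma biadditive_eqI:
  fixes E E' :: "('i \<Rightarrow> 'v) \<Rightarrow> ('i \<Rightarrow> 'v) \<Rightarrow> 'c::ab_group_add"
  assumes "u \<in> DS" "v \<in> DS"
    and "\<And>f g h. f \<in> DS \<Longrightarrow> g \<in> DS \<Longrightarrow> h \<in> DS \<Longrightarrow> E (f + g) h = E f h + E g h"
    and "\<And>f g h. f \<in> DS \<Longrightarrow> g \<in> DS \<Longrightarrow> h \<in> DS \<Longrightarrow> E' (f + g) h = E' f h + E' g h"
    and "\<And>f g h. f \<in> DS \<Longrightarrow> g \<in> DS \<Longrightarrow> h \<in> DS \<Longrightarrow> E h (f + g) = E h f + E h g"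
    and "\<And>f g h. f \<in> DS \<Longrightarrow> g \<in> DS \<Longrightarrow> h \<in> DS \<Longrightarrow> E' h (f + g) = E' h f + E' h g"
    and *: "\<And>i j x y. i \<in> doubles \<Longrightarrow> j \<in> doubles \<Longrightarrow> x \<in> W i \<Longrightarrow> y \<in> W j \<Longrightarrow> E (single i x) (single j y) = E' (single i x) (single j y)"
  shows "E u v = E' u v"
  using assms(1)
proof (induction u rule: DS_induct)
  case (single i x)
  show ?case using assms(2)
    by (induction v rule: DS_induct) (simp_all add: * single single_DS assms)
qed (simp add: assms)

lemma vmodule_sum: "vmodule T V (dsum_module doubles M)"
  using compat by (simp add: compatible_def)

text \<open>These conditions involve only the space and the operators, which the direct sum shares
  with \<open>dsum_module\<close>; compatibility provides them, including the finiteness conditions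
  for VOAs.\<close>

lemma lie_X: "lie_operators (kind T) DS (Lop X)"
  using vmodule_sum by (simp add: vmodule_def dsum_module_def X_def dsum_vertex_def)

lemma group_X: "group_operators T X"
  using vmodule_sum by (simp add: vmodule_def dsum_module_def X_def dsum_vertex_def group_operators_def)

lemma Lop_X_linear: "n \<in> modes (kind T) \<Longrightarrow> linear_on DS DS (Lop X n)"
  using lie_X by (simp add: lie_operators_def)

lemma Lop_X_single: "n \<in> modes (kind T) \<Longrightarrow> i \<in> doubles \<Longrightarrow> Lop X n (single i x) = single i (Lop (M i) n x)"
  by (auto simp: fun_eq_iff Lop_X single_def Lop_0)

lemma Lop_X_in: "n \<in> modes (kind T) \<Longrightarrow> f \<in> DS \<Longrightarrow> Lop X n f \<in> DS"
  and Lop_X_add: "n \<in> modes (kind T) \<Longrightarrow> f \<in> DS \<Longrightarrow> g \<in> DS \<Longrightarrow> Lop X n (f + g) = Lop X n f + Lop X n g"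
  using Lop_X_linear unfolding linear_on_def by blast+

lemma Lop_X_0: "n \<in> modes (kind T) \<Longrightarrow> Lop X n 0 = 0"
  using Lop_X_add[of n 0 0] cvec.subspace_0[OF subspace_DS] by simp

lemma gact_linear:
  assumes "symm T = Some G" "g \<in> carrier G"
  shows "linear_on (W i) (W i) (gact (M i) g)" "linear_on DS DS (gact X g)"
proof -
  have "group_operators T (M i)" using modules[of i] by (simp add: vmodule_def)
  then show "linear_on (W i) (W i) (gact (M i) g)" using assms unfolding group_operators_def by blast
  show "linear_on DS DS (gact X g)" using group_X assms unfolding group_operators_def vs_X by blast
qed

lemma linear_on_0: "linear_on U U' h \<Longrightarrow> cvec.subspace U \<Longrightarrow> h 0 = 0"
  unfolding linear_on_def by (metis cvec.scale_zero_left cvec.subspace_0)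

lemma gact_X_single:
  assumes "symm T = Some G" "g \<in> carrier G" "i \<in> doubles"
  shows "gact X g (single i x) = single i (gact (M i) g x)"
  using linear_on_0[OF gact_linear(1)[OF assms(1,2)] subspace_W] assms(3)
  by (auto simp: fun_eq_iff gact_X single_def)

lemma intertwiner_m:
  assumes "i \<in> doubles"
  shows "m i j \<in> intertwiners T V (M i) (M j) (M (i + j))"
  by (rule intertwinerD[OF m_in[OF assms]])

section \<open>The axioms of a vertex algebra\<close>

lemma vac_W: "vac V \<in> W 0"
  using alg by (simp add: vertex_algebra_def M_0_simps)

lemma vacuum_X: "v \<in> DS \<Longrightarrow> act X (vac X) v = fls_const v"
proof (induction v rule: DS_induct)
  case (single j y)
  then have "act (M j) (vac V) y = fls_const y" using modules[of j] by (simp add: vmodule_def)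
  then show ?case using single
    by (simp add: vac_X fls_eq_iff act_X_single_nth doubles_0 vac_W m_0_left single_0)
next
  case (add f g)
  then show ?case using single_DS[OF doubles_0 vac_W] by (simp add: vac_X act_X_add_right fls_eq_iff single_0)
qed

text \<open>For \<open>i \<noteq> 0\<close> the map is the skew of an action: acting by the vacuum
  yields the constant series \<open>x\<close>, and the exponential adds positive powers of z
  only.\<close>

lemma m_creation:
  assumes "i \<in> doubles" "x \<in> W i"
  shows "m i 0 x (vac V) $$ 0 = x \<and> (\<forall>n<0. m i 0 x (vac V) $$ n = 0)"
proof (cases "i = 0")
  case True
  then show ?thesis using alg assms by (simp add: m_0_left vertex_algebra_def M_0_simps)
next
  case False
  have c: "act (M i) (vac V) x = fls_const x" using modules[of i] assms by (simp add: vmodule_def)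
  have "m i 0 x (vac V) $$ p = (if p = 0 then x else 0)" if "p \<le> 0" for p
    unfolding m_0_right[OF assms(1) False]
    by (subst skew_lead) (use that in \<open>auto simp: c Lop_0 modes_m1\<close>)
  then show ?thesis by simp
qed

lemma creation_X: "v \<in> DS \<Longrightarrow> act X v (vac X) $$ 0 = v \<and> (\<forall>n<0. act X v (vac X) $$ n = 0)"
proof (induction v rule: DS_induct)
  case (single i x)
  then show ?case using m_creation[of i x]
    by (simp add: vac_X act_X_single_nth doubles_0 vac_W single_0)
next
  case (add f g)
  then show ?case using single_DS[OF doubles_0 vac_W] by (simp add: vac_X act_X_add_left)
qed

lemma fls_map_Lop_nth: "n \<in> modes (kind T) \<Longrightarrow> fls_map (Lop X n) F $$ p = Lop X n (F $$ p)"
  by (simp add: fls_map_nth Lop_X_0)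

lemma derivative_X:
  assumes "u \<in> DS" "v \<in> DS"
  shows "fls_map (Lop X (-1)) (act X u v) - act X u (Lop X (-1) v) = ddz (act X u v)"
proof (rule biadditive_eqI[OF assms])
  fix i j x y assume 1: "i \<in> doubles" "j \<in> doubles" "x \<in> W i" "y \<in> W j"
  have "ddz (m i j x y) = fls_map (Lop (M (i + j)) (-1)) (m i j x y) - m i j x (Lop (M j) (-1) y)"
    using intertwiner_m[OF 1(1), of j] 1 unfolding intertwiners_def by blast
  then have "ddz (m i j x y) $$ n = Lop (M (i + j)) (-1) (m i j x y $$ n) - m i j x (Lop (M j) (-1) y) $$ n" for n
    by (simp add: fls_map_nth Lop_0 modes_m1)
  then show "fls_map (Lop X (-1)) (act X (single i x) (single j y)) - act X (single i x) (Lop X (-1) (single j y))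
      = ddz (act X (single i x) (single j y))"
    using 1 Lop_in[OF modes_m1]
    by (simp add: fls_eq_iff fls_map_Lop_nth modes_m1 act_X_single_nth Lop_X_single doubles_add ddz_nth
        flip: single_diff single_scale)
qed (simp_all add: fls_eq_iff fls_map_Lop_nth modes_m1 act_X_add_left act_X_add_right act_X_in Lop_X_add Lop_X_in ddz_nth scaleC_add_right)

lemma covariance_modes_modes:
  assumes "i \<in> covariance_modes k"
  shows "i \<in> modes k" "-1 \<le> i" "l \<le> nat (i + 1) \<Longrightarrow> i - int l \<in> modes k"
  using assms by (cases k; auto)+

text \<open>Intertwining operators are covariant for all modes from -1 on, which include the modes
  demanded of an algebra.\<close>

lemma covariant_X:
  assumes i: "i \<in> covariance_modes (kind T)"
  shows "covariant i X X X (act X)"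
  unfolding covariant_def vs_X
proof (intro ballI, rule biadditive_eqI)
  note mode = covariance_modes_modes[OF i]
  fix a b x y assume 1: "a \<in> doubles" "b \<in> doubles" "x \<in> W a" "y \<in> W b"
  have "covariant i (M a) (M b) (M (a + b)) (m a b)"
    using intertwiner_m[OF 1(1)] mode by (simp add: intertwiners_def)
  then have "fls_map (Lop (M (a + b)) i) (m a b x y) - m a b x (Lop (M b) i y) =
    (\<Sum>l\<le>nat (i + 1). of_nat (nat (i + 1) choose l) *\<^sub>C fls_shift (- int l) (m a b (Lop (M a) (i - int l) x) y))"
    using 1 by (simp add: covariant_def)
  then have "(fls_map (Lop (M (a + b)) i) (m a b x y) - m a b x (Lop (M b) i y)) $$ n =
    (\<Sum>l\<le>nat (i + 1). of_nat (nat (i + 1) choose l) *\<^sub>C fls_shift (- int l) (m a b (Lop (M a) (i - int l) x) y)) $$ n" for n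
    by simp
  then have cov: "Lop (M (a + b)) i (m a b x y $$ n) - m a b x (Lop (M b) i y) $$ n =
    (\<Sum>l\<le>nat (i + 1). of_nat (nat (i + 1) choose l) *\<^sub>C (m a b (Lop (M a) (i - int l) x) y $$ (n - int l)))" for n
    by (simp add: fls_map_nth Lop_0 mode)
  have *: "act X (single a (Lop (M a) (i - int l) x)) (single b y) $$ n = single (a + b) (m a b (Lop (M a) (i - int l) x) y $$ n)"
    if "l \<le> nat (i + 1)" for l n
    using 1 Lop_in[OF mode(3)[OF that]] by (simp add: act_X_single_nth)
  show "fls_map (Lop X i) (act X (single a x) (single b y)) - act X (single a x) (Lop X i (single b y)) =
       (\<Sum>l\<le>nat (i + 1). of_nat (nat (i + 1) choose l) *\<^sub>C fls_shift (- int l) (act X (Lop X (i - int l) (single a x)) (single b y)))"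
    using 1 Lop_in[OF mode(1)]
    by (simp add: fls_eq_iff fls_map_Lop_nth mode act_X_single_nth Lop_X_single doubles_add * cong: sum.cong_simp)
      (simp add: cov single_sum single_scale flip: single_diff)
qed (use covariance_modes_modes[OF i] in \<open>simp_all add: fls_eq_iff fls_map_Lop_nth act_X_add_left act_X_add_right act_X_in
      Lop_X_add Lop_X_in scaleC_add_right sum.distrib cong: sum.cong_simp\<close>)

lemma equivariant_X: "equivariant T X X X (act X)"
  unfolding equivariant_def vs_X
proof (intro allI impI ballI)
  fix G g u v
  assume G: "symm T = Some G" "g \<in> carrier G" and uv: "u \<in> DS" "v \<in> DS"
  have lin: "gact X g (f + h) = gact X g f + gact X g h" "gact X g f \<in> DS" if "f \<in> DS" "h \<in> DS" for f h
    using gact_linear(2)[OF G] that unfolding linear_on_def by blast+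
  have g0: "gact X g 0 = 0" by (rule linear_on_0[OF gact_linear(2)[OF G] subspace_DS])
  show "act X (gact X g u) (gact X g v) = fls_map (gact X g) (act X u v)"
  proof (rule biadditive_eqI[OF uv])
    fix i j x y assume 1: "i \<in> doubles" "j \<in> doubles" "x \<in> W i" "y \<in> W j"
    have g0': "gact (M k) g 0 = 0" for k by (rule linear_on_0[OF gact_linear(1)[OF G] subspace_W])
    have gW: "gact (M k) g z \<in> W k" if "z \<in> W k" for k z using gact_linear(1)[OF G] that unfolding linear_on_def by blast
    have "m i j (gact (M i) g x) (gact (M j) g y) = fls_map (gact (M (i + j)) g) (m i j x y)"
      using intertwiner_m[OF 1(1)] 1 G by (simp add: intertwiners_def equivariant_def)
    then show "act X (gact X g (single i x)) (gact X g (single j y)) = fls_map (gact X g) (act X (single i x) (single j y))"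
      using 1 gW by (simp add: fls_eq_iff gact_X_single[OF G] act_X_single_nth fls_map_nth g0 g0' doubles_add)
  qed (simp_all add: fls_eq_iff fls_map_nth g0 lin act_X_add_left act_X_add_right act_X_in)
qed

text \<open>The exponent may depend on all three elements, as in the axiom. The property is thus
  additive in each argument: for a sum, take an exponent that works for both terms.\<close>

definition local_triple :: "('i \<Rightarrow> 'v) \<Rightarrow> ('i \<Rightarrow> 'v) \<Rightarrow> ('i \<Rightarrow> 'v) \<Rightarrow> bool"
  where "local_triple u v x \<longleftrightarrow> (\<exists>N. (delta ^^ N) (\<lambda>a b. act X u (act X v x $$ b) $$ a) = (delta ^^ N) (\<lambda>a b. act X v (act X u x $$ a) $$ b))"

lemma local_add:
  assumes "\<exists>N. (delta ^^ N) P = (delta ^^ N) R" "\<exists>N. (delta ^^ N) P' = (delta ^^ N) R'"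
  shows "\<exists>N. (delta ^^ N) (P + P') = (delta ^^ N) (R + R')"
proof -
  obtain N N' where N: "(delta ^^ N) P = (delta ^^ N) R" "(delta ^^ N') P' = (delta ^^ N') R'" using assms by blast
  have "(delta ^^ (N + N')) P = (delta ^^ (N + N')) R" "(delta ^^ (N + N')) P' = (delta ^^ (N + N')) R'"
    using delta_pow_mono[OF N(1)] delta_pow_mono[OF N(2)] by simp_all
  then show ?thesis by (metis delta_pow_add)
qed

lemma local_X: "u \<in> DS \<Longrightarrow> v \<in> DS \<Longrightarrow> x \<in> DS \<Longrightarrow> local_triple u v x"
proof (induction u arbitrary: v x rule: DS_induct)
  case (single i u)
  note i = single
  show ?case using i(3,4)
  proof (induction v arbitrary: x rule: DS_induct)
    case (single j v)
    note j = single
    show ?case using j(3)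
    proof (induction x rule: DS_induct)
      case (single k x)
      obtain N where N: "(delta ^^ N) (\<lambda>a b. m i (j + k) u (m j k v x $$ b) $$ a)
        = (delta ^^ N) (\<lambda>a b. m j (i + k) v (m i k u x $$ a) $$ b)"
        using m_local[OF i(1) j(1) i(2) j(2) single(2)] by blast
      have 1: "(\<lambda>a b. act X (single i u) (act X (single j v) (single k x) $$ b) $$ a)
         = (\<lambda>a b. single (i + (j + k)) (m i (j + k) u (m j k v x $$ b) $$ a))"
        using i j single m_W[OF j(1)] by (simp add: act_X_single_nth doubles_add)
      have 2: "(\<lambda>a b. act X (single j v) (act X (single i u) (single k x) $$ a) $$ b)
         = (\<lambda>a b. single (i + (j + k)) (m j (i + k) v (m i k u x $$ a) $$ b))"
        using i j single m_W[OF i(1)] by (simp add: act_X_single_nth doubles_add add.left_commute[of i])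
      show ?case unfolding local_triple_def 1 2
        by (rule exI[of _ N]) (simp only: delta_pow_hom[of "single (i + (j + k))", OF single_diff] N)
    next
      case (add f g)
      note su = single_DS[OF i(1,2)] and sv = single_DS[OF j(1,2)]
      have "(\<lambda>a b. act X (single i u) (act X (single j v) (f + g) $$ b) $$ a) =
        (\<lambda>a b. act X (single i u) (act X (single j v) f $$ b) $$ a) + (\<lambda>a b. act X (single i u) (act X (single j v) g $$ b) $$ a)"
        using add su sv by (simp add: fun_eq_iff plus_fun_apply act_X_add_right act_X_in)
      moreover have "(\<lambda>a b. act X (single j v) (act X (single i u) (f + g) $$ a) $$ b) =
        (\<lambda>a b. act X (single j v) (act X (single i u) f $$ a) $$ b) + (\<lambda>a b. act X (single j v) (act X (single i u) g $$ a) $$ b)"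
        using add su sv by (simp add: fun_eq_iff plus_fun_apply act_X_add_right act_X_in)
      ultimately show ?case using local_add add(3,4) unfolding local_triple_def by simp
    qed
  next
    case (add f g)
    note su = single_DS[OF i(1,2)]
    have "(\<lambda>a b. act X (single i u) (act X (f + g) x $$ b) $$ a) =
      (\<lambda>a b. act X (single i u) (act X f x $$ b) $$ a) + (\<lambda>a b. act X (single i u) (act X g x $$ b) $$ a)"
      using add su by (simp add: fun_eq_iff plus_fun_apply act_X_add_right act_X_add_left act_X_in)
    moreover have "(\<lambda>a b. act X (f + g) (act X (single i u) x $$ a) $$ b) =
      (\<lambda>a b. act X f (act X (single i u) x $$ a) $$ b) + (\<lambda>a b. act X g (act X (single i u) x $$ a) $$ b)"
      using add su by (simp add: fun_eq_iff plus_fun_apply act_X_add_left act_X_in)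
    ultimately show ?case using local_add add(3,4)[OF add(5)] unfolding local_triple_def by simp
  qed
next
  case (add f g)
  have "(\<lambda>a b. act X (f + g) (act X v x $$ b) $$ a) =
    (\<lambda>a b. act X f (act X v x $$ b) $$ a) + (\<lambda>a b. act X g (act X v x $$ b) $$ a)"
    using add by (simp add: fun_eq_iff plus_fun_apply act_X_add_left act_X_in)
  moreover have "(\<lambda>a b. act X v (act X (f + g) x $$ a) $$ b) =
    (\<lambda>a b. act X v (act X f x $$ a) $$ b) + (\<lambda>a b. act X v (act X g x $$ a) $$ b)"
    using add by (simp add: fun_eq_iff plus_fun_apply act_X_add_left act_X_add_right act_X_in)
  ultimately show ?case using local_add add(3,4)[OF add(5,6)] unfolding local_triple_def by simp
qed

lemma comp_right_X_nth: "comp_right (act X) (act X) u v x $$ n $$ k = act X u (act X v x $$ n) $$ k"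
  by (simp add: comp_right_def fls_map_nth act_X_0)

lemma same_X:
  assumes "u \<in> DS" "v \<in> DS" "x \<in> DS"
  shows "same_zw_wz DS (comp_right (act X) (act X) u v x) (comp_right (act X) (act X) v u x)"
proof -
  obtain N where "(delta ^^ N) (\<lambda>a b. act X u (act X v x $$ b) $$ a) = (delta ^^ N) (\<lambda>a b. act X v (act X u x $$ a) $$ b)"
    using local_X[OF assms] unfolding local_triple_def by blast
  then show ?thesis
    by (intro same_zw_wzI[of DS _ _ N]) (simp_all add: subspace_DS comp_right_X_nth act_X_in assms)
qed

lemma modes_conformal: "is_conformal k \<Longrightarrow> modes k = UNIV"
  by (cases k) auto

lemma omega_W: "is_conformal (kind T) \<Longrightarrow> omega V \<in> W 0"
  using alg by (simp add: vertex_algebra_def weight_space_def M_0_simps)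

lemma omega_weight: "is_conformal (kind T) \<Longrightarrow> omega X \<in> weight_space DS (Lop X 0) 2"
  using alg omega_W single_DS[OF doubles_0 omega_W]
  by (simp add: vertex_algebra_def weight_space_def omega_X Lop_X_single modes_conformal doubles_0 M_0_simps single_scale)

text \<open>The conformal vector sits in degree 0 and \<open>m 0 j\<close> is the action, so this is
  the conformal condition on each module.\<close>

lemma omega_modes:
  assumes c: "is_conformal (kind T)" and v: "v \<in> DS"
  shows "Lop X n v = act X (omega X) v $$ (- n - 2)"
  using v
proof (induction v rule: DS_induct)
  case (single j y)
  have "Lop (M j) n y = act (M j) (omega V) y $$ (- n - 2)"
    using modules[of j] c single by (simp add: vmodule_def)
  then show ?case using single omega_W[OF c] c
    by (simp add: omega_X act_X_single_nth doubles_0 Lop_X_single modes_conformal m_0_left)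
next
  case (add f g)
  then show ?case using single_DS[OF doubles_0 omega_W[OF c]] c
    by (simp add: omega_X act_X_add_right Lop_X_add modes_conformal)
qed

lemma gact_vac_X: "symm T = Some G \<Longrightarrow> g \<in> carrier G \<Longrightarrow> gact X g (vac X) = vac X \<and>
      (is_conformal (kind T) \<longrightarrow> gact X g (omega X) = omega X)"
  using alg by (simp add: vertex_algebra_def vac_X omega_X gact_X_single doubles_0 M_0_simps)

lemma vertex_algebra_X: "vertex_algebra T X"
  unfolding vertex_algebra_def vs_X
  using subspace_DS single_DS[OF doubles_0 vac_W] tensor2_X lie_X vacuum_X creation_X derivative_X same_X
    covariant_X omega_weight omega_modes group_X equivariant_X gact_vac_X
  by (intro conjI) (simp_all add: vac_X)

end

section \<open>Groups of odd order and conclusion\<close>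

lemma funpow_plus_0:
  fixes x :: "'a::ab_group_add"
  shows "(((+) x) ^^ (a + b)) 0 = (((+) x) ^^ a) 0 + (((+) x) ^^ b) 0"
  by (induction a) (simp_all add: add.assoc)

text \<open>Lagrange's theorem in the form \<open>|A| x = 0\<close>: translation by \<open>x\<close> permutes the group.\<close>

lemma odd_order_doubles:
  assumes "finite (UNIV :: 'i::ab_group_add set)" "odd (card (UNIV :: 'i set))"
  shows "(doubles :: 'i set) = UNIV"
proof -
  have "x \<in> doubles" for x :: 'i
  proof -
    have sum_const: "(\<Sum>y\<in>B. x) = (((+) x) ^^ card B) 0" if "finite B" for B :: "'i set"
      using that by (induction B) simp_all
    have "(\<Sum>y\<in>(UNIV :: 'i set). y) = (\<Sum>y\<in>(UNIV :: 'i set). x + y)"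
      by (rule sum.reindex_bij_witness[where i="\<lambda>y. x + y" and j="\<lambda>y. y - x"]) auto
    then have "(\<Sum>y\<in>(UNIV :: 'i set). x) = 0" by (simp add: sum.distrib)
    then have 0: "(((+) x) ^^ card (UNIV :: 'i set)) 0 = 0" using sum_const assms(1) by simp
    obtain k where k: "card (UNIV :: 'i set) = Suc (k + k)" using assms(2) by (metis oddE add_Suc_right mult_2 Suc_eq_plus1)
    \<comment> \<open>If the order is 2k+1, then (2k+1) x = 0 exhibits \<open>x\<close> as the
      double of - k x.\<close>
    define h where "h = (((+) x) ^^ k) 0"
    have "x + (h + h) = 0" using 0 unfolding k h_def by (simp add: funpow_plus_0)
    then have "x = - (h + h)" by (simp only: eq_neg_iff_add_eq_0)
    then have "x = - h + - h" by simp
    then show ?thesis unfolding doubles_def by blast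
  qed
  then show ?thesis by blast
qed

theorem corollary2p3p7:
  fixes T :: "'g setting"
    and V :: "('g, 'v::complex_vector) vertex"
    and M :: "'i::ab_group_add \<Rightarrow> ('g, 'v, 'v) vmod"
    and \<I> :: "'i \<Rightarrow> 'i \<Rightarrow> ('v \<Rightarrow> 'v \<Rightarrow> 'v fls) set"
  assumes "wf_setting T"
    and "vertex_algebra T V"
    and "\<And>i. vmodule T V (M i)"
    and "M 0 = vmod.truncate V"
    and "compatible T V doubles M"
    and "commutativity_datum T V M \<I>"
  shows "(\<exists>m. (\<forall>i\<in>doubles. \<forall>j\<in>doubles. m i j \<in> \<I> i j \<and> m i j \<noteq> 0) \<and>
            vertex_algebra T (dsum_vertex V doubles M m)) \<and>
         ((doubles :: 'i set) = UNIV \<longrightarrow> even_datum M \<I>) \<and>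
         (finite (UNIV :: 'i set) \<and> odd (card (UNIV :: 'i set)) \<longrightarrow>
            (doubles :: 'i set) = UNIV \<and> even_datum M \<I>)"
proof -
  interpret fusion_datum T V M \<I>
    by unfold_locales (fact assms)+
  obtain m where m: "\<And>i j. i \<in> doubles \<Longrightarrow> m i j \<in> \<I> i j \<and> m i j \<noteq> 0"
    "\<And>j. m 0 j = act (M j)"
    "\<And>i. i \<in> doubles \<Longrightarrow> i \<noteq> 0 \<Longrightarrow> m i 0 = skew (Lop (M i) (-1)) (act (M i))"
    "\<And>i j k u v x. i \<in> doubles \<Longrightarrow> j \<in> doubles \<Longrightarrow> u \<in> vs (M i) \<Longrightarrow> v \<in> vs (M j) \<Longrightarrow> x \<in> vs (M k) \<Longrightarrow>
      \<exists>N. (delta ^^ N) (\<lambda>a b. m i (j + k) u (m j k v x $$ b) $$ a)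
        = (delta ^^ N) (\<lambda>a b. m j (i + k) v (m i k u x $$ a) $$ b)"
    by (rule coherent_choice) blast
  interpret fusion_choice T V M \<I> m
    by unfold_locales (use m assms in blast)+
  have "even_datum M \<I>" if "(doubles :: 'i set) = UNIV"
    unfolding even_datum_def using even_datum_doubles that by blast
  then show ?thesis
    using m(1) vertex_algebra_X odd_order_doubles[where 'i = 'i] unfolding X_def by blast
qed

end
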